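(* There exists a universal constant $C>0$ such that the following holds. Let $s>0$ and let $P$ be an $s$-hypercontractive-subgaussian distribution over $\mathbb{R}^d$. Then $P$ is $Cs$-certifiably-hypercontractive-subgaussian.
   Context: Let $C_0>0$ be the universal constant chosen so that $\mathcal{N}(0,I_d)$ satisfies $\left(\mathbb{E}|\langle v,X\rangle|^m\right)^{1/m}\le C_0\sqrt{m}\|v\|_2$ for all $v$ and $m\ge1$. A distribution $Q$ on $\mathbb{R}^d$ with mean $\mu$ is $s$-hypercontractive-subgaussian if for all even $m\in\mathbb{N}$ and all $v\in\mathbb{R}^d$, $\left(\mathbb{E}_{X\sim Q}[\langle v,X-\mu\rangle^m]\right)^{1/m}\le C_0 s\sqrt{m}\left(\mathbb{E}_{X\sim Q}[\langle v,X-\mu\rangle^2]\right)^{1/2}$. It is $s$-certifiably-hypercontractive-subgaussian if for all even $m\in\mathbb{N}$ the polynomial $q_m(v)=(C_0 s\sqrt{m})^m\left(\mathbb{E}_{X\sim Q}[\langle v,X-\mu\rangle^2]\right)^{m/2}-\mathbb{E}_{X\sim Q}[\langle v,X-\mu\rangle^m]$ in the variables $v=(v_1,\dots,v_d)$ is a sum of squares of polynomials. *)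

theory Defs
  imports "HOL-Probability.Probability"
begin

text \<open>Vectors in R^d are represented as functions nat => real; only the
coordinates i < d matter. Distributions on R^d are probability measures on
the product sigma-algebra PiM {..<d} (\<lambda>_. borel).\<close>

definition inner_d :: "nat \<Rightarrow> (nat \<Rightarrow> real) \<Rightarrow> (nat \<Rightarrow> real) \<Rightarrow> real" where
  "inner_d d v x = (\<Sum>i<d. v i * x i)"

definition norm_d :: "nat \<Rightarrow> (nat \<Rightarrow> real) \<Rightarrow> real" where
  "norm_d d v = sqrt (\<Sum>i<d. (v i)^2)"

definition std_gaussian :: "nat \<Rightarrow> (nat \<Rightarrow> real) measure" where
  "std_gaussian d = PiM {..<d} (\<lambda>_. density lborel std_normal_density)"

definition gaussian_moment_const :: "real \<Rightarrow> bool" where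
  "gaussian_moment_const C0 \<longleftrightarrow> C0 > 0 \<and>
     (\<forall>d v (m::nat). m \<ge> 1 \<longrightarrow>
        (\<integral>x. \<bar>inner_d d v x\<bar> ^ m \<partial>std_gaussian d) powr (1 / real m)
          \<le> C0 * sqrt (real m) * norm_d d v)"

definition mean_d :: "(nat \<Rightarrow> real) measure \<Rightarrow> nat \<Rightarrow> real" where
  "mean_d P = (\<lambda>i. \<integral>x. x i \<partial>P)"

definition distr_d :: "nat \<Rightarrow> (nat \<Rightarrow> real) measure \<Rightarrow> bool" where
  "distr_d d P \<longleftrightarrow> prob_space P \<and> sets P = sets (PiM {..<d} (\<lambda>_. borel :: real measure)) \<and>
     (\<forall>i<d. integrable P (\<lambda>x. x i)) \<and>
     (\<forall>(m::nat) v. integrable P (\<lambda>x. (inner_d d v (\<lambda>i. x i - mean_d P i)) ^ m))"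

definition dir_moment :: "nat \<Rightarrow> (nat \<Rightarrow> real) measure \<Rightarrow> nat \<Rightarrow> (nat \<Rightarrow> real) \<Rightarrow> real" where
  "dir_moment d P m v = (\<integral>x. (inner_d d v (\<lambda>i. x i - mean_d P i)) ^ m \<partial>P)"

definition hypercontractive_subgaussian ::
    "real \<Rightarrow> nat \<Rightarrow> real \<Rightarrow> (nat \<Rightarrow> real) measure \<Rightarrow> bool" where
  "hypercontractive_subgaussian C0 d s P \<longleftrightarrow> distr_d d P \<and>
     (\<forall>(m::nat) v. even m \<and> m > 0 \<longrightarrow>
        dir_moment d P m v powr (1 / real m) \<le> C0 * s * sqrt (real m) * sqrt (dir_moment d P 2 v))"

inductive poly_fun :: "nat \<Rightarrow> ((nat \<Rightarrow> real) \<Rightarrow> real) \<Rightarrow> bool" for d where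
  const: "poly_fun d (\<lambda>v. c)"
| var: "i < d \<Longrightarrow> poly_fun d (\<lambda>v. v i)"
| add: "poly_fun d p \<Longrightarrow> poly_fun d q \<Longrightarrow> poly_fun d (\<lambda>v. p v + q v)"
| mult: "poly_fun d p \<Longrightarrow> poly_fun d q \<Longrightarrow> poly_fun d (\<lambda>v. p v * q v)"

definition sos_poly :: "nat \<Rightarrow> ((nat \<Rightarrow> real) \<Rightarrow> real) \<Rightarrow> bool" where
  "sos_poly d q \<longleftrightarrow> (\<exists>ps. (\<forall>p\<in>set ps. poly_fun d p) \<and> (\<forall>v. q v = (\<Sum>p\<leftarrow>ps. (p v)^2)))"

definition certifiably_hypercontractive_subgaussian ::
    "real \<Rightarrow> nat \<Rightarrow> real \<Rightarrow> (nat \<Rightarrow> real) measure \<Rightarrow> bool" where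
  "certifiably_hypercontractive_subgaussian C0 d s P \<longleftrightarrow> distr_d d P \<and>
     (\<forall>(m::nat). even m \<and> m > 0 \<longrightarrow>
        sos_poly d (\<lambda>v. (C0 * s * sqrt (real m)) ^ m * (dir_moment d P 2 v) ^ (m div 2)
                        - dir_moment d P m v))"

end

theory Submission
  imports Defs "HOL-Real_Asymp.Real_Asymp"
begin

text \<open>By duality in the finite-dimensional space of forms of degree \<open>m = 2 k\<close>, a form that is not a
  sum of squares is separated from the cone by a functional \<open>L\<close> that is nonnegative on squares. The
  function \<open>f x = L (\<langle>w, x\<rangle> ^ m)\<close> is a nonnegative form whose \<open>m\<close>-th root is a supremum of linear
  functionals \<open>\<langle>t, x\<rangle>\<close>, because the AM-GM inequality for two linear forms has a sum-of-squares
  certificate. After whitening it remains to bound \<open>E f(X)\<close> for a subgaussian \<open>X\<close> by its value for a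
  Gaussian, which \<open>L\<close> computes exactly. This is the comparison of suprema of
  subgaussian and Gaussian processes: chaining bounds the former by a sequence of
  nets, and the nets are built from the Gaussian width by van Handel's interpolation argument, whose only
  probabilistic input is a growth condition implied by the Sudakov-Fernique inequality.\<close>

section \<open>Gaussian product measures\<close>

text \<open>The obstacle is that \<open>L\<close> is not integration against a measure: it respects
  only inequalities that have a sum-of-squares certificate, so a pointwise bound on moments in the
  variable \<open>w\<close> says nothing about \<open>L\<close>. Exchanging the roles of the
  variables avoids this. The value of \<open>L\<close> at the moment form is the expectation of
  \<open>f\<close>, an ordinary function of \<open>x\<close>, and for \<open>f\<close> pointwise
  estimates are legitimate; the certificates are spent once, in relating \<open>f\<close> to the
  functionals \<open>t\<close>. The Gaussian value of \<open>f\<close> does not depend on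
  \<open>L\<close>: the Gaussian moment form of degree 2k is a multiple of |w|^(2k), at which
  \<open>L\<close> is normalised to 1. The functionals \<open>t x\<close> with
  \<open>f x = 1\<close> have Euclidean norm at most 2, and their finite subsets have Gaussian width
  at most 2 sqrt(m). Only these two numbers enter the comparison, so neither the dimension nor the
  size of the index set leaves a trace in the constant. Whitening makes the increments of the
  subgaussian process comparable to the Euclidean metric, which is the metric of the Gaussian
  process.\<close>

definition std_normal :: "real measure" where
  "std_normal = density lborel std_normal_density"

text \<open>The index type is arbitrary because the comparison in \<open>gwidth_growth\<close> runs
  on a Gaussian vector made of several blocks, indexed by pairs.\<close>

definition gauss :: "'j set \<Rightarrow> ('j \<Rightarrow> real) measure" where
  "gauss J = PiM J (\<lambda>_. std_normal)"

lemma sets_std_normal [simp, measurable_cong]: "sets std_normal = sets borel"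
  and space_std_normal [simp]: "space std_normal = UNIV"
  by (auto simp: std_normal_def)

lemma prob_space_std_normal: "prob_space std_normal"
  unfolding std_normal_def by (rule prob_space_normal_density) simp

lemma product_sigma_finite_std_normal: "product_sigma_finite (\<lambda>_. std_normal)"
  using prob_space_std_normal by (simp add: prob_space_imp_sigma_finite product_sigma_finite_def)

lemma prob_space_gauss: "prob_space (gauss J)"
  unfolding gauss_def by (intro prob_space_PiM prob_space_std_normal)

lemma measurable_gauss_component [measurable (raw)]: "j \<in> J \<Longrightarrow> (\<lambda>\<omega>. \<omega> j) \<in> borel_measurable (gauss J)"
proof -
  assume "j \<in> J"
  then have "(\<lambda>\<omega>. \<omega> j) \<in> measurable (gauss J) std_normal"
    unfolding gauss_def by (rule measurable_component_singleton)
  moreover have "borel_measurable (gauss J) = measurable (gauss J) std_normal"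
    by (rule measurable_cong_sets) auto
  ultimately show ?thesis by simp
qed

lemma
  fixes f :: "real \<Rightarrow> real"
  assumes f: "f \<in> borel_measurable borel"
  shows integrable_std_normal_iff: "integrable std_normal f \<longleftrightarrow> integrable lborel (\<lambda>x. std_normal_density x * f x)"
    and integral_std_normal: "integral\<^sup>L std_normal f = (\<integral>x. std_normal_density x * f x \<partial>lborel)"
proof -
  have 1: "f \<in> borel_measurable lborel" using f by (simp only: measurable_lborel2)
  have 2: "std_normal_density \<in> borel_measurable lborel"
    by (simp only: measurable_lborel2 borel_measurable_normal_density)
  have 3: "AE x in lborel. 0 \<le> std_normal_density x"
    by (rule AE_I2) (rule normal_density_nonneg)
  show "integrable std_normal f \<longleftrightarrow> integrable lborel (\<lambda>x. std_normal_density x * f x)"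
    using integrable_density[OF 1 2 3] unfolding std_normal_def real_scaleR_def .
  show "integral\<^sup>L std_normal f = (\<integral>x. std_normal_density x * f x \<partial>lborel)"
    using integral_density[OF 1 2 3] unfolding std_normal_def real_scaleR_def .
qed

lemma distr_gauss_component: "j \<in> J \<Longrightarrow> distr (gauss J) std_normal (\<lambda>\<omega>. \<omega> j) = std_normal"
  unfolding gauss_def by (rule distr_PiM_component) (auto intro: prob_space_std_normal)

lemma
  fixes f :: "real \<Rightarrow> real"
  assumes "j \<in> J" and f: "f \<in> borel_measurable borel"
  shows integral_gauss_component: "(\<integral>\<omega>. f (\<omega> j) \<partial>gauss J) = integral\<^sup>L std_normal f"
    and integrable_gauss_component_iff: "integrable (gauss J) (\<lambda>\<omega>. f (\<omega> j)) \<longleftrightarrow> integrable std_normal f"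
proof -
  have m: "(\<lambda>\<omega>. \<omega> j) \<in> measurable (gauss J) std_normal"
    unfolding gauss_def by (rule measurable_component_singleton) fact
  have f': "f \<in> borel_measurable std_normal" using f by simp
  show "(\<integral>\<omega>. f (\<omega> j) \<partial>gauss J) = integral\<^sup>L std_normal f"
    using integral_distr[OF m f'] distr_gauss_component[OF assms(1)] by simp
  show "integrable (gauss J) (\<lambda>\<omega>. f (\<omega> j)) \<longleftrightarrow> integrable std_normal f"
    using integrable_distr_eq[OF m f'] distr_gauss_component[OF assms(1)] by simp
qed

lemma gauss_component_integrable: "j \<in> J \<Longrightarrow> integrable (gauss J) (\<lambda>\<omega>. \<omega> j)"
  using integrable_gauss_component_iff[of j J "\<lambda>x. x"] integrable_std_normal_iff[of "\<lambda>x. x"]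
    integrable_std_normal_moment[of 1] by simp

lemma gauss_component_mean: "j \<in> J \<Longrightarrow> (\<integral>\<omega>. \<omega> j \<partial>gauss J) = 0"
  using integral_gauss_component[of j J "\<lambda>x. x"] integral_std_normal[of "\<lambda>x. x"]
    integral_std_normal_moment_odd[of 0] by simp

lemma gauss_component_abs: "j \<in> J \<Longrightarrow> (\<integral>\<omega>. \<bar>\<omega> j\<bar> \<partial>gauss J) = sqrt (2 / pi)"
  using integral_gauss_component[of j J "\<lambda>x. \<bar>x\<bar>"] integral_std_normal[of "\<lambda>x. \<bar>x\<bar>"]
    integral_std_normal_moment_abs_odd[of 0] by simp

lemma DERIV_std_normal_density:
  "(std_normal_density has_real_derivative - x * std_normal_density x) (at x)"
  unfolding normal_density_def
  by (auto intro!: derivative_eq_intros simp: field_simps power2_eq_square)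

lemma std_normal_density_at_top: "(std_normal_density \<longlongrightarrow> 0) at_top"
  unfolding normal_density_def by real_asymp

lemma std_normal_density_at_bot: "(std_normal_density \<longlongrightarrow> 0) at_bot"
  unfolding normal_density_def by real_asymp

text \<open>Stein's identity: \<open>u\<close> times the density has derivative
  \<open>u' x - x * u x\<close> times the density, and the product vanishes at both ends of the
  line.\<close>

lemma std_normal_ibp:
  fixes u u' :: "real \<Rightarrow> real"
  assumes der: "\<And>x. (u has_real_derivative u' x) (at x)"
    and cont: "continuous_on UNIV u'"
    and bd: "\<And>x. \<bar>u x\<bar> \<le> B" "\<And>x. \<bar>u' x\<bar> \<le> B"
  shows "(\<integral>x. x * u x \<partial>std_normal) = (\<integral>x. u' x \<partial>std_normal)"
proof -
  let ?n = std_normal_density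
  have cu: "continuous_on UNIV u" using der by (auto intro!: DERIV_continuous_on continuous_at_imp_continuous_on DERIV_isCont)
  have [measurable]: "u \<in> borel_measurable borel" "u' \<in> borel_measurable borel"
    using cu cont by (auto intro: borel_measurable_continuous_onI)
  have i1: "integrable lborel (\<lambda>x. ?n x * (x * u x))"
  proof (rule Bochner_Integration.integrable_bound[where f="\<lambda>x. B * (?n x * \<bar>x\<bar> ^ 1)"])
    show "AE x in lborel. norm (?n x * (x * u x)) \<le> norm (B * (?n x * \<bar>x\<bar> ^ 1))"
    proof (rule AE_I2)
      fix x
      have "?n x * \<bar>x\<bar> * \<bar>u x\<bar> \<le> ?n x * \<bar>x\<bar> * \<bar>B\<bar>"
        using bd(1)[of x] by (intro mult_left_mono) (auto simp: normal_density_nonneg)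
      then show "norm (?n x * (x * u x)) \<le> norm (B * (?n x * \<bar>x\<bar> ^ 1))"
        by (simp add: abs_mult normal_density_nonneg mult.assoc mult.left_commute mult.commute)
    qed
  qed (use integrable_std_normal_moment_abs[of 1] in auto)
  have i2: "integrable lborel (\<lambda>x. ?n x * u' x)"
  proof (rule Bochner_Integration.integrable_bound[where f="\<lambda>x. B * (?n x)"])
    show "AE x in lborel. norm (?n x * u' x) \<le> norm (B * ?n x)"
    proof (rule AE_I2)
      fix x
      have "?n x * \<bar>u' x\<bar> \<le> ?n x * \<bar>B\<bar>"
        using bd(2)[of x] by (intro mult_left_mono) (auto simp: normal_density_nonneg)
      then show "norm (?n x * u' x) \<le> norm (B * ?n x)"
        by (simp add: abs_mult normal_density_nonneg mult.assoc mult.left_commute mult.commute)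
    qed
  qed auto
  have lim: "((\<lambda>x. u x * ?n x) \<longlongrightarrow> 0) F" if "(?n \<longlongrightarrow> 0) F" for F
  proof (rule Lim_null_comparison[where g="\<lambda>x. B * ?n x"])
    show "\<forall>\<^sub>F x in F. norm (u x * ?n x) \<le> B * ?n x"
      using bd(1) by (auto simp: abs_mult normal_density_nonneg intro!: always_eventually mult_right_mono)
    show "((\<lambda>x. B * ?n x) \<longlongrightarrow> 0) F" using tendsto_mult_right_zero[OF that] by simp
  qed
  have "(LBINT x=-\<infinity>..\<infinity>. ?n x * u' x - ?n x * (x * u x)) = 0 - 0"
  proof (rule interval_integral_FTC_integrable[where F="\<lambda>x. u x * ?n x"])
    fix x :: real
    show "((\<lambda>x. u x * ?n x) has_vector_derivative ?n x * u' x - ?n x * (x * u x)) (at x)"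
      unfolding has_real_derivative_iff_has_vector_derivative[symmetric]
      by (auto intro!: derivative_eq_intros der DERIV_std_normal_density simp: algebra_simps)
    show "isCont (\<lambda>x. ?n x * u' x - ?n x * (x * u x)) x"
      using cu cont DERIV_isCont[OF DERIV_std_normal_density]
      by (auto intro!: continuous_intros simp: continuous_on_eq_continuous_at)
  next
    show "set_integrable lborel (einterval (- \<infinity>) \<infinity>) (\<lambda>x. ?n x * u' x - ?n x * (x * u x))"
      using i1 i2 by (simp add: set_integrable_def einterval_def)
    show "(((\<lambda>x. u x * ?n x) \<circ> real_of_ereal) \<longlongrightarrow> 0) (at_right (- \<infinity>))"
      using lim[OF std_normal_density_at_bot]
      by (simp add: at_right_MInf filterlim_filtermap o_def tendsto_compose_filtermap)
    show "(((\<lambda>x. u x * ?n x) \<circ> real_of_ereal) \<longlongrightarrow> 0) (at_left \<infinity>)"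
      using lim[OF std_normal_density_at_top]
      by (simp add: at_left_PInf filterlim_filtermap o_def tendsto_compose_filtermap)
  qed simp
  then have "(\<integral>x. ?n x * u' x - ?n x * (x * u x) \<partial>lborel) = 0"
    by (simp add: interval_lebesgue_integral_def einterval_def set_lebesgue_integral_def)
  then show ?thesis using i1 i2 by (simp add: integral_std_normal)
qed

text \<open>Fubini isolates coordinate \<open>j\<close>. The partial derivative is phrased through
  the update \<open>x(j := y)\<close>, so the one-dimensional identity applies on every line
  parallel to that axis.\<close>

lemma gauss_ibp:
  fixes f f' :: "('j \<Rightarrow> real) \<Rightarrow> real"
  assumes J: "finite J" "j \<in> J"
    and [measurable]: "f \<in> borel_measurable (gauss J)" "f' \<in> borel_measurable (gauss J)"
    and der: "\<And>x y. ((\<lambda>y. f (x(j := y))) has_real_derivative f' (x(j := y))) (at y)"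
    and cont: "\<And>x. continuous_on UNIV (\<lambda>y. f' (x(j := y)))"
    and bd: "\<And>\<omega>. \<bar>f \<omega>\<bar> \<le> B" "\<And>\<omega>. \<bar>f' \<omega>\<bar> \<le> B"
  shows "(\<integral>\<omega>. \<omega> j * f \<omega> \<partial>gauss J) = (\<integral>\<omega>. f' \<omega> \<partial>gauss J)"
proof -
  define I where "I = J - {j}"
  have I: "finite I" "j \<notin> I" and JI: "J = insert j I" using J by (auto simp: I_def)
  interpret prob_space "gauss J" by (rule prob_space_gauss)
  have i1: "integrable (gauss J) (\<lambda>\<omega>. \<omega> j * f \<omega>)"
  proof (rule Bochner_Integration.integrable_bound[where f="\<lambda>\<omega>. B * \<omega> j"])
    show "integrable (gauss J) (\<lambda>\<omega>. B * \<omega> j)" using gauss_component_integrable[OF J(2)] by simp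
    have "\<bar>\<omega> j\<bar> * \<bar>f \<omega>\<bar> \<le> \<bar>B\<bar> * \<bar>\<omega> j\<bar>" for \<omega>
      using mult_right_mono[of "\<bar>f \<omega>\<bar>" "\<bar>B\<bar>" "\<bar>\<omega> j\<bar>"] bd(1)[of \<omega>] by (simp add: mult.commute)
    then show "AE \<omega> in gauss J. norm (\<omega> j * f \<omega>) \<le> norm (B * \<omega> j)"
      by (auto simp: abs_mult)
  qed (use J in measurable)
  have i2: "integrable (gauss J) f'"
    by (rule integrable_const_bound[where B=B]) (use bd in auto)
  have "(\<integral>\<omega>. \<omega> j * f \<omega> \<partial>gauss J) = (\<integral>x. (\<integral>y. y * f (x(j := y)) \<partial>std_normal) \<partial>gauss I)"
    using product_sigma_finite.product_integral_insert[OF product_sigma_finite_std_normal I, of "\<lambda>\<omega>. \<omega> j * f \<omega>"] i1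
    by (simp add: JI gauss_def)
  also have "\<dots> = (\<integral>x. (\<integral>y. f' (x(j := y)) \<partial>std_normal) \<partial>gauss I)"
    by (intro Bochner_Integration.integral_cong refl std_normal_ibp[where B=B] der cont bd)
  also have "\<dots> = (\<integral>\<omega>. f' \<omega> \<partial>gauss J)"
    using product_sigma_finite.product_integral_insert[OF product_sigma_finite_std_normal I, of f'] i2 by (simp add: JI gauss_def)
  finally show ?thesis .
qed

section \<open>The Sudakov-Fernique inequality\<close>

definition lin :: "'j set \<Rightarrow> ('j \<Rightarrow> real) \<Rightarrow> ('j \<Rightarrow> real) \<Rightarrow> real" where
  "lin J a x = (\<Sum>j\<in>J. a j * x j)"

text \<open>The log-sum-exp approximation of the maximum at inverse temperature
  \<open>\<beta>\<close>; \<open>gibbs\<close> is its gradient.\<close>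

definition smax :: "'i set \<Rightarrow> real \<Rightarrow> ('i \<Rightarrow> real) \<Rightarrow> real" where
  "smax I \<beta> z = ln (\<Sum>i\<in>I. exp (\<beta> * z i)) / \<beta>"

definition gibbs :: "'i set \<Rightarrow> real \<Rightarrow> ('i \<Rightarrow> real) \<Rightarrow> 'i \<Rightarrow> real" where
  "gibbs I \<beta> z i = exp (\<beta> * z i) / (\<Sum>l\<in>I. exp (\<beta> * z l))"

lemma lin_measurable [measurable]: "lin J a \<in> borel_measurable (gauss J)"
  unfolding lin_def by measurable

lemma lin_integrable: "integrable (gauss J) (lin J a)"
  unfolding lin_def by (auto intro!: gauss_component_integrable)

lemma lin_mean: "(\<integral>x. lin J a x \<partial>gauss J) = 0"
  unfolding lin_def by (simp add: gauss_component_integrable gauss_component_mean)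

lemma lin_upd: "finite J \<Longrightarrow> j \<in> J \<Longrightarrow> lin J a (x(j := y)) = lin J a x + a j * (y - x j)"
  unfolding lin_def by (simp add: sum.remove[of J j] algebra_simps)

lemma abs_Max_le:
  fixes z :: "'i \<Rightarrow> real"
  assumes "finite I" "I \<noteq> {}"
  shows "\<bar>Max (z ` I)\<bar> \<le> (\<Sum>i\<in>I. \<bar>z i\<bar>)"
proof -
  have "Max (z ` I) \<in> z ` I" using assms by (intro Max_in) auto
  then obtain i where i: "i \<in> I" "Max (z ` I) = z i" by blast
  show ?thesis using member_le_sum[of i I "\<lambda>i. \<bar>z i\<bar>"] assms i by auto
qed

lemma Max_integrable:
  fixes f :: "'i \<Rightarrow> 'a \<Rightarrow> real"
  assumes I: "finite I" "I \<noteq> {}" and f: "\<And>i. i \<in> I \<Longrightarrow> integrable M (f i)"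
  shows "integrable M (\<lambda>x. Max ((\<lambda>i. f i x) ` I))"
proof (rule Bochner_Integration.integrable_bound[where f="\<lambda>x. \<Sum>i\<in>I. \<bar>f i x\<bar>"])
  show "AE x in M. norm (Max ((\<lambda>i. f i x) ` I)) \<le> norm (\<Sum>i\<in>I. \<bar>f i x\<bar>)"
    using abs_Max_le[OF I] by (auto simp: sum_nonneg)
  show "(\<lambda>x. Max ((\<lambda>i. f i x) ` I)) \<in> borel_measurable M"
    using I f by (intro borel_measurable_Max) auto
qed (use f in auto)

section \<open>Smooth maximum: convexity, approximation error, one interpolation step\<close>

context
  fixes I :: "'i set" and \<beta> :: real
  assumes I: "finite I" "I \<noteq> {}" and \<beta>: "\<beta> > 0"
begin

lemma sum_exp_pos: "(\<Sum>i\<in>I. exp (\<beta> * z i)) > 0"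
  using I by (intro sum_pos) auto

lemma gibbs_nonneg: "gibbs I \<beta> z i \<ge> 0"
  using sum_exp_pos[of z] by (simp add: gibbs_def)

lemma sum_gibbs: "(\<Sum>i\<in>I. gibbs I \<beta> z i) = 1"
  using sum_exp_pos[of z] by (simp add: gibbs_def flip: sum_divide_distrib)

lemma gibbs_le_1: "i \<in> I \<Longrightarrow> gibbs I \<beta> z i \<le> 1"
  using member_le_sum[of i I "gibbs I \<beta> z"] I gibbs_nonneg sum_gibbs by simp

text \<open>The gradient inequality at \<open>z'\<close>. Factoring out the sum at \<open>z'\<close>
  reduces it to Jensen's inequality for \<open>exp\<close> under the Gibbs weights, which follows
  from the tangent line of \<open>exp\<close> at the mean \<open>m\<close>.\<close>

lemma smax_convex: "smax I \<beta> z' - smax I \<beta> z \<le> (\<Sum>i\<in>I. gibbs I \<beta> z' i * (z' i - z i))"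
proof -
  define p where "p = gibbs I \<beta> z'"
  define u where "u i = \<beta> * (z i - z' i)" for i
  define m where "m = (\<Sum>i\<in>I. p i * u i)"
  have eq: "(\<Sum>i\<in>I. exp (\<beta> * z i)) = (\<Sum>i\<in>I. exp (\<beta> * z' i)) * (\<Sum>i\<in>I. p i * exp (u i))"
  proof -
    have "(\<Sum>i\<in>I. exp (\<beta> * z' i)) * (p i * exp (u i)) = exp (\<beta> * z i)" for i
      using sum_exp_pos[of z'] by (simp add: p_def gibbs_def u_def right_diff_distrib flip: exp_add)
    then show ?thesis by (simp add: sum_distrib_left)
  qed
  have "exp m = (\<Sum>i\<in>I. p i * (exp m * (1 + (u i - m))))"
  proof -
    have "(\<Sum>i\<in>I. p i * (exp m * (1 + (u i - m)))) = exp m * ((1 - m) * (\<Sum>i\<in>I. p i) + (\<Sum>i\<in>I. p i * u i))"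
      by (simp add: algebra_simps sum.distrib sum_subtractf sum_distrib_left sum_distrib_right)
    then show ?thesis by (simp add: m_def[symmetric] sum_gibbs[of z', folded p_def])
  qed
  also have "\<dots> \<le> (\<Sum>i\<in>I. p i * exp (u i))"
  proof (intro sum_mono mult_left_mono)
    fix i
    have "exp m * (1 + (u i - m)) \<le> exp m * exp (u i - m)"
      using exp_ge_add_one_self[of "u i - m"] by (intro mult_left_mono) auto
    then show "exp m * (1 + (u i - m)) \<le> exp (u i)" by (simp flip: exp_add)
    show "p i \<ge> 0" by (simp add: p_def gibbs_nonneg)
  qed
  finally have le: "exp m \<le> (\<Sum>i\<in>I. p i * exp (u i))" .
  then have pos: "(\<Sum>i\<in>I. p i * exp (u i)) > 0" using exp_gt_zero[of m] by linarith
  have "m \<le> ln (\<Sum>i\<in>I. p i * exp (u i))"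
    using le pos by (simp add: ln_ge_iff)
  also have "\<dots> = \<beta> * smax I \<beta> z - \<beta> * smax I \<beta> z'"
    using \<beta> sum_exp_pos[of z'] pos by (simp add: smax_def eq ln_mult)
  finally have "\<beta> * (smax I \<beta> z' - smax I \<beta> z) \<le> - m" by (simp add: algebra_simps)
  also have "- m = \<beta> * (\<Sum>i\<in>I. p i * (z' i - z i))"
    by (simp add: m_def u_def sum_distrib_left sum_negf[symmetric] algebra_simps)
  finally show ?thesis using \<beta> by (simp add: p_def)
qed

lemma Max_le_smax: "Max (z ` I) \<le> smax I \<beta> z"
proof -
  have "Max (z ` I) \<in> z ` I" using I by (intro Max_in) auto
  then obtain i where i: "i \<in> I" "Max (z ` I) = z i" by blast
  have "\<beta> * z i = ln (exp (\<beta> * z i))" by simp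
  also have "\<dots> \<le> ln (\<Sum>i\<in>I. exp (\<beta> * z i))"
    using member_le_sum[of i I "\<lambda>i. exp (\<beta> * z i)"] I i sum_exp_pos[of z] by (subst ln_le_cancel_iff) auto
  finally show ?thesis using \<beta> i by (simp add: smax_def pos_le_divide_eq mult.commute)
qed

lemma smax_le_Max: "smax I \<beta> z \<le> Max (z ` I) + ln (card I) / \<beta>"
proof -
  have "(\<Sum>i\<in>I. exp (\<beta> * z i)) \<le> (\<Sum>i\<in>I. exp (\<beta> * Max (z ` I)))"
    using I \<beta> by (intro sum_mono) auto
  then have "(\<Sum>i\<in>I. exp (\<beta> * z i)) \<le> card I * exp (\<beta> * Max (z ` I))" by simp
  then have "ln (\<Sum>i\<in>I. exp (\<beta> * z i)) \<le> ln (card I * exp (\<beta> * Max (z ` I)))"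
    using sum_exp_pos[of z] I by (subst ln_le_cancel_iff) (auto simp: card_gt_0_iff)
  also have "\<dots> = ln (card I) + \<beta> * Max (z ` I)"
    using I by (subst ln_mult) (auto simp: card_gt_0_iff)
  finally show ?thesis using \<beta> by (simp add: smax_def field_simps)
qed

lemma ln_card_nonneg: "ln (real (card I)) / \<beta> \<ge> 0"
  using I \<beta> by (auto simp: card_gt_0_iff Suc_le_eq)

context
  fixes J :: "'j set"
  assumes J: "finite J"
begin

lemma smax_lin_integrable: "integrable (gauss J) (\<lambda>x. smax I \<beta> (\<lambda>i. lin J (a i) x))"
proof (rule Bochner_Integration.integrable_bound[where f="\<lambda>x. (\<Sum>i\<in>I. \<bar>lin J (a i) x\<bar>) + ln (card I) / \<beta>"])
  interpret prob_space "gauss J" by (rule prob_space_gauss)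
  show "integrable (gauss J) (\<lambda>x. (\<Sum>i\<in>I. \<bar>lin J (a i) x\<bar>) + ln (card I) / \<beta>)"
    by (intro Bochner_Integration.integrable_add Bochner_Integration.integrable_sum integrable_abs
        lin_integrable integrable_const)
  show "AE x in gauss J. norm (smax I \<beta> (\<lambda>i. lin J (a i) x))
      \<le> norm ((\<Sum>i\<in>I. \<bar>lin J (a i) x\<bar>) + ln (card I) / \<beta>)"
  proof (rule AE_I2)
    fix x
    show "norm (smax I \<beta> (\<lambda>i. lin J (a i) x)) \<le> norm ((\<Sum>i\<in>I. \<bar>lin J (a i) x\<bar>) + ln (card I) / \<beta>)"
      using abs_Max_le[OF I, of "\<lambda>i. lin J (a i) x"] Max_le_smax[of "\<lambda>i. lin J (a i) x"]
        smax_le_Max[of "\<lambda>i. lin J (a i) x"] ln_card_nonneg unfolding real_norm_def by linarith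
  qed
  show "(\<lambda>x. smax I \<beta> (\<lambda>i. lin J (a i) x)) \<in> borel_measurable (gauss J)"
    unfolding smax_def by measurable
qed

lemma gibbs_lin_measurable [measurable]:
  "(\<lambda>x. gibbs I \<beta> (\<lambda>i. lin J (a i) x) i) \<in> borel_measurable (gauss J)"
  unfolding gibbs_def by measurable

text \<open>The integrand on the right is the partial derivative of a Gibbs weight in coordinate
  \<open>j\<close>: the weight times the deviation of \<open>a i j\<close> from its Gibbs
  average.\<close>

lemma gibbs_ibp:
  fixes a :: "'i \<Rightarrow> 'j \<Rightarrow> real"
  assumes i: "i \<in> I" and j: "j \<in> J"
  defines "p \<equiv> \<lambda>x. gibbs I \<beta> (\<lambda>i. lin J (a i) x)"
  shows "(\<integral>x. x j * p x i \<partial>gauss J) = (\<integral>x. \<beta> * (p x i * (a i j - (\<Sum>l\<in>I. p x l * a l j))) \<partial>gauss J)"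
\<comment> \<open>A crude common bound: the summand 1 covers the weight itself, the rest covers its
  derivative.\<close>
proof (rule gauss_ibp[OF J j, where B="1 + \<beta> * (\<bar>a i j\<bar> + (\<Sum>l\<in>I. \<bar>a l j\<bar>))"])
  show "(\<lambda>x. p x i) \<in> borel_measurable (gauss J)"
    "(\<lambda>x. \<beta> * (p x i * (a i j - (\<Sum>l\<in>I. p x l * a l j)))) \<in> borel_measurable (gauss J)"
    unfolding p_def by measurable
  fix x y
  define E where "E l y = exp (\<beta> * (lin J (a l) x + a l j * (y - x j)))" for l y
  have E: "gibbs I \<beta> (\<lambda>i. lin J (a i) (x(j := y))) l = E l y / (\<Sum>l\<in>I. E l y)" for l y
    by (simp add: gibbs_def E_def lin_upd[OF J j])
  have pos: "(\<Sum>l\<in>I. E l y) > 0" for y unfolding E_def by (rule sum_exp_pos)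
  have dE: "(E l has_real_derivative (\<beta> * a l j * E l y)) (at y)" for l
    unfolding E_def by (auto intro!: derivative_eq_intros)
  have dS: "((\<lambda>y. \<Sum>l\<in>I. E l y) has_real_derivative (\<Sum>l\<in>I. \<beta> * a l j * E l y)) (at y)"
    by (intro DERIV_sum dE)
  define S A where "S = (\<Sum>l\<in>I. E l y)" and "A = (\<Sum>l\<in>I. a l j * E l y)"
  have 1: "(\<Sum>l\<in>I. E l y / S * a l j) = A / S"
    by (simp add: sum_divide_distrib mult.commute A_def)
  have 2: "(\<Sum>l\<in>I. \<beta> * a l j * E l y) = \<beta> * A"
    by (simp add: sum_distrib_left mult.assoc A_def)
  have "(\<beta> * a i j * E i y * S - E i y * (\<beta> * A)) / (S * S) = \<beta> * (E i y / S * (a i j - A / S))"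
    using pos[of y] unfolding S_def[symmetric] by (simp add: field_simps)
  then show "((\<lambda>y. p (x(j := y)) i) has_real_derivative
        \<beta> * (p (x(j := y)) i * (a i j - (\<Sum>l\<in>I. p (x(j := y)) l * a l j)))) (at y)"
    unfolding p_def E S_def[symmetric] 1
    using DERIV_divide[OF dE[of i] dS] pos[of y] unfolding S_def[symmetric] 2 by simp
  show "continuous_on UNIV (\<lambda>y. \<beta> * (p (x(j := y)) i * (a i j - (\<Sum>l\<in>I. p (x(j := y)) l * a l j))))"
    unfolding p_def E using pos unfolding E_def
    by (intro continuous_intros) (auto simp: less_imp_neq[symmetric])
next
  fix x
  have *: "\<bar>\<Sum>l\<in>I. p x l * a l j\<bar> \<le> (\<Sum>l\<in>I. \<bar>a l j\<bar>)"
  proof (rule order_trans[OF sum_abs sum_mono])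
    fix l assume "l \<in> I"
    then show "\<bar>p x l * a l j\<bar> \<le> \<bar>a l j\<bar>"
      using gibbs_le_1[of l] gibbs_nonneg by (auto simp: p_def abs_mult intro: mult_left_le_one_le)
  qed
  have p: "0 \<le> p x i" "p x i \<le> 1" using gibbs_le_1[OF i] gibbs_nonneg by (auto simp: p_def)
  have "p x i * \<bar>a i j - (\<Sum>l\<in>I. p x l * a l j)\<bar> \<le> 1 * (\<bar>a i j\<bar> + (\<Sum>l\<in>I. \<bar>a l j\<bar>))"
    using p * by (intro mult_mono) auto
  then show "\<bar>\<beta> * (p x i * (a i j - (\<Sum>l\<in>I. p x l * a l j)))\<bar> \<le> 1 + \<beta> * (\<bar>a i j\<bar> + (\<Sum>l\<in>I. \<bar>a l j\<bar>))"
    using \<beta> p by (simp add: abs_mult) (smt (verit) mult_left_mono)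
  show "\<bar>p x i\<bar> \<le> 1 + \<beta> * (\<bar>a i j\<bar> + (\<Sum>l\<in>I. \<bar>a l j\<bar>))"
    using \<beta> p by (smt (verit) mult_nonneg_nonneg sum_nonneg abs_ge_zero)
qed

text \<open>A finite step in place of a derivative under the integral. Convexity bounds the
  increment by the gradient at the new coefficients \<open>a'\<close>, integration by parts turns
  this into a Gibbs average of terms quadratic in the coefficients, and \<open>\<kappa>\<close>
  bounds these terms pair by pair.\<close>

lemma smax_step:
  assumes \<kappa>: "\<And>i l. i \<in> I \<Longrightarrow> l \<in> I \<Longrightarrow>
    (\<Sum>j\<in>J. ((a' i j - a i j) - (a' l j - a l j)) * (a' i j - a' l j)) \<le> \<kappa>"
  shows "(\<integral>x. smax I \<beta> (\<lambda>i. lin J (a' i) x) \<partial>gauss J) - (\<integral>x. smax I \<beta> (\<lambda>i. lin J (a i) x) \<partial>gauss J)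
    \<le> \<beta> * \<kappa> / 2"
proof -
  interpret prob_space "gauss J" by (rule prob_space_gauss)
  define p where "p x = gibbs I \<beta> (\<lambda>i. lin J (a' i) x)" for x
  define d where "d i j = a' i j - a i j" for i j
  have [measurable]: "(\<lambda>x. p x i) \<in> borel_measurable (gauss J)" for i unfolding p_def by measurable
  have p0: "p x i \<ge> 0" and ps: "(\<Sum>i\<in>I. p x i) = 1" for x i by (simp_all add: p_def gibbs_nonneg sum_gibbs)
  have p1: "p x i \<le> 1" if "i \<in> I" for x i using gibbs_le_1[OF that] by (simp add: p_def)
  have int1: "integrable (gauss J) (\<lambda>x. x j * p x i)" if "i \<in> I" "j \<in> J" for i j
  proof (rule Bochner_Integration.integrable_bound[OF gauss_component_integrable[OF that(2)]])
    show "(\<lambda>x. x j * p x i) \<in> borel_measurable (gauss J)" using that by measurable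
    show "AE x in gauss J. norm (x j * p x i) \<le> norm (x j)"
      using p0 p1[OF that(1)] by (auto simp: abs_mult intro!: mult_right_le_one_le)
  qed
  have intp: "integrable (gauss J) (\<lambda>x. p x i * p x l)" if "i \<in> I" "l \<in> I" for i l
    by (rule integrable_const_bound[where B=1]) (use p0 p1 that in \<open>auto simp: abs_mult intro!: mult_le_one\<close>)
  have intp1: "integrable (gauss J) (\<lambda>x. p x i)" if "i \<in> I" for i
    by (rule integrable_const_bound[where B=1]) (use p0 p1 that in auto)
  have intg: "integrable (gauss J) (\<lambda>x. \<beta> * (p x i * (a' i j - (\<Sum>l\<in>I. p x l * a' l j))))" if "i \<in> I" for i j
  proof -
    have "(\<lambda>x. \<beta> * (p x i * (a' i j - (\<Sum>l\<in>I. p x l * a' l j))))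
      = (\<lambda>x. \<beta> * a' i j * p x i - (\<Sum>l\<in>I. \<beta> * a' l j * (p x i * p x l)))"
      by (simp add: right_diff_distrib sum_distrib_left mult_ac)
    then show ?thesis
      by (simp only:) (intro Bochner_Integration.integrable_diff Bochner_Integration.integrable_sum
          integrable_mult_right intp intp1 that)
  qed
  have "(\<integral>x. smax I \<beta> (\<lambda>i. lin J (a' i) x) \<partial>gauss J) - (\<integral>x. smax I \<beta> (\<lambda>i. lin J (a i) x) \<partial>gauss J)
      = (\<integral>x. smax I \<beta> (\<lambda>i. lin J (a' i) x) - smax I \<beta> (\<lambda>i. lin J (a i) x) \<partial>gauss J)"
    by (simp add: smax_lin_integrable)
  also have "\<dots> \<le> (\<integral>x. (\<Sum>i\<in>I. \<Sum>j\<in>J. d i j * (x j * p x i)) \<partial>gauss J)"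
  proof (rule integral_mono)
    fix x
    have "(\<Sum>i\<in>I. p x i * (lin J (a' i) x - lin J (a i) x)) = (\<Sum>i\<in>I. \<Sum>j\<in>J. d i j * (x j * p x i))"
      by (simp add: lin_def d_def sum_distrib_left sum_subtractf algebra_simps)
    then show "smax I \<beta> (\<lambda>i. lin J (a' i) x) - smax I \<beta> (\<lambda>i. lin J (a i) x) \<le> (\<Sum>i\<in>I. \<Sum>j\<in>J. d i j * (x j * p x i))"
      using smax_convex[of "\<lambda>i. lin J (a' i) x" "\<lambda>i. lin J (a i) x"] by (simp add: p_def)
    show "integrable (gauss J) (\<lambda>x. \<Sum>i\<in>I. \<Sum>j\<in>J. d i j * (x j * p x i))"
      by (intro Bochner_Integration.integrable_sum integrable_mult_right int1)
  qed (auto intro!: smax_lin_integrable)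
  also have "\<dots> = (\<Sum>i\<in>I. \<Sum>j\<in>J. d i j * (\<integral>x. x j * p x i \<partial>gauss J))"
    by (simp add: int1)
  also have "\<dots> = (\<Sum>i\<in>I. \<Sum>j\<in>J. d i j * (\<integral>x. \<beta> * (p x i * (a' i j - (\<Sum>l\<in>I. p x l * a' l j))) \<partial>gauss J))"
    unfolding p_def by (intro sum.cong refl arg_cong2[where f="(*)"] gibbs_ibp)
  also have "\<dots> = (\<integral>x. (\<Sum>i\<in>I. \<Sum>j\<in>J. d i j * (\<beta> * (p x i * (a' i j - (\<Sum>l\<in>I. p x l * a' l j))))) \<partial>gauss J)"
    using intg by simp
  also have "\<dots> \<le> (\<integral>x. \<beta> * \<kappa> / 2 \<partial>gauss J)"
  proof (rule integral_mono)
    show "integrable (gauss J) (\<lambda>x. \<Sum>i\<in>I. \<Sum>j\<in>J. d i j * (\<beta> * (p x i * (a' i j - (\<Sum>l\<in>I. p x l * a' l j)))))"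
      by (intro Bochner_Integration.integrable_sum integrable_mult_right intg)
    fix x
    define R where "R i l = (\<Sum>j\<in>J. d i j * (a' i j - a' l j))" for i l
    have "(\<Sum>i\<in>I. \<Sum>j\<in>J. d i j * (\<beta> * (p x i * (a' i j - (\<Sum>l\<in>I. p x l * a' l j)))))
       = \<beta> * (\<Sum>i\<in>I. \<Sum>l\<in>I. p x i * p x l * R i l)"
    proof -
      have "a' i j - (\<Sum>l\<in>I. p x l * a' l j) = (\<Sum>l\<in>I. p x l * (a' i j - a' l j))" for i j
        by (simp add: right_diff_distrib sum_subtractf ps flip: sum_distrib_right)
      then have "(\<Sum>j\<in>J. d i j * (\<beta> * (p x i * (a' i j - (\<Sum>l\<in>I. p x l * a' l j)))))
        = (\<Sum>l\<in>I. \<beta> * (p x i * p x l * R i l))" for i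
        by (simp add: R_def sum_distrib_left mult_ac) (rule sum.swap)
      then show ?thesis by (simp add: sum_distrib_left)
    qed
    \<comment> \<open>The weights are symmetric in \<open>i\<close> and \<open>l\<close>, so
      \<open>R\<close> may be symmetrised; what results involves the coefficients only through
      differences between two indices, as the hypothesis on increments demands.\<close>
    also have "(\<Sum>i\<in>I. \<Sum>l\<in>I. p x i * p x l * R i l) = (\<Sum>i\<in>I. \<Sum>l\<in>I. p x i * p x l * ((R i l + R l i) / 2))"
    proof -
      have "(\<Sum>i\<in>I. \<Sum>l\<in>I. p x i * p x l * R l i) = (\<Sum>i\<in>I. \<Sum>l\<in>I. p x i * p x l * R i l)"
        by (subst sum.swap) (simp add: mult_ac)
      moreover have "(\<Sum>i\<in>I. \<Sum>l\<in>I. p x i * p x l * ((R i l + R l i) / 2))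
        = ((\<Sum>i\<in>I. \<Sum>l\<in>I. p x i * p x l * R i l) + (\<Sum>i\<in>I. \<Sum>l\<in>I. p x i * p x l * R l i)) / 2"
        by (simp add: algebra_simps sum.distrib add_divide_distrib sum_divide_distrib)
      ultimately show ?thesis by simp
    qed
    also have "\<dots> \<le> (\<Sum>i\<in>I. \<Sum>l\<in>I. p x i * p x l * (\<kappa> / 2))"
    proof (intro sum_mono mult_left_mono)
      fix i l assume "i \<in> I" "l \<in> I"
      moreover have "R i l + R l i = (\<Sum>j\<in>J. ((a' i j - a i j) - (a' l j - a l j)) * (a' i j - a' l j))"
        unfolding R_def d_def sum.distrib[symmetric] by (intro sum.cong) (simp_all add: algebra_simps)
      ultimately show "(R i l + R l i) / 2 \<le> \<kappa> / 2" using \<kappa>[of i l] by simp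
    qed (intro mult_nonneg_nonneg p0)
    also have "\<dots> = \<kappa> / 2"
      by (simp only: sum_distrib_right[symmetric] sum_distrib_left[symmetric] ps mult_1)
    finally show "(\<Sum>i\<in>I. \<Sum>j\<in>J. d i j * (\<beta> * (p x i * (a' i j - (\<Sum>l\<in>I. p x l * a' l j))))) \<le> \<beta> * \<kappa> / 2"
      using \<beta> by simp
  qed auto
  finally show ?thesis by (simp add: prob_space)
qed

end
end

lemma one_minus_cos_le: "1 - cos h \<le> h\<^sup>2 / 2" for h :: real
proof -
  have "\<bar>sin (h / 2)\<bar> \<le> \<bar>h / 2\<bar>" by (rule abs_sin_x_le_abs_x)
  then have "(sin (h / 2))\<^sup>2 \<le> (h / 2)\<^sup>2" by (rule abs_le_square_iff[THEN iffD1])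
  then show ?thesis using cos_double_sin[of "h / 2"] by (simp add: power2_eq_square)
qed

text \<open>By \<open>orth\<close> the two processes are uncorrelated although they live on one
  Gaussian vector, so rotating the coefficients from \<open>a\<close> to \<open>b\<close>
  interpolates between them. A step of angle \<open>h\<close> costs order h^2, hence n equal steps
  cost order 1/n; the smoothing error vanishes as \<open>\<beta>\<close> grows.\<close>

theorem sudakov_fernique:
  fixes a b :: "'i \<Rightarrow> 'j \<Rightarrow> real"
  assumes I: "finite I" "I \<noteq> {}" and J: "finite J"
    and orth: "\<And>i l. i \<in> I \<Longrightarrow> l \<in> I \<Longrightarrow> (\<Sum>j\<in>J. a i j * b l j) = 0"
    and le: "\<And>i l. i \<in> I \<Longrightarrow> l \<in> I \<Longrightarrow> (\<Sum>j\<in>J. (b i j - b l j)\<^sup>2) \<le> (\<Sum>j\<in>J. (a i j - a l j)\<^sup>2)"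
  shows "(\<integral>x. Max ((\<lambda>i. lin J (b i) x) ` I) \<partial>gauss J) \<le> (\<integral>x. Max ((\<lambda>i. lin J (a i) x) ` I) \<partial>gauss J)"
    (is "?B \<le> ?A")
proof -
  interpret prob_space "gauss J" by (rule prob_space_gauss)
  define q where "q \<theta> i j = cos \<theta> * a i j + sin \<theta> * b i j" for \<theta> :: real and i j
  have q0: "q 0 = a" and q1: "q (pi / 2) = b" by (auto simp: q_def fun_eq_iff)
  define M where "M = (\<Sum>i\<in>I. \<Sum>l\<in>I. \<Sum>j\<in>J. (a i j - a l j)\<^sup>2)"
  have M0: "M \<ge> 0" unfolding M_def by (intro sum_nonneg) auto
  have M: "(\<Sum>j\<in>J. (a i j - a l j)\<^sup>2) \<le> M" if "i \<in> I" "l \<in> I" for i l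
  proof -
    have "(\<Sum>j\<in>J. (a i j - a l j)\<^sup>2) \<le> (\<Sum>l\<in>I. \<Sum>j\<in>J. (a i j - a l j)\<^sup>2)"
      by (rule member_le_sum[OF that(2), of "\<lambda>l. \<Sum>j\<in>J. (a i j - a l j)\<^sup>2"]) (use I in \<open>auto intro!: sum_nonneg\<close>)
    also have "\<dots> \<le> M" unfolding M_def
      by (rule member_le_sum[OF that(1), of "\<lambda>i. \<Sum>l\<in>I. \<Sum>j\<in>J. (a i j - a l j)\<^sup>2"]) (use I in \<open>auto intro!: sum_nonneg\<close>)
    finally show ?thesis .
  qed
  have main: "?B \<le> ?A + ln (card I) / \<beta>" if \<beta>: "\<beta> > 0" for \<beta>
  proof -
    define \<Phi> where "\<Phi> \<theta> = (\<integral>x. smax I \<beta> (\<lambda>i. lin J (q \<theta> i) x) \<partial>gauss J)" for \<theta>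
    have step: "\<Phi> t' - \<Phi> t \<le> \<beta> * (M * (1 - cos (t' - t))) / 2"
      if t: "0 \<le> t" "t \<le> t'" "t' \<le> pi / 2" for t t'
      unfolding \<Phi>_def
    proof (rule smax_step[OF I \<beta> J])
      fix i l assume il: "i \<in> I" "l \<in> I"
      define A where "A = (\<Sum>j\<in>J. (a i j - a l j)\<^sup>2)"
      define B where "B = (\<Sum>j\<in>J. (b i j - b l j)\<^sup>2)"
      have AB: "(\<Sum>j\<in>J. (a i j - a l j) * (b i j - b l j)) = 0"
        using orth[of i i] orth[of i l] orth[of l i] orth[of l l] il
        by (simp add: algebra_simps sum.distrib sum_subtractf)
      have "(\<Sum>j\<in>J. ((q t' i j - q t i j) - (q t' l j - q t l j)) * (q t' i j - q t' l j))
        = (\<Sum>j\<in>J. (cos t' - cos t) * cos t' * (a i j - a l j)\<^sup>2 + (sin t' - sin t) * sin t' * (b i j - b l j)\<^sup>2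
            + ((cos t' - cos t) * sin t' + (sin t' - sin t) * cos t') * ((a i j - a l j) * (b i j - b l j)))"
        by (intro sum.cong refl) (simp add: q_def power2_eq_square algebra_simps)
      also have "\<dots> = (cos t' - cos t) * cos t' * A + (sin t' - sin t) * sin t' * B"
        by (simp only: sum.distrib sum_distrib_left[symmetric] AB A_def B_def mult_zero_right add_0_right)
      also have "\<dots> \<le> (cos t' - cos t) * cos t' * A + (sin t' - sin t) * sin t' * A"
      proof (intro add_left_mono mult_left_mono)
        show "B \<le> A" unfolding A_def B_def by (rule le[OF il])
        \<comment> \<open>Here the restriction to angles in [0, pi/2] enters: the sine is
          nonnegative and increasing there, which gives the coefficient of \<open>B\<close> the
          right sign.\<close>
        show "0 \<le> (sin t' - sin t) * sin t'"
          using t by (intro mult_nonneg_nonneg) (auto intro!: sin_ge_zero sin_monotone_2pi_le)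
      qed
      also have "\<dots> = A * (1 - cos (t' - t))"
      proof -
        have "(cos t' - cos t) * cos t' * A + (sin t' - sin t) * sin t' * A
          = A * (((sin t')\<^sup>2 + (cos t')\<^sup>2) - (cos t' * cos t + sin t' * sin t))"
          by (simp only: power2_eq_square) (simp only: algebra_simps)
        then show ?thesis by (simp only: sin_cos_squared_add cos_diff)
      qed
      also have "\<dots> \<le> M * (1 - cos (t' - t))"
        using M[OF il] by (intro mult_right_mono) (auto simp: A_def)
      finally show "(\<Sum>j\<in>J. ((q t' i j - q t i j) - (q t' l j - q t l j)) * (q t' i j - q t' l j))
        \<le> M * (1 - cos (t' - t))" .
    qed
    have bd: "\<Phi> (pi / 2) - \<Phi> 0 \<le> (\<beta> * M * pi\<^sup>2 / 16) / real n" if n: "n > 0" for n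
    proof -
      define h where "h = pi / 2 / real n"
      have h: "h \<ge> 0" by (simp add: h_def)
      have "\<Phi> (pi / 2) - \<Phi> 0 = (\<Sum>k<n. \<Phi> (real (Suc k) * h) - \<Phi> (real k * h))"
        using n by (subst sum_lessThan_telescope) (simp add: h_def)
      also have "\<dots> \<le> (\<Sum>k<n. \<beta> * (M * (h\<^sup>2 / 2)) / 2)"
      proof (rule sum_mono)
        fix k assume "k \<in> {..<n}"
        then have "real (Suc k) * h \<le> real n * h" using h by (intro mult_right_mono) auto
        also have "\<dots> = pi / 2" using n by (simp add: h_def)
        finally have "\<Phi> (real (Suc k) * h) - \<Phi> (real k * h) \<le> \<beta> * (M * (1 - cos (real (Suc k) * h - real k * h))) / 2"
          using h by (intro step mult_right_mono) auto
        also have "real (Suc k) * h - real k * h = h" by (simp add: algebra_simps)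
        also have "\<beta> * (M * (1 - cos h)) / 2 \<le> \<beta> * (M * (h\<^sup>2 / 2)) / 2"
          using M0 \<beta> one_minus_cos_le[of h] by (intro divide_right_mono mult_left_mono) auto
        finally show "\<Phi> (real (Suc k) * h) - \<Phi> (real k * h) \<le> \<beta> * (M * (h\<^sup>2 / 2)) / 2" .
      qed
      also have "\<dots> = (\<beta> * M * pi\<^sup>2 / 16) / real n"
        using n by (simp add: h_def power2_eq_square field_simps)
      finally show ?thesis .
    qed
    have "\<Phi> (pi / 2) - \<Phi> 0 \<le> 0"
    proof (rule LIMSEQ_le_const)
      show "(\<lambda>n. (\<beta> * M * pi\<^sup>2 / 16) / real n) \<longlonglongrightarrow> 0" by (rule lim_const_over_n)
      show "\<exists>N. \<forall>n\<ge>N. \<Phi> (pi / 2) - \<Phi> 0 \<le> (\<beta> * M * pi\<^sup>2 / 16) / real n"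
        using bd by (intro exI[of _ 1]) auto
    qed
    moreover have "?B \<le> \<Phi> (pi / 2)" unfolding \<Phi>_def q1
      using smax_lin_integrable[OF I \<beta> J, of b] Max_integrable[OF I lin_integrable, of J b] Max_le_smax[OF I \<beta>]
      by (simp add: integral_mono)
    moreover have "\<Phi> 0 \<le> ?A + ln (card I) / \<beta>"
    proof -
      have "\<Phi> 0 = (\<integral>x. smax I \<beta> (\<lambda>i. lin J (a i) x) \<partial>gauss J)"
        by (simp add: \<Phi>_def q0)
      also have "\<dots> \<le> (\<integral>x. Max ((\<lambda>i. lin J (a i) x) ` I) + ln (card I) / \<beta> \<partial>gauss J)"
        by (intro integral_mono Bochner_Integration.integrable_add integrable_const
            smax_lin_integrable Max_integrable lin_integrable I \<beta> J smax_le_Max)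
      also have "\<dots> = ?A + ln (card I) / \<beta>" using Max_integrable[OF I lin_integrable, of J a] by (simp add: prob_space)
      finally show ?thesis .
    qed
    ultimately show ?thesis by linarith
  qed
  have "?B - ?A \<le> 0"
  proof (rule LIMSEQ_le_const)
    show "(\<lambda>n. ln (card I) / real n) \<longlonglongrightarrow> 0" by (rule lim_const_over_n)
    show "\<exists>N. \<forall>n\<ge>N. ?B - ?A \<le> ln (card I) / real n"
      using main by (intro exI[of _ 1]) (auto simp: algebra_simps)
  qed
  then show ?thesis by simp
qed

section \<open>Growth of the Gaussian width\<close>

lemma gauss_reindex:
  fixes F :: "('i \<Rightarrow> real) \<Rightarrow> real"
  assumes f: "inj_on f I" "f ` I \<subseteq> J" and F: "F \<in> borel_measurable (gauss I)"
  shows "(\<integral>z. F (\<lambda>i\<in>I. z (f i)) \<partial>gauss J) = (\<integral>z. F z \<partial>gauss I)"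
proof -
  have d: "distr (gauss J) (gauss I) (\<lambda>z. \<lambda>i\<in>I. z (f i)) = gauss I"
    unfolding gauss_def using distr_PiM_reindex[of J "\<lambda>_. std_normal" f I] f prob_space_std_normal by blast
  have m: "(\<lambda>z. \<lambda>i\<in>I. z (f i)) \<in> measurable (gauss J) (gauss I)"
    unfolding gauss_def using f(2) by (intro measurable_restrict measurable_component_singleton) auto
  show ?thesis using integral_distr[OF m F] d by simp
qed

text \<open>Independence of disjoint blocks, by Fubini. The restrictions are there because points of
  a product space are extensional on their own index set.\<close>

lemma gauss_indep:
  fixes F :: "('i \<Rightarrow> real) \<Rightarrow> real" and G :: "('i \<Rightarrow> real) \<Rightarrow> real"
  assumes fin: "finite A" "finite B" and disj: "A \<inter> B = {}"
    and int: "integrable (gauss (A \<union> B)) (\<lambda>z. F (restrict z A) * G (restrict z B))"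
  shows "(\<integral>z. F (restrict z A) * G (restrict z B) \<partial>gauss (A \<union> B)) = (\<integral>z. F z \<partial>gauss A) * (\<integral>z. G z \<partial>gauss B)"
proof -
  have "(\<integral>z. F (restrict z A) * G (restrict z B) \<partial>gauss (A \<union> B))
     = (\<integral>x. (\<integral>y. F (restrict (merge A B (x, y)) A) * G (restrict (merge A B (x, y)) B) \<partial>gauss B) \<partial>gauss A)"
    unfolding gauss_def
    by (rule product_sigma_finite.product_integral_fold[OF product_sigma_finite_std_normal disj fin])
       (use int in \<open>simp add: gauss_def\<close>)
  also have "\<dots> = (\<integral>x. (\<integral>y. F x * G y \<partial>gauss B) \<partial>gauss A)"
  proof (intro Bochner_Integration.integral_cong refl)
    fix x y assume "x \<in> space (gauss A)" "y \<in> space (gauss B)"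
    then have "restrict (merge A B (x, y)) A = x" "restrict (merge A B (x, y)) B = y"
      using disj by (auto simp: gauss_def space_PiM PiE_def extensional_restrict)
    then show "F (restrict (merge A B (x, y)) A) * G (restrict (merge A B (x, y)) B) = F x * G y" by simp
  qed
  finally show ?thesis by simp
qed

section \<open>Gaussian width and the Euclidean metric\<close>

definition gwidth :: "nat \<Rightarrow> (nat \<Rightarrow> real) set \<Rightarrow> real" where
  "gwidth r A = (\<integral>z. Max ((\<lambda>t. lin {..<r} t z) ` A) \<partial>gauss {..<r})"

definition dist_d :: "nat \<Rightarrow> (nat \<Rightarrow> real) \<Rightarrow> (nat \<Rightarrow> real) \<Rightarrow> real" where
  "dist_d d v w = norm_d d (\<lambda>i. v i - w i)"

lemma norm_d_L2: "norm_d d v = L2_set v {..<d}"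
  by (simp add: norm_d_def L2_set_def)

lemma norm_d_nonneg: "norm_d d v \<ge> 0" by (simp add: norm_d_L2 L2_set_nonneg)

lemma norm_d_triangle: "norm_d d (\<lambda>i. v i + w i) \<le> norm_d d v + norm_d d w"
  unfolding norm_d_L2 by (rule L2_set_triangle_ineq)

lemma norm_d_sq: "(norm_d d v)\<^sup>2 = (\<Sum>i<d. (v i)\<^sup>2)"
  by (simp add: norm_d_def sum_nonneg)

lemma dist_d_self: "dist_d d v v = 0" by (simp add: dist_d_def norm_d_def)
lemma dist_d_nonneg: "dist_d d v w \<ge> 0" by (simp add: dist_d_def norm_d_nonneg)
lemma dist_d_commute: "dist_d d v w = dist_d d w v"
  by (simp add: dist_d_def norm_d_def power2_commute)
lemma dist_d_triangle: "dist_d d v w \<le> dist_d d v u + dist_d d u w"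
  using norm_d_triangle[of d "\<lambda>i. v i - u i" "\<lambda>i. u i - w i"] by (simp add: dist_d_def)

lemma gwidth_mono:
  assumes "A \<subseteq> B" "A \<noteq> {}" "finite B"
  shows "gwidth r A \<le> gwidth r B"
  unfolding gwidth_def using assms finite_subset[OF assms(1,3)]
  by (intro integral_mono Max_integrable lin_integrable Max_mono) auto

lemma gwidth_singleton: "gwidth r {x} = 0"
  by (simp add: gwidth_def lin_mean)

text \<open>The scale of a packing is picked up by the independent Gaussian process
  indexed by sign vectors: its maximum over all sign vectors is a sum of absolute values.\<close>

lemma gwidth_growth:
  assumes P: "finite P" "card P = 2 ^ k" and k: "k > 0" and e: "e > 0"
    and sep: "\<And>x y. x \<in> P \<Longrightarrow> y \<in> P \<Longrightarrow> x \<noteq> y \<Longrightarrow> dist_d r x y \<ge> e"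
    and B: "\<And>x. x \<in> P \<Longrightarrow> finite (B x)" "\<And>x. x \<in> P \<Longrightarrow> B x \<noteq> {}"
    and Bd: "\<And>x t. x \<in> P \<Longrightarrow> t \<in> B x \<Longrightarrow> dist_d r x t \<le> e / 8"
  shows "\<exists>x\<in>P. gwidth r (\<Union>x\<in>P. B x) \<ge> e * sqrt k / 5 + gwidth r (B x)"
proof -
  \<comment> \<open>Three blocks: \<open>J2\<close> carries the given process, \<open>J0\<close> the
    sign vectors and \<open>J1\<close> the ball points recentred at their packing point. Putting
    \<open>a\<close> on \<open>J2\<close> and \<open>b\<close> on the other two makes them
    orthogonal. Grouping \<open>J2\<close> with \<open>J0\<close> splits \<open>J\<close> into two
    independent parts, signs and recentred points.\<close>
  define J0 J1 J2 :: "(nat \<times> nat) set" where "J0 = {0} \<times> {..<k}" and "J1 = {1} \<times> {..<r}" and "J2 = {2} \<times> {..<r}"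
  define J where "J = J0 \<union> J2 \<union> J1"
  have finJ: "finite J" "finite (J0 \<union> J2)" "finite J1" by (auto simp: J_def J0_def J1_def J2_def)
  have disj: "(J0 \<union> J2) \<inter> J1 = {}" by (auto simp: J0_def J1_def J2_def)
  \<comment> \<open>The largest scale that the comparison affords up to constants: sign vectors add
    at most 4/9 e^2 and recentred points at most (e/4)^2 to a squared increment, while points of
    different balls are at distance at least 3/4 e.\<close>
  define lam where "lam = e / (3 * sqrt k)"
  have l0: "lam > 0" using e k by (simp add: lam_def)
  have "card (Pow {..<k}) = card P" using P by (simp add: card_Pow)
  then obtain h where h: "bij_betw h P (Pow {..<k})"
    using P by (metis bij_betw_iff_card finite_Pow_iff finite_lessThan)
  define sg :: "(nat \<Rightarrow> real) \<Rightarrow> nat \<Rightarrow> real" where "sg x j = (if j \<in> h x then 1 else -1)" for x j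
  define I where "I = Sigma P B"
  have P0: "P \<noteq> {}" using P by (auto simp: card_eq_0_iff)
  have I: "finite I" "I \<noteq> {}" using P B P0 by (auto simp: I_def Sigma_empty_iff)
  define a :: "(nat \<Rightarrow> real) \<times> (nat \<Rightarrow> real) \<Rightarrow> nat \<times> nat \<Rightarrow> real"
    where "a i c = (if fst c = 2 then snd i (snd c) else 0)" for i c
  define b :: "(nat \<Rightarrow> real) \<times> (nat \<Rightarrow> real) \<Rightarrow> nat \<times> nat \<Rightarrow> real"
    where "b i c = (if fst c = 0 then lam * sg (fst i) (snd c)
      else if fst c = 1 then snd i (snd c) - fst i (snd c) else 0)" for i c
  have sumJ: "(\<Sum>c\<in>J. f c) = (\<Sum>j<k. f (0, j)) + (\<Sum>j<r. f (2, j)) + (\<Sum>j<r. f (1, j))" for f :: "_ \<Rightarrow> real"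
  proof -
    have *: "(\<Sum>c\<in>{q} \<times> S. f c) = (\<Sum>j\<in>S. f (q, j))" for q and S :: "nat set"
    proof -
      have "{q} \<times> S = Pair q ` S" by auto
      then show ?thesis by (simp add: sum.reindex inj_on_def)
    qed
    have "(\<Sum>c\<in>J. f c) = (\<Sum>c\<in>J0 \<union> J2. f c) + (\<Sum>c\<in>J1. f c)"
      unfolding J_def by (rule sum.union_disjoint[OF finJ(2,3) disj])
    moreover have "(\<Sum>c\<in>J0 \<union> J2. f c) = (\<Sum>c\<in>J0. f c) + (\<Sum>c\<in>J2. f c)"
      by (rule sum.union_disjoint) (auto simp: J0_def J2_def)
    ultimately show ?thesis by (simp only: J0_def J1_def J2_def *)
  qed
  have SF: "(\<integral>z. Max ((\<lambda>i. lin J (b i) z) ` I) \<partial>gauss J) \<le> (\<integral>z. Max ((\<lambda>i. lin J (a i) z) ` I) \<partial>gauss J)"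
  proof (rule sudakov_fernique[OF I finJ(1)])
    fix i l assume il: "i \<in> I" "l \<in> I"
    show "(\<Sum>c\<in>J. a i c * b l c) = 0" by (intro sum.neutral) (auto simp: a_def b_def)
    obtain x t y u where xy: "i = (x, t)" "l = (y, u)" "x \<in> P" "y \<in> P" "t \<in> B x" "u \<in> B y"
      using il by (auto simp: I_def)
    have A: "(\<Sum>c\<in>J. (a i c - a l c)\<^sup>2) = (dist_d r t u)\<^sup>2"
      by (simp add: sumJ a_def xy dist_d_def norm_d_sq)
    have Bq: "(\<Sum>c\<in>J. (b i c - b l c)\<^sup>2) = (\<Sum>j<k. (lam * sg x j - lam * sg y j)\<^sup>2) + (norm_d r (\<lambda>j. (t j - x j) - (u j - y j)))\<^sup>2"
      by (simp add: sumJ b_def xy norm_d_sq)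
    show "(\<Sum>c\<in>J. (b i c - b l c)\<^sup>2) \<le> (\<Sum>c\<in>J. (a i c - a l c)\<^sup>2)"
    proof (cases "x = y")
      case True
      then show ?thesis unfolding A Bq by (simp add: dist_d_def)
    next
      case False
      have "(\<Sum>j<k. (lam * sg x j - lam * sg y j)\<^sup>2) \<le> (\<Sum>j<k. 4 * lam\<^sup>2)"
        by (intro sum_mono) (auto simp: sg_def power2_eq_square)
      also have "\<dots> = 4 * e\<^sup>2 / 9" using k by (simp add: lam_def power_divide power_mult_distrib)
      finally have 1: "(\<Sum>j<k. (lam * sg x j - lam * sg y j)\<^sup>2) \<le> 4 * e\<^sup>2 / 9" .
      have "norm_d r (\<lambda>j. (t j - x j) - (u j - y j)) = norm_d r (\<lambda>j. (t j - x j) + (y j - u j))"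
        by (rule arg_cong[where f="norm_d r"]) auto
      also have "\<dots> \<le> dist_d r t x + dist_d r y u"
        unfolding dist_d_def by (rule norm_d_triangle)
      also have "\<dots> \<le> e / 8 + e / 8" using Bd xy by (intro add_mono) (auto simp: dist_d_commute[of r t])
      finally have "norm_d r (\<lambda>j. (t j - x j) - (u j - y j)) \<le> e / 4" by simp
      then have 2: "(norm_d r (\<lambda>j. (t j - x j) - (u j - y j)))\<^sup>2 \<le> (e / 4)\<^sup>2"
        using norm_d_nonneg by (intro power_mono) auto
      have "e \<le> dist_d r x y" using sep False xy by auto
      also have "\<dots> \<le> dist_d r x t + dist_d r t u + dist_d r u y"
        using dist_d_triangle[of r x y t] dist_d_triangle[of r t y u] by simp
      also have "\<dots> \<le> e / 8 + dist_d r t u + e / 8"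
        using Bd xy by (intro add_mono) (auto simp: dist_d_commute[of r u])
      finally have "3 / 4 * e \<le> dist_d r t u" by simp
      then have 3: "(3 / 4 * e)\<^sup>2 \<le> (dist_d r t u)\<^sup>2" using e by (intro power_mono) auto
      have "4 * e\<^sup>2 / 9 + (e / 4)\<^sup>2 \<le> (3 / 4 * e)\<^sup>2"
        by (simp add: power2_eq_square)
      then show ?thesis unfolding A Bq using 1 2 3 by linarith
    qed
  qed
  have meas: "(\<lambda>z. Max ((\<lambda>t. lin {..<r} t z) ` A)) \<in> borel_measurable (gauss {..<r})" if "finite A" for A
    using that by (intro borel_measurable_Max) auto
  have RHS: "(\<integral>z. Max ((\<lambda>i. lin J (a i) z) ` I) \<partial>gauss J) = gwidth r (\<Union>x\<in>P. B x)"
  proof -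
    have "(\<lambda>i. lin J (a i) z) ` I = (\<lambda>t. lin {..<r} t (\<lambda>j\<in>{..<r}. z (2, j))) ` (\<Union>x\<in>P. B x)" for z
    proof -
      have "lin J (a i) z = lin {..<r} (snd i) (\<lambda>j\<in>{..<r}. z (2, j))" for i
        by (simp add: lin_def sumJ a_def)
      moreover have "(\<Union>x\<in>P. B x) = snd ` I" by (force simp: I_def)
      ultimately show ?thesis by (simp add: image_image)
    qed
    then have "(\<integral>z. Max ((\<lambda>i. lin J (a i) z) ` I) \<partial>gauss J)
      = (\<integral>z. Max ((\<lambda>t. lin {..<r} t (\<lambda>j\<in>{..<r}. z (2, j))) ` (\<Union>x\<in>P. B x)) \<partial>gauss J)" by simp
    also have "\<dots> = gwidth r (\<Union>x\<in>P. B x)" unfolding gwidth_def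
      by (rule gauss_reindex[where f="\<lambda>j. (2, j)" and F="\<lambda>z. Max ((\<lambda>t. lin {..<r} t z) ` (\<Union>x\<in>P. B x))"])
         (use P B in \<open>auto intro!: meas inj_onI simp: J_def J2_def\<close>)
    finally show ?thesis .
  qed
  define m where "m = Min ((\<lambda>x. gwidth r (B x)) ` P)"
  \<comment> \<open>\<open>ind x\<close> is 1 exactly when the signs of the \<open>J0\<close> block
    are those coded by \<open>h x\<close>, so precisely one packing point is selected. The selection
    is independent of the recentred maxima \<open>\<Phi> x\<close>, which live on \<open>J1\<close>;
    this is how the expectation of the selected maximum is bounded below by
    \<open>m\<close>.\<close>
  define ind where "ind x z = (if \<forall>j\<in>{..<k}. (j \<in> h x) = (z (0::nat, j) \<ge> 0) then 1 else 0 :: real)" for x and z :: "nat \<times> nat \<Rightarrow> real"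
  define \<Phi> where "\<Phi> x z = Max ((\<lambda>t. \<Sum>j<r. (t j - x j) * z (1::nat, j)) ` B x)" for x and z :: "nat \<times> nat \<Rightarrow> real"
  have ind_meas: "ind x \<in> borel_measurable (gauss (J0 \<union> J2))" "ind x \<in> borel_measurable (gauss J)" for x
  proof -
    have "ind x \<in> borel_measurable (gauss K)" if "J0 \<subseteq> K" for K
    proof -
      have [measurable]: "(\<lambda>z. z (0, j)) \<in> borel_measurable (gauss K)" if "j \<in> {..<k}" for j
        using that \<open>J0 \<subseteq> K\<close> by (intro measurable_gauss_component) (auto simp: J0_def)
      show ?thesis unfolding ind_def by measurable
    qed
    moreover have "J0 \<subseteq> J0 \<union> J2" "J0 \<subseteq> J" by (auto simp: J_def)
    ultimately show "ind x \<in> borel_measurable (gauss (J0 \<union> J2))" "ind x \<in> borel_measurable (gauss J)"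
      by blast+
  qed
  have \<Phi>_lin: "\<Phi> x z = Max ((\<lambda>t. lin {..<r} t (\<lambda>j\<in>{..<r}. z (1, j))) ` B x) - lin {..<r} x (\<lambda>j\<in>{..<r}. z (1, j))"
    if "x \<in> P" for x z
  proof -
    have "\<Phi> x z = Max ((\<lambda>t. lin {..<r} t (\<lambda>j\<in>{..<r}. z (1, j)) + (- lin {..<r} x (\<lambda>j\<in>{..<r}. z (1, j)))) ` B x)"
      by (simp add: \<Phi>_def lin_def left_diff_distrib sum_subtractf)
    also have "\<dots> = Max ((\<lambda>t. lin {..<r} t (\<lambda>j\<in>{..<r}. z (1, j))) ` B x) + (- lin {..<r} x (\<lambda>j\<in>{..<r}. z (1, j)))"
      using B[OF that] by (intro Max_add_commute) auto
    finally show ?thesis by simp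
  qed
  have \<Phi>_int: "integrable (gauss K) (\<Phi> x)" if "x \<in> P" "J1 \<subseteq> K" for x K
    unfolding \<Phi>_def using B[OF that(1)] that(2)
    by (intro Max_integrable Bochner_Integration.integrable_sum integrable_mult_right gauss_component_integrable)
       (auto simp: J1_def)
  have \<Phi>_mean: "(\<integral>z. \<Phi> x z \<partial>gauss J1) = gwidth r (B x)" if x: "x \<in> P" for x
  proof -
    let ?F = "\<lambda>z. Max ((\<lambda>t. lin {..<r} t z) ` B x) - lin {..<r} x z"
    have "(\<integral>z. \<Phi> x z \<partial>gauss J1) = (\<integral>z. ?F (\<lambda>j\<in>{..<r}. z (1, j)) \<partial>gauss J1)"
      by (simp add: \<Phi>_lin[OF x])
    also have "\<dots> = (\<integral>z. ?F z \<partial>gauss {..<r})"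
      by (rule gauss_reindex[where f="\<lambda>j. (1, j)" and F="?F"])
         (use B x in \<open>auto intro!: borel_measurable_diff meas lin_measurable inj_onI simp: J1_def\<close>)
    also have "\<dots> = gwidth r (B x) - 0"
      unfolding gwidth_def lin_mean[symmetric, of "{..<r}" x]
      using B[OF x] by (intro Bochner_Integration.integral_diff Max_integrable lin_integrable)
    finally show ?thesis by simp
  qed
  have ind\<Phi>: "integrable (gauss J) (\<lambda>z. ind x z * \<Phi> x z)" if x: "x \<in> P" for x
  proof (rule Bochner_Integration.integrable_bound[OF \<Phi>_int[OF x]])
    show "J1 \<subseteq> J" by (auto simp: J_def)
    show "(\<lambda>z. ind x z * \<Phi> x z) \<in> borel_measurable (gauss J)"
      using ind_meas \<Phi>_int[OF x, of J] by (intro borel_measurable_times) (auto simp: J_def)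
    show "AE z in gauss J. norm (ind x z * \<Phi> x z) \<le> norm (\<Phi> x z)" by (auto simp: ind_def)
  qed
  have ind_restrict: "ind x (restrict z (J0 \<union> J2)) = ind x z" for x z by (simp add: ind_def J0_def)
  have \<Phi>_restrict: "\<Phi> x (restrict z J1) = \<Phi> x z" for x z
  proof -
    have "(\<Sum>j<r. (t j - x j) * restrict z J1 (1, j)) = (\<Sum>j<r. (t j - x j) * z (1, j))" for t
      by (intro sum.cong) (auto simp: J1_def)
    then show ?thesis by (simp add: \<Phi>_def)
  qed
  have ind\<Phi>_mean: "(\<integral>z. ind x z * \<Phi> x z \<partial>gauss J) = (\<integral>z. ind x z \<partial>gauss (J0 \<union> J2)) * gwidth r (B x)" if x: "x \<in> P" for x
  proof -
    have "(\<integral>z. ind x (restrict z (J0 \<union> J2)) * \<Phi> x (restrict z J1) \<partial>gauss J)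
      = (\<integral>z. ind x z \<partial>gauss (J0 \<union> J2)) * (\<integral>z. \<Phi> x z \<partial>gauss J1)"
      unfolding J_def
      by (rule gauss_indep[OF finJ(2,3) disj])
         (use ind\<Phi>[OF x] in \<open>simp add: ind_restrict \<Phi>_restrict J_def\<close>)
    then show ?thesis by (simp add: ind_restrict \<Phi>_restrict \<Phi>_mean[OF x])
  qed
  have sel: "\<exists>!x. x \<in> P \<and> ind x z = 1" for z
  proof -
    define S where "S = {j\<in>{..<k}. z (0::nat, j) \<ge> 0}"
    have "ind x z = 1 \<longleftrightarrow> h x = S" if "x \<in> P" for x
    proof -
      have "h x \<subseteq> {..<k}" using h that by (auto simp: bij_betw_def)
      then show ?thesis by (auto simp: ind_def S_def)
    qed
    moreover have "\<exists>!x. x \<in> P \<and> h x = S"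
    proof -
      have "S \<in> Pow {..<k}" by (auto simp: S_def)
      then have "S \<in> h ` P" using h by (simp add: bij_betw_def)
      then obtain x where "x \<in> P" "h x = S" by blast
      then show ?thesis using h by (auto simp: bij_betw_def inj_on_def)
    qed
    ultimately show ?thesis by (metis (full_types))
  qed
  have sum_ind: "(\<Sum>x\<in>P. ind x z * f x) = f (THE x. x \<in> P \<and> ind x z = 1)" for z and f :: "_ \<Rightarrow> real"
  proof -
    obtain x where x: "x \<in> P" "ind x z = 1" "\<And>y. y \<in> P \<and> ind y z = 1 \<Longrightarrow> y = x" using sel[of z] by blast
    have the: "(THE x. x \<in> P \<and> ind x z = 1) = x" by (rule the_equality) (use x in blast)+
    have "ind y z = 0 \<or> ind y z = 1" for y by (simp add: ind_def)
    then have 0: "ind y z * f y = 0" if "y \<in> P - {x}" for y using x(3)[of y] that by fastforce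
    have "(\<Sum>y\<in>P - {x}. ind y z * f y) = 0" by (rule sum.neutral) (use 0 in blast)
    then show ?thesis unfolding the sum.remove[OF P(1) x(1)] by (simp add: x(2))
  qed
  have abs_int: "integrable (gauss J) (\<lambda>z. lam * (\<Sum>j<k. \<bar>z (0, j)\<bar>))"
    by (intro integrable_mult_right Bochner_Integration.integrable_sum integrable_abs gauss_component_integrable)
       (auto simp: J_def J0_def)
  have "e * sqrt k / 5 + m \<le> lam * k * sqrt (2 / pi) + m"
  proof -
    \<comment> \<open>The expected absolute value of a standard normal variable is at least 7/10,
      and a third of 7/10 exceeds 1/5.\<close>
    have "(7 / 10)\<^sup>2 \<le> 2 / pi" using pi_less_4 by (simp add: field_simps power2_eq_square)
    then have "7 / 10 \<le> sqrt (2 / pi)" by (rule real_le_rsqrt)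
    then have "e * sqrt k / 3 * (7 / 10) \<le> e * sqrt k / 3 * sqrt (2 / pi)"
      using e by (intro mult_left_mono) auto
    moreover have "lam * k = e * sqrt k / 3"
      using k real_div_sqrt[of "real k"] by (simp add: lam_def field_simps)
    then have "lam * k * sqrt (2 / pi) = e * sqrt k / 3 * sqrt (2 / pi)" by (rule arg_cong)
    moreover have "e * sqrt k / 5 \<le> e * sqrt k / 3 * (7 / 10)" using e by simp
    ultimately show ?thesis by linarith
  qed
  also have "\<dots> = (\<integral>z. lam * (\<Sum>j<k. \<bar>z (0, j)\<bar>) \<partial>gauss J) + m"
  proof -
    have "(\<integral>z. \<bar>z (0::nat, j)\<bar> \<partial>gauss J) = sqrt (2 / pi)" "integrable (gauss J) (\<lambda>z. \<bar>z (0::nat, j)\<bar>)" if "j < k" for j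
      using that by (auto intro!: gauss_component_abs gauss_component_integrable integrable_abs simp: J_def J0_def)
    then show ?thesis by simp
  qed
  also have "m \<le> (\<Sum>x\<in>P. (\<integral>z. ind x z * \<Phi> x z \<partial>gauss J))"
  proof -
    interpret prob_space "gauss (J0 \<union> J2)" by (rule prob_space_gauss)
    have ii: "integrable (gauss (J0 \<union> J2)) (ind x)" for x
      by (rule integrable_const_bound[where B=1]) (use ind_meas in \<open>auto simp: ind_def\<close>)
    have "(\<Sum>x\<in>P. (\<integral>z. ind x z * \<Phi> x z \<partial>gauss J)) = (\<integral>z. (\<Sum>x\<in>P. ind x z * gwidth r (B x)) \<partial>gauss (J0 \<union> J2))"
      using ii by (simp add: ind\<Phi>_mean)
    also have "\<dots> \<ge> (\<integral>z. m \<partial>gauss (J0 \<union> J2))"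
    proof (rule integral_mono)
      fix z
      have "(THE x. x \<in> P \<and> ind x z = 1) \<in> P" using theI'[OF sel[of z]] by blast
      then show "m \<le> (\<Sum>x\<in>P. ind x z * gwidth r (B x))" unfolding sum_ind m_def using P by auto
    qed (use ii in auto)
    finally show ?thesis by (simp add: prob_space)
  qed
  also have "(\<integral>z. lam * (\<Sum>j<k. \<bar>z (0, j)\<bar>) \<partial>gauss J) + (\<Sum>x\<in>P. (\<integral>z. ind x z * \<Phi> x z \<partial>gauss J))
    = (\<integral>z. lam * (\<Sum>j<k. \<bar>z (0, j)\<bar>) + (\<Sum>x\<in>P. ind x z * \<Phi> x z) \<partial>gauss J)"
    using abs_int ind\<Phi> by (subst Bochner_Integration.integral_add) (auto simp: Bochner_Integration.integral_sum)
  also have "\<dots> \<le> (\<integral>z. Max ((\<lambda>i. lin J (b i) z) ` I) \<partial>gauss J)"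
  proof (rule integral_mono)
    show "integrable (gauss J) (\<lambda>z. lam * (\<Sum>j<k. \<bar>z (0, j)\<bar>) + (\<Sum>x\<in>P. ind x z * \<Phi> x z))"
      using abs_int ind\<Phi> by (intro Bochner_Integration.integrable_add Bochner_Integration.integrable_sum)
    show "integrable (gauss J) (\<lambda>z. Max ((\<lambda>i. lin J (b i) z) ` I))"
      using I by (intro Max_integrable lin_integrable)
    fix z
    \<comment> \<open>For the selected point all products of sign and coordinate are absolute
      values. Joined with a maximiser in its own ball it is one index of the
      \<open>b\<close>-process, whose value the maximum dominates.\<close>
    define x where "x = (THE x. x \<in> P \<and> ind x z = 1)"
    have x: "x \<in> P" "ind x z = 1" using theI'[OF sel[of z]] by (auto simp: x_def)
    have "Max ((\<lambda>t. \<Sum>j<r. (t j - x j) * z (1::nat, j)) ` B x) \<in> (\<lambda>t. \<Sum>j<r. (t j - x j) * z (1::nat, j)) ` B x"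
      using B[OF x(1)] by (intro Max_in) auto
    then obtain t where t: "t \<in> B x" "\<Phi> x z = (\<Sum>j<r. (t j - x j) * z (1, j))" by (auto simp: \<Phi>_def)
    have "sg x j * z (0, j) = \<bar>z (0, j)\<bar>" if "j < k" for j
      using x(2) that by (auto simp: ind_def sg_def split: if_splits)
    then have "lam * (\<Sum>j<k. \<bar>z (0, j)\<bar>) + \<Phi> x z = lin J (b (x, t)) z"
      by (simp add: lin_def sumJ b_def t sum_distrib_left mult.assoc)
    also have "\<dots> \<le> Max ((\<lambda>i. lin J (b i) z) ` I)"
      using I x t by (intro Max_ge) (auto simp: I_def intro!: image_eqI[of _ _ "(x, t)"])
    finally show "lam * (\<Sum>j<k. \<bar>z (0, j)\<bar>) + (\<Sum>x\<in>P. ind x z * \<Phi> x z) \<le> Max ((\<lambda>i. lin J (b i) z) ` I)"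
      by (simp add: sum_ind x_def)
  qed
  also have "\<dots> \<le> gwidth r (\<Union>x\<in>P. B x)" using SF RHS by simp
  finally have fin: "e * sqrt k / 5 + m \<le> gwidth r (\<Union>x\<in>P. B x)" by simp
  have "m \<in> (\<lambda>x. gwidth r (B x)) ` P" unfolding m_def using P P0 by (intro Min_in) auto
  then obtain x where "x \<in> P" "m = gwidth r (B x)" by blast
  then show ?thesis using fin by auto
qed

section \<open>Admissible nets from a growth condition\<close>

text \<open>The functional \<open>W\<close> abstracts the Gaussian width. Packings of size
  \<open>2 ^ 4 ^ n\<close> are used so that the square root of the logarithm of their size is of
  order \<open>2 ^ n\<close>.\<close>

locale growth_space =
  fixes T :: "'a set" and d :: "'a \<Rightarrow> 'a \<Rightarrow> real" and W :: "'a set \<Rightarrow> real"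
  assumes finite_T: "finite T" and T_nonempty: "T \<noteq> {}"
    and d_self: "d x x = 0" and d_nonneg: "0 \<le> d x y" and d_commute: "d x y = d y x"
    and d_triangle: "d x z \<le> d x y + d y z"
    and W_mono: "A \<subseteq> A' \<Longrightarrow> A \<noteq> {} \<Longrightarrow> A' \<subseteq> T \<Longrightarrow> W A \<le> W A'"
    and W_singleton: "x \<in> T \<Longrightarrow> 0 \<le> W {x}"
    and growth: "\<lbrakk>P \<subseteq> T; card P = 2 ^ 4 ^ n; e > 0;
       \<And>x y. x \<in> P \<Longrightarrow> y \<in> P \<Longrightarrow> x \<noteq> y \<Longrightarrow> e \<le> d x y;
       \<And>x. x \<in> P \<Longrightarrow> B x \<subseteq> T \<and> B x \<noteq> {};
       \<And>x t. x \<in> P \<Longrightarrow> t \<in> B x \<Longrightarrow> d x t \<le> e / 8\<rbrakk>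
       \<Longrightarrow> \<exists>x\<in>P. e * 2 ^ n / 5 + W (B x) \<le> W (\<Union>x\<in>P. B x)"
begin

definition bl :: "'a \<Rightarrow> real \<Rightarrow> 'a set" where "bl x s = {u \<in> T. d x u \<le> s}"

text \<open>An interpolation functional. The increments in \<open>n\<close> of its minimum dominate \<open>2 ^ n * rad n x\<close>,
  so these telescope to at most a multiple of \<open>W T\<close>.\<close>

definition cost :: "nat \<Rightarrow> 'a \<Rightarrow> 'a \<Rightarrow> real" where
  "cost n x y = 2 ^ n / 100 * d x y + W T - W (bl x (d x y))"

text \<open>Radii are parametrised by points: only distances from \<open>x\<close> to elements of
  \<open>T\<close> compete, so the minimum runs over a finite set and is attained.\<close>

definition near :: "nat \<Rightarrow> 'a \<Rightarrow> 'a" where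
  "near n x = (SOME y. y \<in> T \<and> (\<forall>u\<in>T. cost n x y \<le> cost n x u))"

definition rad :: "nat \<Rightarrow> 'a \<Rightarrow> real" where "rad n x = d x (near n x)"

lemma near: "near n x \<in> T" and cost_near: "u \<in> T \<Longrightarrow> cost n x (near n x) \<le> cost n x u"
proof -
  have "\<exists>y. y \<in> T \<and> (\<forall>u\<in>T. cost n x y \<le> cost n x u)"
  proof -
    have "Min (cost n x ` T) \<in> cost n x ` T" using finite_T T_nonempty by (intro Min_in) auto
    then obtain y where "y \<in> T" "Min (cost n x ` T) = cost n x y" by blast
    then show ?thesis using finite_T Min_le[of "cost n x ` T"] by (metis finite_imageI imageI)
  qed
  from someI_ex[OF this] show "near n x \<in> T" "u \<in> T \<Longrightarrow> cost n x (near n x) \<le> cost n x u"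
    unfolding near_def by blast+
qed

lemma bl_subset: "bl x s \<subseteq> T" by (auto simp: bl_def)

lemma in_bl: "x \<in> T \<Longrightarrow> s \<ge> 0 \<Longrightarrow> x \<in> bl x s" by (simp add: bl_def d_self)

lemma W_T_nonneg: "0 \<le> W T"
  using T_nonempty W_singleton W_mono[of "{_}" T] by fastforce

lemma rad_nonneg: "0 \<le> rad n x" by (simp add: rad_def d_nonneg)

lemma sum_rad_le_cost: "x \<in> T \<Longrightarrow> (\<Sum>n\<le>k. 2 ^ n * rad n x) / 200 \<le> cost k x (near k x)"
proof (induction k)
  case 0
  have "W (bl x (rad 0 x)) \<le> W T" using 0 in_bl[OF 0 rad_nonneg] by (intro W_mono bl_subset) auto
  then show ?case using rad_nonneg[of 0 x] by (simp add: cost_def flip: rad_def)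
next
  case (Suc k)
  \<comment> \<open>The minimiser of the next level is a competitor at this level, and for a fixed
    point the two costs differ only in the coefficient of the distance. Hence the increment is
    \<open>2 ^ Suc k * rad (Suc k) x / 200\<close>.\<close>
  have "cost k x (near k x) \<le> cost k x (near (Suc k) x)" by (intro cost_near near)
  also have "\<dots> = cost (Suc k) x (near (Suc k) x) - 2 ^ k * rad (Suc k) x / 100"
    by (simp add: cost_def rad_def)
  finally show ?case using Suc by (simp add: add_divide_distrib)
qed

lemma sum_rad: assumes "x \<in> T" shows "(\<Sum>n<k. 2 ^ n * rad n x) \<le> 200 * W T"
proof -
  have "(\<Sum>n<k. 2 ^ n * rad n x) \<le> (\<Sum>n\<le>k. 2 ^ n * rad n x)"
    by (intro sum_mono2) (auto simp: rad_nonneg)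
  also have "\<dots> \<le> 200 * cost k x (near k x)" using sum_rad_le_cost[OF assms, of k] by simp
  \<comment> \<open>The point \<open>x\<close> itself, that is radius zero, competes at every level
    and costs at most \<open>W T\<close>.\<close>
  also have "cost k x (near k x) \<le> cost k x x" by (rule cost_near[OF assms])
  also have "cost k x x \<le> W T"
  proof -
    have "W {x} \<le> W (bl x 0)" using assms in_bl[OF assms, of 0] by (intro W_mono bl_subset) auto
    then show ?thesis using W_singleton[OF assms] by (simp add: cost_def d_self)
  qed
  finally show ?thesis by simp
qed

text \<open>Two estimates collide. With packing distance \<open>D / 8\<close>, growth gives some
  \<open>x\<close> in the packing whose small ball falls short of the union in width by at least 2^n
  D / 40. Minimality of \<open>rad n x\<close> says that enlarging the radius until the ball covers
  the union gains at most 2^n / 100 times the new radius, which is hardly more than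
  \<open>D\<close>.\<close>

lemma packing_bound:
  assumes Q: "Q \<subseteq> T" and diam: "\<And>x y. x \<in> Q \<Longrightarrow> y \<in> Q \<Longrightarrow> d x y \<le> D"
    and small: "\<And>x. x \<in> Q \<Longrightarrow> rad n x < D / 64"
    and sep: "\<And>x y. x \<in> Q \<Longrightarrow> y \<in> Q \<Longrightarrow> x \<noteq> y \<Longrightarrow> D / 8 \<le> d x y"
  shows "card Q < 2 ^ 4 ^ n"
proof (rule ccontr)
  assume "\<not> card Q < 2 ^ 4 ^ n"
  then obtain P where P: "P \<subseteq> Q" "card P = 2 ^ 4 ^ n"
    using obtain_subset_with_card_n[of "2 ^ 4 ^ n" Q] by auto
  then obtain z where z: "z \<in> P" by (metis card.empty equals0I power_not_zero zero_neq_numeral)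
  have D: "D > 0" using small[of z] rad_nonneg[of n z] z P by force
  define B where "B x = bl x (rad n x)" for x
  have B: "B x \<subseteq> T \<and> B x \<noteq> {}" "x \<in> B x" if "x \<in> P" for x
  proof -
    have "x \<in> T" using that P Q by blast
    then have "x \<in> B x" unfolding B_def by (rule in_bl[OF _ rad_nonneg])
    then show "B x \<subseteq> T \<and> B x \<noteq> {}" "x \<in> B x" using bl_subset unfolding B_def by blast+
  qed
  have rB: "d x t \<le> rad n x" if "t \<in> B x" for x t using that by (simp add: B_def bl_def)
  have "\<exists>x\<in>P. (D / 8) * 2 ^ n / 5 + W (B x) \<le> W (\<Union>x\<in>P. B x)"
  proof (rule growth)
    show "P \<subseteq> T" using P Q by blast
    show "d x t \<le> D / 8 / 8" if "x \<in> P" "t \<in> B x" for x t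
      using rB[OF that(2)] small[of x] that P by force
    show "D / 8 \<le> d x y" if "x \<in> P" "y \<in> P" "x \<noteq> y" for x y using sep that P by blast
  qed (use P B D in auto)
  then obtain x where x: "x \<in> P" "(D / 8) * 2 ^ n / 5 + W (B x) \<le> W (\<Union>x\<in>P. B x)" by blast
  let ?U = "\<Union>x\<in>P. B x"
  have U: "?U \<subseteq> T" "x \<in> ?U" using B x by auto
  have finU: "finite (d x ` ?U)" using U finite_T finite_subset by blast
  have "Max (d x ` ?U) \<in> d x ` ?U" using finU U by (intro Max_in) auto
  then obtain y where y: "y \<in> ?U" "Max (d x ` ?U) = d x y" by blast
  \<comment> \<open>Taking a farthest point \<open>y\<close> of the union makes the covering radius
    one of those that compete in \<open>cost\<close>.\<close>
  have "?U \<subseteq> bl x (d x y)"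
    unfolding y(2)[symmetric] bl_def using U finU Max_ge by blast
  then have "W ?U \<le> W (bl x (d x y))" using U by (intro W_mono bl_subset) auto
  moreover have "cost n x (near n x) \<le> cost n x y" using y U by (intro cost_near) auto
  ultimately have 1: "W ?U \<le> W (B x) + 2 ^ n / 100 * d x y"
    using mult_nonneg_nonneg[OF _ rad_nonneg[of n x], of "2 ^ n / 100"] by (simp add: cost_def B_def rad_def)
  obtain w where w: "w \<in> P" "y \<in> B w" using y by blast
  have "d x y \<le> d x w + d w y" by (rule d_triangle)
  also have "\<dots> \<le> D + D / 64"
    using diam[of x w] rB[OF w(2)] small[of w] w x P by force
  finally have "2 ^ n / 100 * d x y \<le> 2 ^ n / 100 * (D + D / 64)" by (intro mult_left_mono) auto
  \<comment> \<open>A contradiction for positive \<open>D\<close>, since 1/40 exceeds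
    65/6400.\<close>
  with 1 x(2) have "(D / 8) * 2 ^ n / 5 \<le> 2 ^ n / 100 * (D + D / 64)" by linarith
  then have "2 ^ n * D \<le> 0" by (simp add: algebra_simps)
  moreover have "0 < 2 ^ n * D" using D by simp
  ultimately show False by linarith
qed

text \<open>A separated subset of maximal cardinality is a net, and \<open>packing_bound\<close>
  limits its size.\<close>

lemma covering:
  assumes A: "A \<subseteq> T" and diam: "\<And>x y. x \<in> A \<Longrightarrow> y \<in> A \<Longrightarrow> d x y \<le> D"
    and small: "\<And>x. x \<in> A \<Longrightarrow> rad n x < D / 64"
  shows "\<exists>Q\<subseteq>A. card Q < 2 ^ 4 ^ n \<and> (\<forall>x\<in>A. \<exists>q\<in>Q. d x q \<le> D / 8)"
proof -
  define F where "F = {Q. Q \<subseteq> A \<and> (\<forall>x\<in>Q. \<forall>y\<in>Q. x \<noteq> y \<longrightarrow> D / 8 \<le> d x y)}"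
  have finA: "finite A" using A finite_T finite_subset by blast
  have F: "finite F" "{} \<in> F"
    using finite_subset[of F "Pow A"] finA by (auto simp: F_def)
  have "Max (card ` F) \<in> card ` F" using F by (intro Max_in) auto
  then obtain Q where Q: "Q \<in> F" "Max (card ` F) = card Q" by blast
  have max: "card Q' \<le> card Q" if "Q' \<in> F" for Q' unfolding Q(2)[symmetric] using F that by auto
  have "card Q < 2 ^ 4 ^ n"
  proof (rule packing_bound[of Q D])
    have QA: "Q \<subseteq> A" using Q(1) by (simp add: F_def)
    show "Q \<subseteq> T" using QA A by blast
    show "d x y \<le> D" if "x \<in> Q" "y \<in> Q" for x y using diam that QA by blast
    show "rad n x < D / 64" if "x \<in> Q" for x using small that QA by blast
    show "D / 8 \<le> d x y" if "x \<in> Q" "y \<in> Q" "x \<noteq> y" for x y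
      using Q(1) that by (simp add: F_def)
  qed
  moreover have "\<exists>q\<in>Q. d x q \<le> D / 8" if x: "x \<in> A" for x
  proof (rule ccontr)
    assume *: "\<not> (\<exists>q\<in>Q. d x q \<le> D / 8)"
    have "D > 0" using small[OF x] rad_nonneg[of n x] by simp
    then have "x \<notin> Q" using * d_self by force
    moreover have "insert x Q \<in> F"
    proof -
      have "D / 8 \<le> d x q" "D / 8 \<le> d q x" if "q \<in> Q" for q
        using * that d_commute[of q x] by (auto simp: not_le)
      then show ?thesis using Q(1) x unfolding F_def by blast
    qed
    moreover have "finite Q" using Q finA finite_subset by (auto simp: F_def)
    ultimately show False using max[of "insert x Q"] by simp
  qed
  ultimately show ?thesis using Q by (auto simp: F_def)
qed

text \<open>One level of a sequence of admissible partitions as in generic chaining. The partition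
  is coded by a labelling, and the diameter bound may vary from class to class.\<close>

definition admissible :: "nat \<Rightarrow> ('a \<Rightarrow> 'a) \<times> ('a \<Rightarrow> real) \<Rightarrow> bool" where
  "admissible n cD \<longleftrightarrow> card (fst cD ` T) \<le> 2 ^ 4 ^ n \<and> (\<forall>x\<in>T. snd cD x > 0) \<and>
    (\<forall>x\<in>T. \<forall>y\<in>T. fst cD x = fst cD y \<longrightarrow> d x y \<le> snd cD x \<and> snd cD x = snd cD y)"

text \<open>A point of large radius keeps the old diameter bound, which its radius pays for; only the
  remaining points of a class are covered by smaller balls.\<close>

lemma refine:
  assumes adm: "admissible n (c, D)"
  shows "\<exists>c' D'. admissible (Suc n) (c', D') \<and> (\<forall>x\<in>T. D' x \<le> D x / 4 + 64 * rad n x)"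
proof -
  have cD: "card (c ` T) \<le> 2 ^ 4 ^ n" "\<And>x. x \<in> T \<Longrightarrow> D x > 0"
    "\<And>x y. x \<in> T \<Longrightarrow> y \<in> T \<Longrightarrow> c x = c y \<Longrightarrow> d x y \<le> D x"
    "\<And>x y. x \<in> T \<Longrightarrow> y \<in> T \<Longrightarrow> c x = c y \<Longrightarrow> D x = D y"
    using adm unfolding admissible_def fst_conv snd_conv by blast+
  define A where "A l = {x \<in> T. c x = l \<and> rad n x < D x / 64}" for l
  have "\<exists>Q\<subseteq>A l. card Q < 2 ^ 4 ^ n \<and> (\<forall>x\<in>A l. \<exists>q\<in>Q. d x q \<le> D x / 8)" for l
  proof (cases "A l = {}")
    case False
    then obtain x0 where x0: "x0 \<in> A l" by blast
    have eq: "D x = D x0" if "x \<in> A l" for x using that x0 cD(4) by (auto simp: A_def)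
    have "\<exists>Q\<subseteq>A l. card Q < 2 ^ 4 ^ n \<and> (\<forall>x\<in>A l. \<exists>q\<in>Q. d x q \<le> D x0 / 8)"
    proof (rule covering)
      show "d x y \<le> D x0" if "x \<in> A l" "y \<in> A l" for x y
        using cD(3)[of x y] eq[OF that(1)] that by (auto simp: A_def)
      show "rad n x < D x0 / 64" if "x \<in> A l" for x
        using eq[OF that] that by (auto simp: A_def)
    qed (auto simp: A_def)
    then show ?thesis using eq by metis
  qed auto
  then obtain Q where Q: "\<And>l. Q l \<subseteq> A l" "\<And>l. card (Q l) < 2 ^ 4 ^ n"
    "\<And>l x. x \<in> A l \<Longrightarrow> \<exists>q\<in>Q l. d x q \<le> D x / 8" by metis
  define pk where "pk x = (SOME q. q \<in> Q (c x) \<and> d x q \<le> D x / 8)" for x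
  \<comment> \<open>\<open>None\<close> collects the points of large radius in a class. The strict
    inequality in the bound on \<open>card (Q l)\<close> leaves room for exactly this extra
    label.\<close>
  define lab where "lab x = (c x, if x \<in> A (c x) then Some (pk x) else None)" for x
  \<comment> \<open>Each new label is replaced by a representative in \<open>T\<close>, so that the
    labelling has the same type at every level and the construction can be iterated.\<close>
  define c' where "c' x = (SOME y. y \<in> T \<and> lab y = lab x)" for x
  define D' where "D' x = (if x \<in> A (c x) then D x / 4 else D x)" for x
  have pick: "pk x \<in> Q (c x)" "d x (pk x) \<le> D x / 8" if "x \<in> A (c x)" for x
    unfolding pk_def using someI_ex[of "\<lambda>q. q \<in> Q (c x) \<and> d x q \<le> D x / 8"] Q(3)[OF that] by blast+
  have lab_c': "lab x = lab y" if "x \<in> T" "y \<in> T" "c' x = c' y" for x y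
  proof -
    have "lab (c' x) = lab x" if "x \<in> T" for x
      unfolding c'_def using someI_ex[of "\<lambda>y. y \<in> T \<and> lab y = lab x"] that by blast
    then show ?thesis using that by metis
  qed
  have finQ: "finite (Q l)" for l
    using Q(1)[of l] finite_T finite_subset[of "Q l" T] by (auto simp: A_def)
  have "card (c' ` T) \<le> card (lab ` T)"
  proof -
    have "c' ` T = (\<lambda>l. SOME y. y \<in> T \<and> lab y = l) ` (lab ` T)" by (simp add: c'_def image_image)
    then show ?thesis using finite_T by (simp add: card_image_le)
  qed
  also have "\<dots> \<le> card (Sigma (c ` T) (\<lambda>l. insert None (Some ` Q l)))"
  proof (rule card_mono)
    show "finite (Sigma (c ` T) (\<lambda>l. insert None (Some ` Q l)))" using finite_T finQ by auto
    show "lab ` T \<subseteq> Sigma (c ` T) (\<lambda>l. insert None (Some ` Q l))"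
      using pick(1) by (auto simp: lab_def)
  qed
  also have "\<dots> = (\<Sum>l\<in>c ` T. card (insert None (Some ` Q l)))"
    using finite_T finQ by (intro card_SigmaI) auto
  also have "\<dots> \<le> (\<Sum>l\<in>c ` T. 2 ^ 4 ^ n)"
  proof (rule sum_mono)
    fix l
    have "card (insert None (Some ` Q l)) \<le> Suc (card (Q l))"
      using finQ[of l] card_image_le[of "Q l" Some] by (simp add: card_insert_if)
    then show "card (insert None (Some ` Q l)) \<le> 2 ^ 4 ^ n" using Q(2)[of l] by linarith
  qed
  also have "\<dots> \<le> 2 ^ 4 ^ n * 2 ^ 4 ^ n" using cD(1) by simp
  also have "\<dots> \<le> 2 ^ 4 ^ Suc n" by (simp flip: power_add)
  finally have card: "card (c' ` T) \<le> 2 ^ 4 ^ Suc n" .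
  have inv: "d x y \<le> D' x \<and> D' x = D' y" if xy: "x \<in> T" "y \<in> T" "c' x = c' y" for x y
  proof -
    have l: "lab x = lab y" by (rule lab_c'[OF xy])
    then have c: "c x = c y" by (simp add: lab_def)
    have A: "x \<in> A (c x) \<longleftrightarrow> y \<in> A (c y)" using l by (auto simp: lab_def split: if_splits)
    have D: "D x = D y" "d x y \<le> D x" using cD(3,4)[OF xy(1,2) c] by auto
    \<comment> \<open>Both points lie within \<open>D x / 8\<close> of their common net
      point.\<close>
    have "d x y \<le> D x / 4" if x: "x \<in> A (c x)"
    proof -
      have y: "y \<in> A (c y)" using A x by simp
      have eq: "pk x = pk y" using l x y by (simp add: lab_def)
      show ?thesis
        using pick(2)[OF x] pick(2)[OF y] d_triangle[of x y "pk y"] d_commute[of "pk y" y] D(1)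
        unfolding eq by linarith
    qed
    then show ?thesis using A D by (simp add: D'_def)
  qed
  have "D' x \<le> D x / 4 + 64 * rad n x" if "x \<in> T" for x
    using that rad_nonneg[of n x] cD(2)[OF that] by (auto simp: D'_def A_def)
  moreover have "D' x > 0" if "x \<in> T" for x using cD(2)[OF that] by (simp add: D'_def)
  ultimately show ?thesis using card inv
    unfolding admissible_def fst_conv snd_conv by blast
qed

text \<open>From one level to the next the weight \<open>2 ^ n\<close> doubles while the diameter
  bound is quartered, so the weighted sum is at most \<open>\<Delta>\<close>, plus half of itself,
  plus 128 times the weighted sum of radii. As the latter is at most \<open>200 * W T\<close>, this
  gives \<open>2 * \<Delta>\<close> and 51200 = 2 * 128 * 200.\<close>

theorem admissible_nets:
  assumes \<Delta>: "\<Delta> > 0" "\<And>x y. x \<in> T \<Longrightarrow> y \<in> T \<Longrightarrow> d x y \<le> \<Delta>"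
  shows "\<exists>(p :: nat \<Rightarrow> 'a \<Rightarrow> 'a) D n1. (\<forall>n. \<forall>x\<in>T. p n x \<in> T \<and> D n x > 0 \<and> d x (p n x) \<le> D n x \<and> D n (p n x) = D n x) \<and>
     (\<forall>n. card (p n ` T) \<le> 2 ^ 4 ^ n) \<and> (\<forall>n\<ge>n1. \<forall>x\<in>T. p n x = x) \<and>
     (\<forall>k. \<forall>x\<in>T. (\<Sum>n<k. 2 ^ n * D n x) \<le> 2 * \<Delta> + 51200 * W T)"
proof -
  have "\<exists>f. \<forall>n. admissible n (f n) \<and> (\<forall>x\<in>T. n = 0 \<longrightarrow> snd (f n) x = \<Delta>) \<and>
      (\<forall>x\<in>T. snd (f (Suc n)) x \<le> snd (f n) x / 4 + 64 * rad n x)"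
  proof (rule exE[OF dependent_nat_choice[where P="\<lambda>n f. admissible n f \<and> (\<forall>x\<in>T. n = 0 \<longrightarrow> snd f x = \<Delta>)"
        and Q="\<lambda>n f g. \<forall>x\<in>T. snd g x \<le> snd f x / 4 + 64 * rad n x"]])
    show "\<exists>f. admissible 0 f \<and> (\<forall>x\<in>T. (0::nat) = 0 \<longrightarrow> snd f x = \<Delta>)"
    proof (intro exI conjI)
      have "(\<lambda>_. SOME x. x \<in> T) ` T = {SOME x. x \<in> T}" using T_nonempty by auto
      then show "admissible 0 (\<lambda>_. SOME x. x \<in> T, \<lambda>_. \<Delta>)" using \<Delta> by (simp add: admissible_def)
    qed auto
    show "\<exists>g. (admissible (Suc n) g \<and> (\<forall>x\<in>T. Suc n = 0 \<longrightarrow> snd g x = \<Delta>)) \<and>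
        (\<forall>x\<in>T. snd g x \<le> snd f x / 4 + 64 * rad n x)"
      if "admissible n f \<and> (\<forall>x\<in>T. n = 0 \<longrightarrow> snd f x = \<Delta>)" for f n
      using refine[of n "fst f" "snd f"] that by force
  qed blast
  then obtain f where f: "\<And>n. admissible n (f n)" "\<And>x. x \<in> T \<Longrightarrow> snd (f 0) x = \<Delta>"
    "\<And>n x. x \<in> T \<Longrightarrow> snd (f (Suc n)) x \<le> snd (f n) x / 4 + 64 * rad n x" by blast
  define D where "D n = snd (f n)" for n
  define c where "c n = fst (f n)" for n
  have cD: "card (c n ` T) \<le> 2 ^ 4 ^ n" "\<And>x. x \<in> T \<Longrightarrow> D n x > 0"
    "\<And>x y. x \<in> T \<Longrightarrow> y \<in> T \<Longrightarrow> c n x = c n y \<Longrightarrow> d x y \<le> D n x"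
    "\<And>x y. x \<in> T \<Longrightarrow> y \<in> T \<Longrightarrow> c n x = c n y \<Longrightarrow> D n x = D n y" for n
    using f(1)[of n] unfolding admissible_def D_def c_def by blast+
  \<comment> \<open>As soon as a net is allowed \<open>card T\<close> points it is all of
    \<open>T\<close>, so every chain ends at its own point after finitely many steps.\<close>
  define p where "p n x = (if card T \<le> 2 ^ 4 ^ n then x else SOME y. y \<in> T \<and> c n y = c n x)" for n x
  have p: "p n x \<in> T" "c n (p n x) = c n x" if "x \<in> T" for n x
    using someI_ex[of "\<lambda>y. y \<in> T \<and> c n y = c n x"] that by (auto simp: p_def)
  have sum: "(\<Sum>n<k. 2 ^ n * D n x) \<le> 2 * \<Delta> + 51200 * W T" if x: "x \<in> T" for k x
  proof (induction k)
    case 0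
    then show ?case using \<Delta> W_T_nonneg by simp
  next
    case (Suc k)
    have "(\<Sum>n<Suc k. 2 ^ n * D n x) = D 0 x + (\<Sum>n<k. 2 ^ Suc n * D (Suc n) x)"
      by (subst sum.lessThan_Suc_shift) simp
    also have "\<dots> \<le> \<Delta> + (\<Sum>n<k. 2 ^ Suc n * (D n x / 4 + 64 * rad n x))"
      using f(2,3)[OF x] by (intro add_mono sum_mono mult_left_mono) (auto simp: D_def)
    also have "\<dots> = \<Delta> + (\<Sum>n<k. 2 ^ n * D n x) / 2 + 128 * (\<Sum>n<k. 2 ^ n * rad n x)"
      by (simp add: sum_distrib_left sum_divide_distrib algebra_simps sum.distrib)
    also have "\<dots> \<le> \<Delta> + (2 * \<Delta> + 51200 * W T) / 2 + 128 * (200 * W T)"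
      using Suc sum_rad[OF x, of k] by (intro add_mono divide_right_mono mult_left_mono) auto
    finally show ?case by (simp add: add_divide_distrib)
  qed
  have "card (p n ` T) \<le> 2 ^ 4 ^ n" for n
  proof (cases "card T \<le> 2 ^ 4 ^ n")
    case False
    then have "p n ` T = (\<lambda>l. SOME y. y \<in> T \<and> c n y = l) ` (c n ` T)"
      by (simp add: p_def image_image)
    then have "card (p n ` T) \<le> card (c n ` T)" using finite_T by (simp add: card_image_le)
    then show ?thesis using cD(1)[of n] by linarith
  qed (simp add: p_def)
  moreover have "p n x = x" if "card T \<le> n" for n x
  proof -
    have "card T < 2 ^ card T" by simp
    also have "\<dots> \<le> (2::nat) ^ 4 ^ n"
    proof (rule power_increasing)
      have "n < 4 ^ n" by (rule power_gt_expt) simp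
      then show "card T \<le> 4 ^ n" using that by linarith
    qed simp
    finally show ?thesis by (simp add: p_def)
  qed
  moreover have "p n x \<in> T \<and> D n x > 0 \<and> d x (p n x) \<le> D n x \<and> D n (p n x) = D n x" if "x \<in> T" for n x
  proof -
    note 1 = p(1)[OF that, of n] p(2)[OF that, of n]
    show ?thesis using 1(1) cD(2)[OF that, of n] cD(3)[OF that 1(1) 1(2)[symmetric]] cD(4)[OF 1(1) that 1(2)] by blast
  qed
  ultimately show ?thesis using sum by (intro exI[of _ p] exI[of _ D] exI[of _ "card T"]) blast
qed

end

section \<open>Chaining\<close>

lemma power_add_le: "0 \<le> a \<Longrightarrow> 0 \<le> b \<Longrightarrow> (a + b) ^ m \<le> 2 ^ m * (a ^ m + b ^ m)" for a b :: real
proof -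
  assume ab: "0 \<le> a" "0 \<le> b"
  have "(a + b) ^ m \<le> (2 * max a b) ^ m" using ab by (intro power_mono) auto
  also have "\<dots> \<le> 2 ^ m * (a ^ m + b ^ m)"
    using ab by (auto simp: power_mult_distrib max_def)
  finally show ?thesis .
qed

lemma power_le_add_power: "0 \<le> a \<Longrightarrow> 0 \<le> b \<Longrightarrow> 0 < m \<Longrightarrow> a ^ m + b ^ m \<le> (a + b) ^ m" for a b :: real
proof (induction m)
  case (Suc m)
  show ?case
  proof (cases "m = 0")
    case False
    have "a ^ Suc m + b ^ Suc m \<le> (a + b) * (a ^ m + b ^ m)"
      using Suc.prems by (simp add: algebra_simps)
    also have "\<dots> \<le> (a + b) * (a + b) ^ m" using Suc False by (intro mult_left_mono) auto
    finally show ?thesis by simp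
  qed simp
qed simp

lemma power_le_two_power_add:
  fixes a :: real
  assumes "0 \<le> a" "m \<le> q"
  shows "a ^ m \<le> 2 ^ m * (1 + (a / 2) ^ q)"
proof -
  have "(a / 2) ^ m \<le> 1 + (a / 2) ^ q"
  proof (cases "a / 2 \<le> 1")
    case True
    then have "(a / 2) ^ m \<le> 1" using assms by (intro power_le_one) auto
    then show ?thesis using assms by (smt (verit) zero_le_power divide_nonneg_pos)
  next
    case False
    then have "(a / 2) ^ m \<le> (a / 2) ^ q" by (intro power_increasing assms) auto
    then show ?thesis by linarith
  qed
  then show ?thesis by (simp add: power_divide field_simps)
qed

text \<open>Level \<open>n\<close> has at most \<open>32 ^ 4 ^ n\<close> links, which moments of order \<open>4 ^ n\<close> absorb at the
  cost of a constant factor; levels with \<open>4 ^ n < m\<close> are skipped.\<close>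

theorem chaining:
  fixes X :: "'a \<Rightarrow> 'w \<Rightarrow> real" and T :: "'a set" and d :: "'a \<Rightarrow> 'a \<Rightarrow> real"
  assumes M: "prob_space M" and T: "finite T"
    and d: "\<And>x y. d x y = d y x" "\<And>x y z. d x z \<le> d x y + d y z" "\<And>x y. 0 \<le> d x y"
    and p: "\<And>n x. x \<in> T \<Longrightarrow> p n x \<in> T \<and> D n x > 0 \<and> d x (p n x) \<le> D n x \<and> D n (p n x) = D n x"
    and card_p: "\<And>n. card (p n ` T) \<le> 2 ^ 4 ^ n" and p_id: "\<And>n x. n \<ge> n1 \<Longrightarrow> x \<in> T \<Longrightarrow> p n x = x"
    and \<Gamma>: "\<And>k x. x \<in> T \<Longrightarrow> (\<Sum>n<k. 2 ^ n * D n x) \<le> \<Gamma>"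
    and int_inc: "\<And>t u q. t \<in> T \<Longrightarrow> u \<in> T \<Longrightarrow> integrable M (\<lambda>w. (X t w - X u w) ^ q)"
    and int: "\<And>t q. t \<in> T \<Longrightarrow> integrable M (\<lambda>w. X t w ^ q)"
    and inc: "\<And>t u q. \<lbrakk>t \<in> T; u \<in> T; even q; q > 0\<rbrakk> \<Longrightarrow> (\<integral>w. (X t w - X u w) ^ q \<partial>M) \<le> (K * sqrt q * d t u) ^ q"
    and mom: "\<And>t q. \<lbrakk>t \<in> T; even q; q > 0\<rbrakk> \<Longrightarrow> (\<integral>w. X t w ^ q \<partial>M) \<le> (K * sqrt q * \<Delta>) ^ q"
    and K: "K > 0" and \<Delta>: "\<Delta> \<ge> 0" "\<Gamma> \<ge> 0" and m: "even m" "m > 0"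
  shows "\<exists>R. integrable M R \<and> (\<forall>t\<in>T. \<forall>w. X t w ^ m \<le> R w) \<and>
    (\<integral>w. R w \<partial>M) \<le> (2 * (16 * K * sqrt m * \<Delta> + 256 * K * \<Gamma>)) ^ m"
proof -
  interpret prob_space M by (rule M)
  \<comment> \<open>The first level whose moment order \<open>4 ^ n\<close> reaches
    \<open>m\<close>. As \<open>m\<close> is even, \<open>n0\<close> is positive, so all later
    orders are even; minimality keeps the first net below 2^(4m) = 16^m points.\<close>
  define n0 where "n0 = (LEAST n. m \<le> 4 ^ n)"
  have ex: "m \<le> 4 ^ m" using power_gt_expt[of 4 m] by simp
  have n0: "m \<le> 4 ^ n0" unfolding n0_def by (rule LeastI[of _ m]) (rule ex)
  have n0_pos: "n0 > 0" using n0 m by (cases n0) auto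
  have n0': "4 ^ n0 \<le> 4 * m"
  proof -
    have "\<not> m \<le> 4 ^ (n0 - 1)" using not_less_Least[of "n0 - 1" "\<lambda>n. m \<le> 4 ^ n"] n0_pos by (simp add: n0_def)
    then show ?thesis using n0_pos by (cases n0) auto
  qed
  define N where "N = max n0 n1"
  \<comment> \<open>The weight is a function of the end points alone, so that links can be counted
    as pairs. That is the purpose of requiring \<open>D n (p n x) = D n x\<close>.\<close>
  define w where "w n u v = D n u + D (Suc n) v" for n u v
  \<comment> \<open>Together with the halving in \<open>Y\<close> the factor 32 becomes 64: a term
    of order \<open>q = 4 ^ n\<close> has expectation at most 64^(-q), which against at most 32^q
    links leaves 2^(-q) for the level.\<close>
  define rat where "rat n uv z = (X (snd uv) z - X (fst uv) z) / (32 * K * 2 ^ n * w n (fst uv) (snd uv))" for n uv z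
  define L where "L n = (\<lambda>t. (p n t, p (Suc n) t)) ` T" for n
  \<comment> \<open>A sum over all links in place of a union bound: one random variable of mean at
    most 1 controls every link of every level simultaneously.\<close>
  define Y where "Y z = (\<Sum>n\<in>{n0..<N}. \<Sum>uv\<in>L n. (rat n uv z / 2) ^ 4 ^ n)" for z
  define Z where "Z z = 2 ^ m * (1 + Y z)" for z
  define R where "R z = 2 ^ m * ((\<Sum>u\<in>p n0 ` T. X u z ^ m) + (64 * K * \<Gamma>) ^ m * Z z)" for z
  have finL: "finite (L n)" for n using T by (simp add: L_def)
  have ev: "even ((4::nat) ^ n)" if "n \<ge> n0" for n using n0_pos that by simp
  have L: "fst uv \<in> T \<and> snd uv \<in> T \<and> w n (fst uv) (snd uv) > 0 \<and> d (snd uv) (fst uv) \<le> w n (fst uv) (snd uv)"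
    if uv: "uv \<in> L n" for uv n
  proof -
    obtain t where t: "t \<in> T" "uv = (p n t, p (Suc n) t)" using uv by (auto simp: L_def)
    have "d (p (Suc n) t) (p n t) \<le> d (p (Suc n) t) t + d t (p n t)" by (rule d)
    also have "\<dots> \<le> D (Suc n) t + D n t" using p[OF t(1)] d(1) by (intro add_mono) metis+
    finally show ?thesis using p[OF t(1), of n] p[OF t(1), of "Suc n"] t by (simp add: w_def)
  qed
  have cardL: "card (L n) \<le> 32 ^ 4 ^ n" for n
  proof -
    have "L n \<subseteq> (p n ` T) \<times> (p (Suc n) ` T)" by (auto simp: L_def)
    then have "card (L n) \<le> card ((p n ` T) \<times> (p (Suc n) ` T))" using T by (intro card_mono) auto
    also have "\<dots> \<le> 2 ^ 4 ^ n * 2 ^ 4 ^ Suc n"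
      unfolding card_cartesian_product by (intro mult_mono card_p) auto
    also have "\<dots> = 2 ^ (5 * 4 ^ n)" by (simp flip: power_add)
    also have "\<dots> = 32 ^ 4 ^ n" by (simp add: power_mult)
    finally show ?thesis .
  qed
  have intR: "integrable M (\<lambda>z. (rat n uv z / 2) ^ q)" if "uv \<in> L n" for n uv q
    using int_inc[of "snd uv" "fst uv" q] L[OF that] by (simp add: rat_def power_divide)
  have ER: "(\<integral>z. (rat n uv z / 2) ^ 4 ^ n \<partial>M) \<le> (1 / 64) ^ 4 ^ n" if uv: "uv \<in> L n" and n: "n \<ge> n0" for n uv
  proof -
    let ?u = "fst uv" and ?v = "snd uv" and ?q = "(4::nat) ^ n"
    note l = L[OF uv]
    have sq: "sqrt (real ?q) = 2 ^ n"
      by (rule real_sqrt_unique) (simp_all flip: power_mult_distrib add: power2_eq_square)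
    have "(\<integral>z. (rat n uv z / 2) ^ ?q \<partial>M) = (\<integral>z. (X ?v z - X ?u z) ^ ?q \<partial>M) / (64 * K * 2 ^ n * w n ?u ?v) ^ ?q"
    proof -
      have "rat n uv z / 2 = (X ?v z - X ?u z) / (64 * K * 2 ^ n * w n ?u ?v)" for z by (simp add: rat_def)
      then show ?thesis by (simp only: power_divide integral_divide_zero)
    qed
    also have "\<dots> \<le> (K * 2 ^ n * d ?v ?u) ^ ?q / (64 * K * 2 ^ n * w n ?u ?v) ^ ?q"
      using inc[of ?v ?u ?q] l ev[OF n] K unfolding sq by (intro divide_right_mono zero_le_power) auto
    also have "\<dots> = (K * 2 ^ n * d ?v ?u / (64 * K * 2 ^ n * w n ?u ?v)) ^ ?q" by (rule power_divide[symmetric])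
    also have "\<dots> \<le> (1 / 64) ^ ?q"
    proof (rule power_mono)
      show "K * 2 ^ n * d ?v ?u / (64 * K * 2 ^ n * w n ?u ?v) \<le> 1 / 64"
        using l K by (simp add: divide_simps)
    qed (use l K d(3) in auto)
    finally show ?thesis .
  qed
  have Ynn: "0 \<le> Y z" for z unfolding Y_def
    using ev by (intro sum_nonneg) (auto intro!: zero_le_even_power)
  have rat_le: "(rat n uv z / 2) ^ 4 ^ n \<le> Y z" if "n \<in> {n0..<N}" "uv \<in> L n" for n uv z
  proof -
    have "(rat n uv z / 2) ^ 4 ^ n \<le> (\<Sum>uv\<in>L n. (rat n uv z / 2) ^ 4 ^ n)"
      by (rule member_le_sum[OF that(2)]) (use ev that finL in \<open>auto intro!: zero_le_even_power\<close>)
    also have "\<dots> \<le> Y z" unfolding Y_def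
      by (rule member_le_sum[OF that(1)]) (use ev in \<open>auto intro!: sum_nonneg zero_le_even_power\<close>)
    finally show ?thesis .
  qed
  have intY: "integrable M Y" unfolding Y_def by (intro Bochner_Integration.integrable_sum intR)
  have EY: "(\<integral>z. Y z \<partial>M) \<le> 1"
  proof -
    have "(\<integral>z. Y z \<partial>M) = (\<Sum>n\<in>{n0..<N}. \<Sum>uv\<in>L n. (\<integral>z. (rat n uv z / 2) ^ 4 ^ n \<partial>M))"
      unfolding Y_def by (simp add: Bochner_Integration.integral_sum intR)
    also have "\<dots> \<le> (\<Sum>n\<in>{n0..<N}. \<Sum>uv\<in>L n. (1 / 64) ^ 4 ^ n)"
      by (intro sum_mono ER) auto
    also have "\<dots> \<le> (\<Sum>n\<in>{n0..<N}. 32 ^ 4 ^ n * (1 / 64) ^ 4 ^ n)"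
    proof (rule sum_mono)
      fix n
      have "real (card (L n)) \<le> 32 ^ 4 ^ n" using cardL[of n] by (metis of_nat_le_iff of_nat_numeral of_nat_power)
      then show "(\<Sum>uv\<in>L n. (1 / 64) ^ 4 ^ n) \<le> 32 ^ 4 ^ n * (1 / 64 :: real) ^ 4 ^ n"
        by (simp add: mult_right_mono)
    qed
    also have "\<dots> = (\<Sum>n\<in>{n0..<N}. (1 / 2) ^ 4 ^ n)" by (simp flip: power_mult_distrib)
    also have "\<dots> \<le> (\<Sum>n\<in>{n0..<N}. (1 / 2) ^ Suc n)"
    proof (intro sum_mono power_decreasing)
      fix n show "Suc n \<le> 4 ^ n" using power_gt_expt[of 4 n] by simp
    qed auto
    also have "\<dots> \<le> (\<Sum>n. (1 / 2 :: real) ^ Suc n)"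
      using power_half_series by (intro sum_le_suminf) (auto simp: sums_iff)
    also have "\<dots> = 1" using power_half_series by (simp add: sums_iff)
    finally show ?thesis .
  qed
  have intRR: "integrable M R"
    unfolding R_def Z_def using p
    by (intro integrable_mult_right Bochner_Integration.integrable_add Bochner_Integration.integrable_sum
        integrable_const intY int) auto
  have bound: "X t z ^ m \<le> R z" if t: "t \<in> T" for t z
  proof -
    define y where "y = root m (Z z)"
    have Z0: "Z z \<ge> 0" using Ynn by (simp add: Z_def)
    have y: "y \<ge> 0" "y ^ m = Z z" using Z0 m by (simp_all add: y_def)
    have step: "\<bar>X (p (Suc n) t) z - X (p n t) z\<bar> \<le> 32 * K * y * (2 ^ n * (D n t + D (Suc n) t))" if n: "n \<in> {n0..<N}" for n
    proof -
      define uv where "uv = (p n t, p (Suc n) t)"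
      have uv: "uv \<in> L n" using t by (auto simp: L_def uv_def)
      have w: "w n (fst uv) (snd uv) = D n t + D (Suc n) t" using p[OF t] by (simp add: uv_def w_def)
      have wp: "D n t + D (Suc n) t > 0" using L[OF uv] w by simp
      have "m \<le> 4 ^ n" using n0 n by (meson atLeastLessThan_iff le_trans one_le_numeral power_increasing)
      then have "\<bar>rat n uv z\<bar> ^ m \<le> 2 ^ m * (1 + (\<bar>rat n uv z\<bar> / 2) ^ 4 ^ n)"
        by (intro power_le_two_power_add) auto
      also have "(\<bar>rat n uv z\<bar> / 2) ^ 4 ^ n = (rat n uv z / 2) ^ 4 ^ n"
        using ev[of n] n by (simp add: power_even_abs power_divide)
      also have "2 ^ m * (1 + (rat n uv z / 2) ^ 4 ^ n) \<le> Z z"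
        unfolding Z_def using rat_le[OF n uv] by (intro mult_left_mono add_left_mono) auto
      finally have "\<bar>rat n uv z\<bar> ^ m \<le> y ^ m" by (simp add: y)
      then have "\<bar>rat n uv z\<bar> \<le> y"
        by (rule power_mono_iff[THEN iffD1, rotated 3]) (use m y in auto)
      then have "\<bar>rat n uv z\<bar> * (32 * K * 2 ^ n * (D n t + D (Suc n) t)) \<le> y * (32 * K * 2 ^ n * (D n t + D (Suc n) t))"
        using K wp by (intro mult_right_mono) auto
      moreover have "\<bar>rat n uv z\<bar> * (32 * K * 2 ^ n * (D n t + D (Suc n) t)) = \<bar>X (p (Suc n) t) z - X (p n t) z\<bar>"
        using K wp unfolding rat_def w by (simp add: abs_mult uv_def)
      ultimately show ?thesis by (simp add: mult_ac)
    qed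
    \<comment> \<open>The telescoping sum ends at \<open>t\<close> because
      \<open>N \<ge> n1\<close>.\<close>
    have "X t z = X (p n0 t) z + (\<Sum>n\<in>{n0..<N}. X (p (Suc n) t) z - X (p n t) z)"
      using sum_Suc_diff'[of n0 N "\<lambda>n. X (p n t) z"] p_id[of N t] t by (simp add: N_def)
    then have "\<bar>X t z\<bar> \<le> \<bar>X (p n0 t) z\<bar> + (\<Sum>n\<in>{n0..<N}. \<bar>X (p (Suc n) t) z - X (p n t) z\<bar>)"
      using sum_abs[of "\<lambda>n. X (p (Suc n) t) z - X (p n t) z" "{n0..<N}"] by linarith
    also have "\<dots> \<le> \<bar>X (p n0 t) z\<bar> + (\<Sum>n\<in>{n0..<N}. 32 * K * y * (2 ^ n * (D n t + D (Suc n) t)))"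
      using step by (intro add_left_mono sum_mono) auto
    also have "\<dots> = \<bar>X (p n0 t) z\<bar> + 32 * K * y * (\<Sum>n\<in>{n0..<N}. 2 ^ n * (D n t + D (Suc n) t))"
      by (simp add: sum_distrib_left)
    also have "\<dots> \<le> \<bar>X (p n0 t) z\<bar> + 32 * K * y * (2 * \<Gamma>)"
    proof (intro add_left_mono mult_left_mono)
      have Dp: "D n t > 0" for n using p[OF t, of n] by blast
      have w0: "0 \<le> 2 ^ n * (D n t + D (Suc n) t)" for n using Dp[of n] Dp[of "Suc n"] by simp
      have "(\<Sum>n\<in>{n0..<N}. 2 ^ n * (D n t + D (Suc n) t)) \<le> (\<Sum>n<N. 2 ^ n * (D n t + D (Suc n) t))"
        by (rule sum_mono2) (use w0 in auto)
      also have "\<dots> \<le> (\<Sum>n<N. 2 ^ n * D n t) + (\<Sum>n<N. 2 ^ Suc n * D (Suc n) t)"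
        unfolding sum.distrib[symmetric]
      proof (rule sum_mono)
        fix n
        have "0 \<le> 2 ^ n * D (Suc n) t" using Dp[of "Suc n"] by simp
        then show "2 ^ n * (D n t + D (Suc n) t) \<le> 2 ^ n * D n t + 2 ^ Suc n * D (Suc n) t"
          by (simp add: algebra_simps)
      qed
      also have "(\<Sum>n<N. 2 ^ Suc n * D (Suc n) t) \<le> (\<Sum>n<Suc N. 2 ^ n * D n t)"
        unfolding sum.lessThan_Suc_shift[of _ N] using Dp[of 0] by simp
      finally show "(\<Sum>n\<in>{n0..<N}. 2 ^ n * (D n t + D (Suc n) t)) \<le> 2 * \<Gamma>"
        using \<Gamma>[OF t, of N] \<Gamma>[OF t, of "Suc N"] by linarith
    qed (use K y in auto)
    finally have "\<bar>X t z\<bar> ^ m \<le> (\<bar>X (p n0 t) z\<bar> + 64 * K * \<Gamma> * y) ^ m"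
      by (intro power_mono) (auto simp: mult_ac)
    also have "\<dots> \<le> 2 ^ m * (\<bar>X (p n0 t) z\<bar> ^ m + (64 * K * \<Gamma> * y) ^ m)"
      using K \<Delta> y by (intro power_add_le) auto
    also have "\<dots> = 2 ^ m * (X (p n0 t) z ^ m + (64 * K * \<Gamma>) ^ m * Z z)"
      using m y by (simp add: power_mult_distrib power_even_abs)
    also have "\<dots> \<le> R z" unfolding R_def
    proof (intro mult_left_mono add_right_mono)
      show "X (p n0 t) z ^ m \<le> (\<Sum>u\<in>p n0 ` T. X u z ^ m)"
        by (rule member_le_sum[of "p n0 t" _ "\<lambda>u. X u z ^ m"]) (use t T m in \<open>auto intro!: zero_le_even_power\<close>)
    qed auto
    finally show ?thesis using m by (simp add: power_even_abs)
  qed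
  have "(\<integral>z. R z \<partial>M) = 2 ^ m * ((\<Sum>u\<in>p n0 ` T. (\<integral>z. X u z ^ m \<partial>M)) + (64 * K * \<Gamma>) ^ m * (2 ^ m * (1 + (\<integral>z. Y z \<partial>M))))"
  proof -
    have i: "integrable M (\<lambda>z. X u z ^ m)" if "u \<in> p n0 ` T" for u using that p int by auto
    then show ?thesis unfolding R_def Z_def using intY by (simp add: prob_space)
  qed
  also have "\<dots> \<le> 2 ^ m * ((16 * K * sqrt m * \<Delta>) ^ m + (256 * K * \<Gamma>) ^ m)"
  proof (intro mult_left_mono add_mono)
    have "(\<Sum>u\<in>p n0 ` T. (\<integral>z. X u z ^ m \<partial>M)) \<le> (\<Sum>u\<in>p n0 ` T. (K * sqrt m * \<Delta>) ^ m)"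
      using p m by (intro sum_mono mom) auto
    also have "\<dots> = card (p n0 ` T) * (K * sqrt m * \<Delta>) ^ m" by simp
    also have "\<dots> \<le> 16 ^ m * (K * sqrt m * \<Delta>) ^ m"
    proof (rule mult_right_mono)
      have "card (p n0 ` T) \<le> 2 ^ 4 ^ n0" by (rule card_p)
      also have "\<dots> \<le> 2 ^ (4 * m)" using n0' by (intro power_increasing) auto
      also have "\<dots> = 16 ^ m" by (simp add: power_mult)
      finally show "real (card (p n0 ` T)) \<le> 16 ^ m"
        by (metis of_nat_le_iff of_nat_numeral of_nat_power)
    qed (use K \<Delta> in auto)
    finally show "(\<Sum>u\<in>p n0 ` T. (\<integral>z. X u z ^ m \<partial>M)) \<le> (16 * K * sqrt m * \<Delta>) ^ m"
      by (simp add: power_mult_distrib mult.assoc)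
    have "(64 * K * \<Gamma>) ^ m * (2 ^ m * (1 + (\<integral>z. Y z \<partial>M))) \<le> (64 * K * \<Gamma>) ^ m * (2 ^ m * 2 ^ m)"
    proof (intro mult_left_mono)
      have "(2::real) ^ 1 \<le> 2 ^ m" using m by (intro power_increasing) auto
      then show "1 + (\<integral>z. Y z \<partial>M) \<le> 2 ^ m" using EY by simp
    qed (use K \<Delta> in auto)
    also have "\<dots> = (64 * K * \<Gamma> * 2 * 2) ^ m" by (simp only: power_mult_distrib mult.assoc)
    also have "64 * K * \<Gamma> * 2 * 2 = 256 * K * \<Gamma>" by simp
    finally show "(64 * K * \<Gamma>) ^ m * (2 ^ m * (1 + (\<integral>z. Y z \<partial>M))) \<le> (256 * K * \<Gamma>) ^ m" .
  qed auto
  also have "\<dots> \<le> 2 ^ m * (16 * K * sqrt m * \<Delta> + 256 * K * \<Gamma>) ^ m"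
    using K \<Delta> m by (intro mult_left_mono power_le_add_power) auto
  also have "\<dots> = (2 * (16 * K * sqrt m * \<Delta> + 256 * K * \<Gamma>)) ^ m"
    by (simp only: power_mult_distrib)
  finally show ?thesis using intRR bound by blast
qed

lemma inner_d_diff: "inner_d r (\<lambda>i. t i - u i) y = inner_d r t y - inner_d r u y"
  by (simp add: inner_d_def left_diff_distrib sum_subtractf)

text \<open>The nets are governed by Euclidean distance and Gaussian width, while the chaining needs
  moment bounds in the same distance; here the Gaussian and the subgaussian sides meet. The diameter
  is at most \<open>2 * \<Delta>\<close>, which \<open>admissible_nets\<close> doubles.\<close>

theorem subgaussian_max_moment:
  fixes T :: "(nat \<Rightarrow> real) set" and Y :: "'w \<Rightarrow> nat \<Rightarrow> real"
  assumes M: "prob_space M" and T: "finite T" "T \<noteq> {}"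
    and int: "\<And>v q. integrable M (\<lambda>w. inner_d r v (Y w) ^ q)"
    and sub: "\<And>v q. even q \<Longrightarrow> q > 0 \<Longrightarrow> (\<integral>w. inner_d r v (Y w) ^ q \<partial>M) \<le> (K * sqrt q * norm_d r v) ^ q"
    and K: "K > 0" and \<Delta>: "\<Delta> > 0" "\<And>t. t \<in> T \<Longrightarrow> norm_d r t \<le> \<Delta>" and W: "gwidth r T \<le> W"
    and m: "even m" "m > 0"
  shows "\<exists>R. integrable M R \<and> (\<forall>t\<in>T. \<forall>w. inner_d r t (Y w) ^ m \<le> R w) \<and>
    (\<integral>w. R w \<partial>M) \<le> (2 * (16 * K * sqrt m * \<Delta> + 256 * K * (4 * \<Delta> + 51200 * W))) ^ m"
proof -
  interpret gs: growth_space T "dist_d r" "gwidth r"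
  proof
    fix P n e B
    assume P: "P \<subseteq> T" "card P = 2 ^ 4 ^ n" and e: "e > 0"
      and sep: "\<And>x y. x \<in> P \<Longrightarrow> y \<in> P \<Longrightarrow> x \<noteq> y \<Longrightarrow> e \<le> dist_d r x y"
      and B: "\<And>x. x \<in> P \<Longrightarrow> B x \<subseteq> T \<and> B x \<noteq> {}"
      and Bd: "\<And>x t. x \<in> P \<Longrightarrow> t \<in> B x \<Longrightarrow> dist_d r x t \<le> e / 8"
    have sq: "sqrt (real (4 ^ n)) = 2 ^ n"
      by (rule real_sqrt_unique) (simp_all flip: power_mult_distrib add: power2_eq_square)
    have "finite P" using P(1) T(1) by (rule finite_subset)
    moreover have "finite (B x)" if "x \<in> P" for x using B[OF that] T(1) finite_subset by blast
    ultimately have "\<exists>x\<in>P. gwidth r (\<Union>x\<in>P. B x) \<ge> e * sqrt (real (4 ^ n)) / 5 + gwidth r (B x)"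
      using P(2) e sep B Bd by (intro gwidth_growth) auto
    then show "\<exists>x\<in>P. e * 2 ^ n / 5 + gwidth r (B x) \<le> gwidth r (\<Union>x\<in>P. B x)" by (simp only: sq)
  next
    show "gwidth r A \<le> gwidth r A'" if "A \<subseteq> A'" "A \<noteq> {}" "A' \<subseteq> T" for A A'
      using that T finite_subset by (intro gwidth_mono) auto
  qed (simp_all add: T dist_d_self dist_d_nonneg dist_d_triangle gwidth_singleton, rule dist_d_commute)
  have diam: "dist_d r x y \<le> 2 * \<Delta>" if "x \<in> T" "y \<in> T" for x y
    using norm_d_triangle[of r x "\<lambda>i. - y i"] \<Delta>(2)[OF that(1)] \<Delta>(2)[OF that(2)]
    by (simp add: dist_d_def norm_d_def)
  obtain p D n1 where p: "\<And>n x. x \<in> T \<Longrightarrow> p n x \<in> T \<and> D n x > 0 \<and> dist_d r x (p n x) \<le> D n x \<and> D n (p n x) = D n x"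
    and card: "\<And>n. card (p n ` T) \<le> 2 ^ 4 ^ n" and pid: "\<And>n x. n \<ge> n1 \<Longrightarrow> x \<in> T \<Longrightarrow> p n x = x"
    and sum: "\<And>k x. x \<in> T \<Longrightarrow> (\<Sum>n<k. 2 ^ n * D n x) \<le> 2 * (2 * \<Delta>) + 51200 * gwidth r T"
    using gs.admissible_nets[of "2 * \<Delta>"] \<Delta>(1) diam by (auto simp: Ball_def) blast
  have Kn: "0 \<le> K * sqrt (real q) * norm_d r v" for q v using K norm_d_nonneg by simp
  have W0: "0 \<le> W" using gs.W_T_nonneg W by simp
  show ?thesis
  proof (rule chaining[where X="\<lambda>t w. inner_d r t (Y w)" and d="dist_d r" and p=p and D=D and ?n1.0=n1, OF M T(1)])
    show "dist_d r x y = dist_d r y x" "dist_d r x z \<le> dist_d r x y + dist_d r y z" "0 \<le> dist_d r x y" for x y z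
      by (rule dist_d_commute dist_d_triangle dist_d_nonneg)+
    show "(\<Sum>n<k. 2 ^ n * D n x) \<le> 4 * \<Delta> + 51200 * W" if "x \<in> T" for k x
      using sum[OF that, of k] W by simp
    show "integrable M (\<lambda>w. (inner_d r t (Y w) - inner_d r u (Y w)) ^ q)" for t u q
      using int[of "\<lambda>i. t i - u i" q] by (simp add: inner_d_diff)
    show "(\<integral>w. (inner_d r t (Y w) - inner_d r u (Y w)) ^ q \<partial>M) \<le> (K * sqrt q * dist_d r t u) ^ q" if "even q" "q > 0" for t u q
      using sub[OF that, of "\<lambda>i. t i - u i"] by (simp add: inner_d_diff dist_d_def)
    show "(\<integral>w. inner_d r t (Y w) ^ q \<partial>M) \<le> (K * sqrt q * \<Delta>) ^ q" if "t \<in> T" "even q" "q > 0" for t q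
      using sub[OF that(2,3), of t] Kn \<Delta>(2)[OF that(1)] K
      by (elim order_trans) (intro power_mono mult_left_mono, auto)
  qed (use p card pid int K \<Delta> W0 m in auto)
qed

section \<open>Forms, sums of squares and duality\<close>

text \<open>Monomials are indexed by words instead of exponent vectors: multiplication is
  concatenation, and powers of a linear form expand without multinomial coefficients. The price is
  that the coefficients of a form are not unique.\<close>

definition words :: "nat \<Rightarrow> nat \<Rightarrow> nat list set" where
  "words r n = {xs. set xs \<subseteq> {..<r} \<and> length xs = n}"

definition mon :: "nat list \<Rightarrow> (nat \<Rightarrow> real) \<Rightarrow> real" where
  "mon xs w = (\<Prod>i\<leftarrow>xs. w i)"

definition lincomb :: "nat \<Rightarrow> nat \<Rightarrow> (nat list \<Rightarrow> real) \<Rightarrow> (nat \<Rightarrow> real) \<Rightarrow> real" where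
  "lincomb r n c w = (\<Sum>xs\<in>words r n. c xs * mon xs w)"

definition form :: "nat \<Rightarrow> nat \<Rightarrow> ((nat \<Rightarrow> real) \<Rightarrow> real) \<Rightarrow> bool" where
  "form r n p \<longleftrightarrow> (\<exists>c. p = lincomb r n c)"

lemma finite_words: "finite (words r n)"
  unfolding words_def by (rule finite_lists_length_eq) simp

lemma mon_Nil [simp]: "mon [] w = 1" and mon_Cons [simp]: "mon (x # xs) w = w x * mon xs w"
  and mon_append: "mon (xs @ ys) w = mon xs w * mon ys w"
  by (simp_all add: mon_def)

lemma words_0: "words r 0 = {[]}" by (auto simp: words_def)

lemma lincomb_add: "lincomb r n (\<lambda>x. c x + c' x) w = lincomb r n c w + lincomb r n c' w"
  by (simp add: lincomb_def algebra_simps sum.distrib)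

lemma lincomb_scale: "lincomb r n (\<lambda>x. a * c x) w = a * lincomb r n c w"
  by (simp add: lincomb_def sum_distrib_left mult.assoc)

lemma form_add: "form r n p \<Longrightarrow> form r n q \<Longrightarrow> form r n (\<lambda>w. p w + q w)"
  by (auto simp: form_def lincomb_add[symmetric])

lemma form_scale: "form r n p \<Longrightarrow> form r n (\<lambda>w. a * p w)"
  by (auto simp: form_def lincomb_scale[symmetric])

lemma form_zero: "form r n (\<lambda>w. 0)"
  unfolding form_def by (intro exI[of _ "\<lambda>_. 0"]) (simp add: lincomb_def fun_eq_iff)

lemma form_diff: "form r n p \<Longrightarrow> form r n q \<Longrightarrow> form r n (\<lambda>w. p w - q w)"
  using form_add[of r n p "\<lambda>w. -1 * q w"] form_scale[of r n q "-1"] by simp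

lemma form_sum: "(\<And>i. i \<in> I \<Longrightarrow> form r n (p i)) \<Longrightarrow> form r n (\<lambda>w. \<Sum>i\<in>I. p i w)"
  by (induction I rule: infinite_finite_induct) (auto intro: form_zero form_add)

lemma form_sum_list: "(\<And>i. i \<in> set is \<Longrightarrow> form r n (p i)) \<Longrightarrow> form r n (\<lambda>w. \<Sum>i\<leftarrow>is. p i w)"
  by (induction "is") (auto intro: form_zero form_add)

lemma form_mon: "xs \<in> words r n \<Longrightarrow> form r n (mon xs)"
  unfolding form_def
  by (intro exI[of _ "\<lambda>ys. if ys = xs then 1 else 0"])
     (auto simp: lincomb_def fun_eq_iff finite_words if_distrib[of "\<lambda>x. x * _"] cong: if_cong)

lemma form_const: "form r 0 (\<lambda>w. a)"
  using form_scale[OF form_mon[of "[]" r 0], of a] by (simp add: words_0)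

lemma form_var: "i < r \<Longrightarrow> form r 1 (\<lambda>w. w i)"
  using form_mon[of "[i]" r 1] by (simp add: words_def mon_def[abs_def])

lemma form_mult:
  assumes "form r m p" "form r n q" shows "form r (m + n) (\<lambda>w. p w * q w)"
proof -
  obtain c c' where c: "p = lincomb r m c" "q = lincomb r n c'" using assms by (auto simp: form_def)
  have "form r (m + n) (\<lambda>w. \<Sum>xs\<in>words r m. \<Sum>ys\<in>words r n. (c xs * c' ys) * mon (xs @ ys) w)"
    by (intro form_sum form_scale form_mon) (auto simp: words_def)
  also have "(\<lambda>w. \<Sum>xs\<in>words r m. \<Sum>ys\<in>words r n. (c xs * c' ys) * mon (xs @ ys) w) = (\<lambda>w. p w * q w)"
    unfolding c lincomb_def sum_product by (intro ext sum.cong refl) (simp add: mon_append)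
  finally show ?thesis .
qed

lemma form_power: "form r n p \<Longrightarrow> form r (k * n) (\<lambda>w. p w ^ k)"
proof (induction k)
  case 0 then show ?case using form_const[of r 1] by simp
next
  case (Suc k) then show ?case using form_mult[OF Suc.prems Suc.IH[OF Suc.prems]] by simp
qed

section \<open>The cone of sums of squares and its order unit\<close>

definition sos :: "nat \<Rightarrow> nat \<Rightarrow> ((nat \<Rightarrow> real) \<Rightarrow> real) \<Rightarrow> bool" where
  "sos r n p \<longleftrightarrow> (\<exists>hs. (\<forall>h\<in>set hs. form r n h) \<and> p = (\<lambda>w. \<Sum>h\<leftarrow>hs. (h w)\<^sup>2))"

lemma sos_square: "form r n h \<Longrightarrow> sos r n (\<lambda>w. (h w)\<^sup>2)"
  unfolding sos_def by (intro exI[of _ "[h]"]) auto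

lemma sos_zero: "sos r n (\<lambda>w. 0)"
  unfolding sos_def by (intro exI[of _ "[]"]) auto

lemma sos_add: "sos r n p \<Longrightarrow> sos r n q \<Longrightarrow> sos r n (\<lambda>w. p w + q w)"
  unfolding sos_def by (elim exE conjE, rule_tac x="hs @ hsa" in exI) auto

lemma sos_sum: "(\<And>i. i \<in> I \<Longrightarrow> sos r n (p i)) \<Longrightarrow> sos r n (\<lambda>w. \<Sum>i\<in>I. p i w)"
  by (induction I rule: infinite_finite_induct) (auto intro: sos_zero sos_add)

lemma sos_sum_list: "(\<And>i. i \<in> set is \<Longrightarrow> sos r n (p i)) \<Longrightarrow> sos r n (\<lambda>w. \<Sum>i\<leftarrow>is. p i w)"
  by (induction "is") (auto intro: sos_zero sos_add)

lemma sos_scale: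
  assumes "sos r n p" "a \<ge> 0" shows "sos r n (\<lambda>w. a * p w)"
proof -
  obtain hs where hs: "\<forall>h\<in>set hs. form r n h" "p = (\<lambda>w. \<Sum>h\<leftarrow>hs. (h w)\<^sup>2)" using assms by (auto simp: sos_def)
  have "sos r n (\<lambda>w. \<Sum>h\<leftarrow>hs. (sqrt a * h w)\<^sup>2)"
    by (intro sos_sum_list sos_square form_scale) (use hs in auto)
  then show ?thesis using assms(2) by (simp add: hs power_mult_distrib sum_list_const_mult)
qed

lemma sos_mult:
  assumes "sos r m p" "sos r n q" shows "sos r (m + n) (\<lambda>w. p w * q w)"
proof -
  obtain hs where hs: "\<forall>h\<in>set hs. form r m h" "p = (\<lambda>w. \<Sum>h\<leftarrow>hs. (h w)\<^sup>2)" using assms by (auto simp: sos_def)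
  obtain gs where gs: "\<forall>h\<in>set gs. form r n h" "q = (\<lambda>w. \<Sum>h\<leftarrow>gs. (h w)\<^sup>2)" using assms by (auto simp: sos_def)
  have "sos r (m + n) (\<lambda>w. \<Sum>h\<leftarrow>hs. \<Sum>g\<leftarrow>gs. (h w * g w)\<^sup>2)"
    by (intro sos_sum_list sos_square form_mult) (use hs gs in auto)
  then show ?thesis
    by (simp add: hs gs power_mult_distrib sum_list_const_mult sum_list_mult_const)
qed

lemma sos_const: "a \<ge> 0 \<Longrightarrow> sos r 0 (\<lambda>w. a)"
  using sos_square[OF form_const[of r "sqrt a"]] by simp

lemma sos_power: "sos r n p \<Longrightarrow> sos r (k * n) (\<lambda>w. p w ^ k)"
proof (induction k)
  case 0 then show ?case using sos_const[of 1] by simp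
next
  case (Suc k) then show ?case using sos_mult[OF Suc.prems Suc.IH[OF Suc.prems]] by simp
qed

lemma sos_form: "sos r n p \<Longrightarrow> form r (2 * n) p"
  unfolding sos_def using form_power[of r n _ 2] by (auto intro!: form_sum_list)

definition sq :: "nat \<Rightarrow> (nat \<Rightarrow> real) \<Rightarrow> real" where "sq r w = (\<Sum>i<r. (w i)\<^sup>2)"

lemma sos_sq: "sos r 1 (sq r)"
  unfolding sq_def[abs_def] by (intro sos_sum sos_square form_var) auto

lemma sos_sq_power: "sos r k (\<lambda>w. sq r w ^ k)"
  using sos_power[OF sos_sq[of r], of k] by simp

lemma form_sq_power: "form r (2 * k) (\<lambda>w. sq r w ^ k)"
  by (rule sos_form[OF sos_sq_power])

text \<open>Induction on the word: splitting off a letter \<open>i\<close> leaves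
  \<open>sq r w - (w i)\<^sup>2\<close> times a power of \<open>sq r w\<close>, and
  \<open>(w i)\<^sup>2\<close> times the difference for the shorter word.\<close>

lemma sos_sq_minus_mon: "xs \<in> words r k \<Longrightarrow> sos r k (\<lambda>w. sq r w ^ k - (mon xs w)\<^sup>2)"
proof (induction xs arbitrary: k)
  case Nil
  then show ?case using sos_zero by (simp add: words_def)
next
  case (Cons i xs)
  define k' where "k' = length xs"
  have k: "k = Suc k'" and i: "i < r" and xs: "xs \<in> words r k'" using Cons.prems by (auto simp: words_def k'_def)
  have "sos r 1 (\<lambda>w. sq r w - (w i)\<^sup>2)"
  proof -
    have "sos r 1 (\<lambda>w. \<Sum>j\<in>{..<r} - {i}. (w j)\<^sup>2)" by (intro sos_sum sos_square form_var) auto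
    also have "(\<lambda>w. \<Sum>j\<in>{..<r} - {i}. (w j)\<^sup>2) = (\<lambda>w. sq r w - (w i)\<^sup>2)"
      using i by (simp add: sq_def sum_diff1)
    finally show ?thesis .
  qed
  from sos_mult[OF this sos_sq_power[of r k']] sos_mult[OF sos_square[OF form_var[OF i]] Cons.IH[OF xs]]
  have "sos r (1 + k') (\<lambda>w. (sq r w - (w i)\<^sup>2) * sq r w ^ k' + (w i)\<^sup>2 * (sq r w ^ k' - (mon xs w)\<^sup>2))"
    by (rule sos_add)
  also have "(\<lambda>w. (sq r w - (w i)\<^sup>2) * sq r w ^ k' + (w i)\<^sup>2 * (sq r w ^ k' - (mon xs w)\<^sup>2))
    = (\<lambda>w. sq r w ^ k - (mon (i # xs) w)\<^sup>2)"
    by (simp add: k algebra_simps power_mult_distrib)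
  finally show ?case by (simp add: k)
qed

text \<open>A word of length \<open>2 * k\<close> is a product of two words of length
  \<open>k\<close>; completing the square bounds the product by half the sum of their squares, and
  each square is dominated by the power of \<open>sq r w\<close>.\<close>

lemma order_unit:
  assumes "form r (2 * k) p" shows "\<exists>a. sos r k (\<lambda>w. a * sq r w ^ k - p w)"
proof -
  obtain c where c: "p = lincomb r (2 * k) c" using assms by (auto simp: form_def)
  have "sos r k (\<lambda>w. \<bar>c zs\<bar> * sq r w ^ k - c zs * mon zs w)" if zs: "zs \<in> words r (2 * k)" for zs
  proof -
    define xs ys where "xs = take k zs" and "ys = drop k zs"
    have xy: "xs \<in> words r k" "ys \<in> words r k" "zs = xs @ ys"
      using zs set_take_subset[of k zs] set_drop_subset[of k zs] by (auto simp: words_def xs_def ys_def)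
    have "sos r k (\<lambda>w. (\<bar>c zs\<bar> / 2) * (((sq r w ^ k - (mon xs w)\<^sup>2) + (sq r w ^ k - (mon ys w)\<^sup>2)) + (mon xs w + (- sgn (c zs)) * mon ys w)\<^sup>2))"
      by (intro sos_scale sos_add sos_sq_minus_mon sos_square form_add form_scale form_mon xy) auto
    also have "(\<lambda>w. (\<bar>c zs\<bar> / 2) * (((sq r w ^ k - (mon xs w)\<^sup>2) + (sq r w ^ k - (mon ys w)\<^sup>2)) + (mon xs w + (- sgn (c zs)) * mon ys w)\<^sup>2))
      = (\<lambda>w. \<bar>c zs\<bar> * sq r w ^ k - c zs * mon zs w)"
      by (auto simp: xy mon_append sgn_if power2_eq_square algebra_simps fun_eq_iff)
    finally show ?thesis .
  qed
  then have "sos r k (\<lambda>w. \<Sum>zs\<in>words r (2 * k). \<bar>c zs\<bar> * sq r w ^ k - c zs * mon zs w)" by (rule sos_sum)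
  then show ?thesis
    by (intro exI[of _ "\<Sum>zs\<in>words r (2 * k). \<bar>c zs\<bar>"])
       (simp add: c lincomb_def sum_subtractf sum_distrib_right)
qed

text \<open>The extension is by one coordinate at a time; allowing a multiple of the vector
  \<open>x0\<close>, which is not assumed independent of the coordinates, keeps the value at \<open>x0\<close> under control.\<close>

lemma hahn_banach_finite:
  fixes N :: "('i \<Rightarrow> real) \<Rightarrow> real"
  assumes I: "finite I"
    and sub: "\<And>c c'. N (\<lambda>i. c i + c' i) \<le> N c + N c'"
    and hom: "\<And>a c. a \<ge> 0 \<Longrightarrow> N (\<lambda>i. a * c i) = a * N c"
  shows "\<exists>y. \<forall>t c. (\<forall>i. i \<notin> I \<longrightarrow> c i = 0) \<longrightarrow> t * N x0 + (\<Sum>i\<in>I. c i * y i) \<le> N (\<lambda>i. t * x0 i + c i)"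
  using I
proof (induction I)
  case empty
  have N0: "N (\<lambda>i. 0) = 0" using hom[of 0] by simp
  have "t * N x0 \<le> N (\<lambda>i. t * x0 i)" for t
  proof (cases "t \<ge> 0")
    case False
    have "N (\<lambda>i. t * x0 i + (-t) * x0 i) \<le> N (\<lambda>i. t * x0 i) + N (\<lambda>i. (-t) * x0 i)" by (rule sub)
    then show ?thesis using hom[of "-t" x0] False N0 by simp
  qed (use hom in simp)
  moreover have "c = (\<lambda>_. 0)" if "\<forall>i. c i = 0" for c :: "'i \<Rightarrow> real" using that by auto
  ultimately show ?case by auto
next
  case (insert j I)
  then obtain y where y: "\<And>t c. (\<And>i. i \<notin> I \<Longrightarrow> c i = 0) \<Longrightarrow> t * N x0 + (\<Sum>i\<in>I. c i * y i) \<le> N (\<lambda>i. t * x0 i + c i)"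
    by blast
  define \<delta> where "\<delta> i = (if i = j then 1 else 0 :: real)" for i
  define L where "L t c = t * N x0 + (\<Sum>i\<in>I. c i * y i)" for t c
  \<comment> \<open>\<open>S\<close> collects the lower bounds for the value at the new coordinate.
    Subadditivity places all of them below all upper bounds, so the supremum serves for both signs
    of the new coefficient.\<close>
  define S where "S = {L t c - N (\<lambda>i. t * x0 i + c i - \<delta> i) | t c. \<forall>i. i \<notin> I \<longrightarrow> c i = 0}"
  have upper: "s \<le> N (\<lambda>i. t' * x0 i + c' i + \<delta> i) - L t' c'" if s: "s \<in> S" and c': "\<And>i. i \<notin> I \<Longrightarrow> c' i = 0" for s t' c'
  proof -
    obtain t c where tc: "s = L t c - N (\<lambda>i. t * x0 i + c i - \<delta> i)" "\<And>i. i \<notin> I \<Longrightarrow> c i = 0" using s by (auto simp: S_def)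
    have "L t c + L t' c' = (t + t') * N x0 + (\<Sum>i\<in>I. (c i + c' i) * y i)"
      by (simp add: L_def algebra_simps sum.distrib)
    also have "\<dots> \<le> N (\<lambda>i. (t + t') * x0 i + (c i + c' i))" using tc c' by (intro y) auto
    also have "(\<lambda>i. (t + t') * x0 i + (c i + c' i)) = (\<lambda>i. (t * x0 i + c i - \<delta> i) + (t' * x0 i + c' i + \<delta> i))"
      by (simp add: algebra_simps)
    also have "N \<dots> \<le> N (\<lambda>i. t * x0 i + c i - \<delta> i) + N (\<lambda>i. t' * x0 i + c' i + \<delta> i)" by (rule sub)
    finally show ?thesis using tc by simp
  qed
  have S: "S \<noteq> {}" by (auto simp: S_def intro!: exI[of _ "\<lambda>_. 0"])
  have bdd: "bdd_above S" using upper[of _ "\<lambda>_. 0" 0] by (auto simp: bdd_above_def)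
  define yj where "yj = Sup S"
  have yj_le: "yj \<le> N (\<lambda>i. t * x0 i + c i + \<delta> i) - L t c" if "\<And>i. i \<notin> I \<Longrightarrow> c i = 0" for t c
    unfolding yj_def using S upper[OF _ that] by (intro cSup_least) auto
  have yj_ge: "L t c - N (\<lambda>i. t * x0 i + c i - \<delta> i) \<le> yj" if "\<And>i. i \<notin> I \<Longrightarrow> c i = 0" for t c
    unfolding yj_def using that by (intro cSup_upper bdd) (auto simp: S_def)
  have "t * N x0 + (\<Sum>i\<in>insert j I. c i * (y(j := yj)) i) \<le> N (\<lambda>i. t * x0 i + c i)"
    if c: "\<And>i. i \<notin> insert j I \<Longrightarrow> c i = 0" for t c
  proof -
    define a where "a = c j"
    define c1 where "c1 = c(j := 0)"
    have c1: "c1 i = 0" if "i \<notin> I" for i using c[of i] that by (auto simp: c1_def)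
    have cc: "c i = c1 i + a * \<delta> i" for i by (simp add: c1_def a_def \<delta>_def)
    have "(\<Sum>i\<in>I. c i * (y(j := yj)) i) = (\<Sum>i\<in>I. c1 i * y i)"
      using insert.hyps by (intro sum.cong) (auto simp: c1_def)
    then have lhs: "t * N x0 + (\<Sum>i\<in>insert j I. c i * (y(j := yj)) i) = L t c1 + a * yj"
      using insert.hyps by (simp add: L_def a_def)
    have Ls: "L (t / b) (\<lambda>i. c1 i / b) = L t c1 / b" for b
      by (simp add: L_def add_divide_distrib sum_divide_distrib)
    consider "a = 0" | "a > 0" | "a < 0" by linarith
    then have "L t c1 + a * yj \<le> N (\<lambda>i. t * x0 i + c i)"
    proof cases
      case 1
      then show ?thesis using y[of c1 t] c1 by (simp add: L_def cc)
    next
      case 2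
      have "yj \<le> N (\<lambda>i. (t / a) * x0 i + c1 i / a + \<delta> i) - L t c1 / a"
        using yj_le[of "\<lambda>i. c1 i / a" "t / a"] c1 by (simp add: Ls)
      then have "a * yj \<le> a * N (\<lambda>i. (t / a) * x0 i + c1 i / a + \<delta> i) - L t c1"
        using 2 by (simp add: field_simps)
      also have "a * N (\<lambda>i. (t / a) * x0 i + c1 i / a + \<delta> i) = N (\<lambda>i. a * ((t / a) * x0 i + c1 i / a + \<delta> i))"
        using 2 by (subst hom) auto
      also have "(\<lambda>i. a * ((t / a) * x0 i + c1 i / a + \<delta> i)) = (\<lambda>i. t * x0 i + c i)"
        using 2 by (simp add: cc algebra_simps)
      finally show ?thesis by simp
    next
      case 3
      have "L t c1 / (-a) - N (\<lambda>i. (t / (-a)) * x0 i + c1 i / (-a) - \<delta> i) \<le> yj"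
        using yj_ge[of "\<lambda>i. c1 i / (-a)" "t / (-a)"] c1 Ls[of "-a"] by simp
      then have "(-a) * (L t c1 / (-a) - N (\<lambda>i. (t / (-a)) * x0 i + c1 i / (-a) - \<delta> i)) \<le> (-a) * yj"
        using 3 by (intro mult_left_mono) auto
      moreover have "(-a) * N (\<lambda>i. (t / (-a)) * x0 i + c1 i / (-a) - \<delta> i) = N (\<lambda>i. (-a) * ((t / (-a)) * x0 i + c1 i / (-a) - \<delta> i))"
        using 3 by (subst hom) auto
      moreover have "(\<lambda>i. (-a) * ((t / (-a)) * x0 i + c1 i / (-a) - \<delta> i)) = (\<lambda>i. t * x0 i + c i)"
        using 3 by (simp add: cc algebra_simps)
      ultimately show ?thesis using 3 by (simp add: right_diff_distrib)
    qed
    then show ?thesis using lhs by simp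
  qed
  then show ?case by (intro exI[of _ "y(j := yj)"]) auto
qed

definition pos_functional :: "nat \<Rightarrow> nat \<Rightarrow> (((nat \<Rightarrow> real) \<Rightarrow> real) \<Rightarrow> real) \<Rightarrow> bool" where
  "pos_functional r k L \<longleftrightarrow>
     (\<forall>p q a b. form r (2 * k) p \<and> form r (2 * k) q \<longrightarrow> L (\<lambda>w. a * p w + b * q w) = a * L p + b * L q) \<and>
     (\<forall>p. sos r k p \<longrightarrow> 0 \<le> L p) \<and> L (\<lambda>w. sq r w ^ k) = 1"

text \<open>A linear functional below the gauge \<open>N\<close> is nonnegative on the cone, because
  \<open>N\<close> is at most 0 at the negative of a sum of squares. Only weak separation of
  \<open>q\<close> results, since closedness of the cone is not established; the users supply the
  strict gap.\<close>

lemma not_sos_imp_functional: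
  assumes q: "form r (2 * k) q" and nq: "\<not> sos r k q"
  shows "\<exists>L. pos_functional r k L \<and> L q \<le> 0"
proof -
  define e where "e w = sq r w ^ k" for w
  define I where "I = words r (2 * k)"
  define P where "P = lincomb r (2 * k)"
  have se: "sos r k (\<lambda>w. a * e w)" if "a \<ge> 0" for a
    unfolding e_def by (rule sos_scale[OF sos_sq_power that])
  have ou: "\<exists>a. sos r k (\<lambda>w. a * e w - p w)" if "form r (2 * k) p" for p
    unfolding e_def by (rule order_unit[OF that])
  have formP: "form r (2 * k) (P c)" for c by (auto simp: form_def P_def)
  have Padd: "P (\<lambda>i. c i + c' i) w = P c w + P c' w" for c c' w unfolding P_def by (rule lincomb_add)
  have Pscale: "P (\<lambda>i. a * c i) w = a * P c w" for a c w unfolding P_def by (rule lincomb_scale)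
  \<comment> \<open>The cone is proper, and \<open>q\<close> witnesses it: a negative multiple of
    the order unit in the cone would put every form there, including \<open>q\<close>.\<close>
  have neg_e: "a \<ge> 0" if "sos r k (\<lambda>w. a * e w)" for a
  proof (rule ccontr)
    assume a: "\<not> a \<ge> 0"
    have ne: "sos r k (\<lambda>w. b * e w)" for b
    proof (cases "b \<ge> 0")
      case False
      have "sos r k (\<lambda>w. (b / a) * (a * e w))" using False a by (intro sos_scale that) (auto simp: divide_simps)
      then show ?thesis using a by simp
    qed (rule se)
    obtain b where "sos r k (\<lambda>w. b * e w - (-1) * q w)" using ou[OF form_scale[OF q, of "-1"]] by blast
    from sos_add[OF this ne[of "-b"]] have "sos r k q" by simp
    then show False using nq by simp
  qed
  define S where "S c = {a. sos r k (\<lambda>w. a * e w - P c w)}" for c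
  \<comment> \<open>The Minkowski-type gauge of the cone relative to the order unit, as a sublinear
    function of the coefficients.\<close>
  define N where "N c = Inf (S c)" for c
  have S_ne: "S c \<noteq> {}" for c using ou[OF formP] by (auto simp: S_def)
  have S_lower: "- b \<le> a" if "a \<in> S c" "b \<in> S (\<lambda>i. -1 * c i)" for a b c
  proof -
    have "sos r k (\<lambda>w. (a * e w - P c w) + (b * e w - P (\<lambda>i. -1 * c i) w))"
      using that by (intro sos_add) (auto simp: S_def)
    then have "sos r k (\<lambda>w. (a + b) * e w)" by (simp only: Pscale) (simp add: algebra_simps)
    then show ?thesis using neg_e by force
  qed
  have S_bdd: "bdd_below (S c)" for c
  proof -
    obtain b where "b \<in> S (\<lambda>i. -1 * c i)" using S_ne by blast
    then show ?thesis using S_lower by (intro bdd_belowI[of _ "-b"]) blast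
  qed
  have N_le: "N c \<le> a" if "a \<in> S c" for a c unfolding N_def by (intro cInf_lower that S_bdd)
  have N_ge: "b \<le> N c" if "\<And>a. a \<in> S c \<Longrightarrow> b \<le> a" for b c unfolding N_def using that by (intro cInf_greatest S_ne)
  have S_add: "a + a' \<in> S (\<lambda>i. c i + c' i)" if "a \<in> S c" "a' \<in> S c'" for a a' c c'
  proof -
    have "sos r k (\<lambda>w. (a * e w - P c w) + (a' * e w - P c' w))" using that by (intro sos_add) (auto simp: S_def)
    then show ?thesis by (simp add: S_def Padd algebra_simps)
  qed
  have S_scale: "t * a \<in> S (\<lambda>i. t * c i)" if "a \<in> S c" "t \<ge> 0" for a t c
  proof -
    have "sos r k (\<lambda>w. t * (a * e w - P c w))" using that by (intro sos_scale) (auto simp: S_def)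
    then show ?thesis by (simp add: S_def Pscale algebra_simps)
  qed
  have sub: "N (\<lambda>i. c i + c' i) \<le> N c + N c'" for c c'
  proof -
    have "N (\<lambda>i. c i + c' i) - a \<le> N c'" if "a \<in> S c" for a
      by (rule N_ge) (use N_le[OF S_add[OF that]] in force)
    then have "N (\<lambda>i. c i + c' i) - N c' \<le> N c" by (intro N_ge) force
    then show ?thesis by simp
  qed
  have P0: "P (\<lambda>i. 0) w = 0" for w using Pscale[of 0 "\<lambda>_. 0"] by simp
  have N0: "N (\<lambda>i. 0) = 0"
  proof (rule antisym)
    show "N (\<lambda>i. 0) \<le> 0" by (rule N_le) (use sos_zero in \<open>simp add: S_def P0\<close>)
    show "0 \<le> N (\<lambda>i. 0)" by (rule N_ge) (use neg_e in \<open>simp add: S_def P0\<close>)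
  qed
  have hom: "N (\<lambda>i. t * c i) = t * N c" if t: "t \<ge> 0" for t c
  proof (cases "t = 0")
    case False
    have le: "N (\<lambda>i. t * c i) \<le> t * N c" if "t > 0" for t c
    proof -
      have "N (\<lambda>i. t * c i) / t \<le> N c"
        by (rule N_ge) (use N_le[OF S_scale] that in \<open>simp add: divide_simps mult.commute\<close>)
      then show ?thesis using that by (simp add: divide_simps mult.commute)
    qed
    have "N (\<lambda>i. (1 / t) * (t * c i)) \<le> (1 / t) * N (\<lambda>i. t * c i)" by (rule le) (use t False in simp)
    moreover have "(\<lambda>i. (1 / t) * (t * c i)) = c" using False by simp
    ultimately have "N c \<le> N (\<lambda>i. t * c i) / t" by simp
    then show ?thesis using le[of t c] t False by (simp add: divide_simps mult.commute)
  qed (simp add: N0)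
  obtain c0 where c0: "q = P c0" using q by (auto simp: form_def P_def)
  \<comment> \<open>Coefficients of words of another length do not affect \<open>P\<close>; cutting
    them off meets the support condition of the extension lemma.\<close>
  define cut where "cut c i = (if i \<in> I then c i else 0 :: real)" for c i
  have Pcut: "P (cut c) = P c" for c by (auto simp: P_def lincomb_def cut_def I_def fun_eq_iff intro!: sum.cong)
  have cut0: "cut c i = 0" if "i \<notin> I" for c i using that by (simp add: cut_def)
  have Scut: "S (cut c) = S c" for c by (simp add: S_def Pcut)
  have Ncut: "N (cut c) = N c" for c by (simp add: N_def Scut)
  \<comment> \<open>The vector of -q. Its gauge is nonnegative because \<open>q\<close> is not a sum
    of squares, and a functional that agrees with the gauge in this direction is at most 0 at
    \<open>q\<close>.\<close>
  define x0 where "x0 i = -1 * cut c0 i" for i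
  obtain y where y: "\<And>t c. (\<And>i. i \<notin> I \<Longrightarrow> c i = 0) \<Longrightarrow> t * N x0 + (\<Sum>i\<in>I. c i * y i) \<le> N (\<lambda>i. t * x0 i + c i)"
    using hahn_banach_finite[of I N x0] sub hom finite_words unfolding I_def by meson
  define l where "l c = (\<Sum>i\<in>I. c i * y i)" for c
  have l_le: "l c \<le> N c" for c
  proof -
    have "l c = l (cut c)" by (simp add: l_def cut_def cong: sum.cong)
    also have "\<dots> \<le> N (cut c)" using y[of "cut c" 0] by (simp add: l_def cut0)
    finally show ?thesis by (simp add: Ncut)
  qed
  have l_scale: "l (\<lambda>i. t * c i) = t * l c" for t c by (simp add: l_def sum_distrib_left mult.assoc)
  have l_add: "l (\<lambda>i. c i + c' i) = l c + l c'" for c c' by (simp add: l_def sum.distrib algebra_simps)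
  have l_pos: "0 \<le> l c" if "sos r k (P c)" for c
  proof -
    have "0 \<in> S (\<lambda>i. -1 * c i)" using that unfolding S_def Pscale by simp
    from N_le[OF this] l_le[of "\<lambda>i. -1 * c i"] show ?thesis unfolding l_scale by simp
  qed
  \<comment> \<open>Coefficients being non-unique, the functional must be shown to depend on the
    form alone. The difference of two representations gives the zero form, which is a sum of
    squares, and so does its negative.\<close>
  have l_wd: "l c = l c'" if "P c = P c'" for c c'
  proof -
    have "P (\<lambda>i. c i + -1 * c' i) = (\<lambda>w. 0)" "P (\<lambda>i. c' i + -1 * c i) = (\<lambda>w. 0)"
      unfolding fun_eq_iff Padd Pscale using that by simp_all
    then have "sos r k (P (\<lambda>i. c i + -1 * c' i))" "sos r k (P (\<lambda>i. c' i + -1 * c i))"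
      using sos_zero by simp_all
    from l_pos[OF this(1)] l_pos[OF this(2)] show ?thesis unfolding l_add l_scale by simp
  qed
  define L where "L p = l (SOME c. p = P c)" for p
  have L: "L (P c) = l c" for c
  proof -
    have "P c = P (SOME c'. P c = P c')" by (rule someI[of "\<lambda>c'. P c = P c'" c]) simp
    then show ?thesis unfolding L_def by (rule l_wd[symmetric])
  qed
  have formD: "\<exists>c. p = P c" if "form r (2 * k) p" for p using that by (auto simp: form_def P_def)
  have "L (\<lambda>w. a * p w + b * p' w) = a * L p + b * L p'" if f: "form r (2 * k) p" "form r (2 * k) p'" for p p' a b
  proof -
    obtain c c' where c: "p = P c" "p' = P c'" using formD[OF f(1)] formD[OF f(2)] by blast
    have "(\<lambda>w. a * p w + b * p' w) = P (\<lambda>i. a * c i + b * c' i)" by (simp add: c Padd Pscale fun_eq_iff)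
    then show ?thesis by (simp only: L c l_add l_scale)
  qed
  moreover have "0 \<le> L p" if "sos r k p" for p
    using formD[OF sos_form[OF that]] l_pos that L by auto
  moreover have "L e = 1"
  proof -
    obtain c where c: "e = P c" using formD[OF form_sq_power[of r k]] unfolding e_def by blast
    have "1 \<in> S c" using sos_zero by (simp add: S_def flip: c)
    moreover have "-1 \<in> S (\<lambda>i. -1 * c i)" unfolding S_def Pscale using sos_zero by (simp flip: c)
    ultimately have "l c \<le> 1" "-1 * l c \<le> -1" using l_le N_le unfolding l_scale[symmetric] by (meson order_trans)+
    then show ?thesis by (simp add: c L)
  qed
  moreover have "L q \<le> 0"
  proof -
    have "N x0 + l (cut c0) \<le> N (\<lambda>i. 0)"
      using y[of "cut c0" 1] by (simp add: l_def cut0 x0_def)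
    moreover have "0 \<le> N x0"
    proof (rule N_ge, rule ccontr)
      fix a assume a: "a \<in> S x0" "\<not> 0 \<le> a"
      have "sos r k (\<lambda>w. a * e w + q w)"
        using a(1) unfolding S_def x0_def[abs_def] Pscale Pcut c0 by simp
      from sos_add[OF this se[of "-a"]] have "sos r k q" using a(2) by simp
      then show False using nq by simp
    qed
    moreover have "l (cut c0) = l c0" by (rule l_wd[OF Pcut])
    ultimately show ?thesis by (simp add: N0 c0 L)
  qed
  ultimately show ?thesis unfolding pos_functional_def e_def[abs_def] by (intro exI[of _ L]) auto
qed

text \<open>With a = A^2 and b = B^2 the form equals a b^(k-1) + (a - b)(a^(k-1) - b^(k-1)). The
  last product is (a - b)^2 times a geometric sum, and each of its terms is a square.\<close>

lemma sos_young_even: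
  fixes A B :: "(nat \<Rightarrow> real) \<Rightarrow> real"
  assumes A: "form r 1 A" and B: "form r 1 B" and k: "k > 0"
  shows "sos r k (\<lambda>w. A w ^ (2 * k) + B w ^ (2 * k) - A w ^ (2 * k - 2) * (B w)\<^sup>2)"
proof -
  obtain k' where k': "k = Suc k'" using k by (cases k) auto
  have fA: "form r i (\<lambda>w. A w ^ i)" and fB: "form r i (\<lambda>w. B w ^ i)" for i
    using form_power[OF A, of i] form_power[OF B, of i] by simp_all
  have 1: "sos r k (\<lambda>w. (A w * B w ^ k')\<^sup>2)"
    using form_mult[OF A fB[of k']] by (intro sos_square) (simp add: k')
  have 2: "sos r k (\<lambda>w. ((A w ^ 2 - B w ^ 2) * (A w ^ i * B w ^ (k' - 1 - i)))\<^sup>2)" if "i < k'" for i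
    using form_mult[OF form_diff[OF fA[of 2] fB[of 2]] form_mult[OF fA[of i] fB[of "k' - 1 - i"]]] that
    by (intro sos_square) (simp add: k')
  have "sos r k (\<lambda>w. (A w * B w ^ k')\<^sup>2 + (\<Sum>i<k'. ((A w ^ 2 - B w ^ 2) * (A w ^ i * B w ^ (k' - 1 - i)))\<^sup>2))"
    by (intro sos_add 1 sos_sum 2) auto
  also have "(\<lambda>w. (A w * B w ^ k')\<^sup>2 + (\<Sum>i<k'. ((A w ^ 2 - B w ^ 2) * (A w ^ i * B w ^ (k' - 1 - i)))\<^sup>2))
    = (\<lambda>w. A w ^ (2 * k) + B w ^ (2 * k) - A w ^ (2 * k - 2) * (B w)\<^sup>2)"
  proof
    fix w
    define a b where "a = (A w)\<^sup>2" and "b = (B w)\<^sup>2"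
    have geo: "(a - b) * (\<Sum>i<k'. a ^ i * b ^ (k' - 1 - i)) = a ^ k' - b ^ k'"
    proof (cases k')
      case (Suc n)
      have "a ^ Suc n - b ^ Suc n = (a - b) * (\<Sum>p<Suc n. a ^ p * b ^ (n - p))"
        using power_diff_sumr2[of a "Suc n" b] by (simp add: mult.commute)
      then show ?thesis by (simp add: Suc)
    qed simp
    have "(A w * B w ^ k')\<^sup>2 + (\<Sum>i<k'. ((A w ^ 2 - B w ^ 2) * (A w ^ i * B w ^ (k' - 1 - i)))\<^sup>2)
      = a * b ^ k' + (\<Sum>i<k'. (a - b)\<^sup>2 * (a ^ i * b ^ (k' - 1 - i)))"
      by (simp add: a_def b_def power_mult_distrib power_mult[symmetric] mult.commute)
    also have "\<dots> = a * b ^ k' + (a - b) * (a ^ k' - b ^ k')"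
      by (simp add: geo[symmetric] power2_eq_square sum_distrib_left mult.assoc)
    also have "\<dots> = a ^ k + b ^ k - a ^ k' * b" by (simp add: k' algebra_simps)
    also have "\<dots> = A w ^ (2 * k) + B w ^ (2 * k) - A w ^ (2 * k - 2) * (B w)\<^sup>2"
    proof -
      have "2 * k - 2 = 2 * k'" by (simp add: k')
      then show ?thesis by (simp only: a_def b_def power_mult)
    qed
    finally show "(A w * B w ^ k')\<^sup>2 + (\<Sum>i<k'. ((A w ^ 2 - B w ^ 2) * (A w ^ i * B w ^ (k' - 1 - i)))\<^sup>2)
      = A w ^ (2 * k) + B w ^ (2 * k) - A w ^ (2 * k - 2) * (B w)\<^sup>2" .
  qed
  finally show ?thesis .
qed

text \<open>The square of A^(k-1) (A - B) produces the odd product at the cost of A^(2k-2) B^2,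
  which the even case absorbs.\<close>

lemma sos_young:
  fixes A B :: "(nat \<Rightarrow> real) \<Rightarrow> real"
  assumes A: "form r 1 A" and B: "form r 1 B" and k: "k > 0"
  shows "sos r k (\<lambda>w. A w ^ (2 * k) + B w ^ (2 * k) - A w ^ (2 * k - 1) * B w)"
proof -
  obtain k' where k': "k = Suc k'" using k by (cases k) auto
  have fA: "form r i (\<lambda>w. A w ^ i)" and fB: "form r i (\<lambda>w. B w ^ i)" for i
    using form_power[OF A, of i] form_power[OF B, of i] by simp_all
  have 1: "sos r k (\<lambda>w. (A w ^ k' * (A w - B w))\<^sup>2)"
    using form_mult[OF fA[of k'] form_diff[OF A B]] by (intro sos_square) (simp add: k')
  have "sos r k (\<lambda>w. (1/2) * (((A w ^ k' * (A w - B w))\<^sup>2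
      + (A w ^ (2 * k) + B w ^ (2 * k) - A w ^ (2 * k - 2) * (B w)\<^sup>2)) + (B w ^ k)\<^sup>2))"
    by (intro sos_scale sos_add 1 sos_young_even[OF A B k] sos_square fB) simp
  also have "(\<lambda>w. (1/2) * (((A w ^ k' * (A w - B w))\<^sup>2
      + (A w ^ (2 * k) + B w ^ (2 * k) - A w ^ (2 * k - 2) * (B w)\<^sup>2)) + (B w ^ k)\<^sup>2))
    = (\<lambda>w. A w ^ (2 * k) + B w ^ (2 * k) - A w ^ (2 * k - 1) * B w)"
  proof
    fix w
    define c where "c = (A w ^ k')\<^sup>2"
    have p: "A w ^ (2 * k) = c * (A w)\<^sup>2" "A w ^ (2 * k - 2) = c" "A w ^ (2 * k - 1) = c * A w" "B w ^ (2 * k) = (B w ^ k)\<^sup>2"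
      by (simp_all add: c_def k' power2_eq_square power_add mult_2 power_mult_distrib)
    show "(1/2) * (((A w ^ k' * (A w - B w))\<^sup>2
      + (A w ^ (2 * k) + B w ^ (2 * k) - A w ^ (2 * k - 2) * (B w)\<^sup>2)) + (B w ^ k)\<^sup>2)
    = A w ^ (2 * k) + B w ^ (2 * k) - A w ^ (2 * k - 1) * B w"
      unfolding p power_mult_distrib c_def[symmetric] by (simp add: power2_eq_square algebra_simps)
  qed
  finally show ?thesis .
qed

lemma form_inner: "form r 1 (\<lambda>w. inner_d r w x)"
  unfolding inner_d_def by (simp only: mult.commute[of _ "x _"]) (intro form_sum form_scale form_var, simp)

text \<open>Lagrange's identity, read as a certificate.\<close>

lemma sos_cauchy_schwarz:
  assumes x: "norm_d r x = 1"
  shows "sos r 1 (\<lambda>w. sq r w - (inner_d r w x)\<^sup>2)"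
proof -
  have "sos r 1 (\<lambda>w. (1/2) * (\<Sum>i<r. \<Sum>j<r. (x j * w i - x i * w j)\<^sup>2))"
    by (intro sos_scale sos_sum sos_square form_diff form_scale form_var) auto
  also have "(\<lambda>w. (1/2) * (\<Sum>i<r. \<Sum>j<r. (x j * w i - x i * w j)\<^sup>2)) = (\<lambda>w. sq r w - (inner_d r w x)\<^sup>2)"
  proof
    fix w
    have x1: "(\<Sum>j<r. (x j)\<^sup>2) = 1" using norm_d_sq[of r x] x by simp
    have "(\<Sum>i<r. \<Sum>j<r. (x j * w i - x i * w j)\<^sup>2)
      = (\<Sum>i<r. \<Sum>j<r. (w i)\<^sup>2 * (x j)\<^sup>2) + (\<Sum>i<r. \<Sum>j<r. (x i)\<^sup>2 * (w j)\<^sup>2) - 2 * (\<Sum>i<r. \<Sum>j<r. (w i * x i) * (w j * x j))"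
      unfolding sum_distrib_left sum.distrib[symmetric] sum_subtractf[symmetric]
      by (intro sum.cong refl) (simp add: power2_eq_square algebra_simps)
    also have "\<dots> = 2 * sq r w - 2 * (inner_d r w x)\<^sup>2"
      unfolding sum_product[symmetric] x1 by (simp add: sq_def inner_d_def power2_eq_square)
    finally show "(1/2) * (\<Sum>i<r. \<Sum>j<r. (x j * w i - x i * w j)\<^sup>2) = sq r w - (inner_d r w x)\<^sup>2" by simp
  qed
  finally show ?thesis .
qed

text \<open>Telescoping as in \<open>sos_sq_minus_mon\<close>, replacing one factor at a
  time.\<close>

lemma sos_cauchy_schwarz_power:
  assumes x: "norm_d r x = 1"
  shows "sos r k (\<lambda>w. sq r w ^ k - inner_d r w x ^ (2 * k))"
proof (induction k)
  case 0 then show ?case using sos_zero by simp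
next
  case (Suc k)
  have "sos r (1 + k) (\<lambda>w. (sq r w - (inner_d r w x)\<^sup>2) * sq r w ^ k + (inner_d r w x)\<^sup>2 * (sq r w ^ k - inner_d r w x ^ (2 * k)))"
    by (intro sos_add sos_mult sos_cauchy_schwarz x sos_sq_power sos_square form_inner Suc)
  also have "(\<lambda>w. (sq r w - (inner_d r w x)\<^sup>2) * sq r w ^ k + (inner_d r w x)\<^sup>2 * (sq r w ^ k - inner_d r w x ^ (2 * k)))
     = (\<lambda>w. sq r w ^ Suc k - inner_d r w x ^ (2 * Suc k))"
    by (simp add: algebra_simps power2_eq_square)
  finally show ?case by simp
qed

section \<open>Positive functionals and subgaussian vectors\<close>

lemma gauss_coordinates_indep: "prob_space.indep_vars (gauss {..<r}) (\<lambda>_. borel) (\<lambda>i z. z i) {..<r::nat}"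
\<comment> \<open>The empty family is separate because the characterisation of independence by
  product measures asks for a nonempty index set.\<close>
proof (cases "r = 0")
  case True
  then show ?thesis using prob_space_gauss[of "{..<r}"]
    by (simp add: prob_space.indep_vars_def prob_space.indep_sets_def)
next
  case False
  interpret prob_space "gauss {..<r}" by (rule prob_space_gauss)
  have m: "(\<lambda>z. z i) \<in> measurable (gauss {..<r}) std_normal" if "i \<in> {..<r}" for i
    unfolding gauss_def by (rule measurable_component_singleton) (rule that)
  have "distr (gauss {..<r}) (PiM {..<r} (\<lambda>_. std_normal)) (\<lambda>z. \<lambda>i\<in>{..<r}. z i) = distr (gauss {..<r}) (gauss {..<r}) (\<lambda>z. z)"
    by (rule distr_cong) (auto simp: gauss_def space_PiM PiE_def extensional_restrict)
  also have "\<dots> = PiM {..<r} (\<lambda>i. distr (gauss {..<r}) std_normal (\<lambda>z. z i))"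
    by (simp add: distr_id distr_gauss_component gauss_def[of "{..<r}"] cong: PiM_cong)
       (intro PiM_cong, auto simp: distr_gauss_component[unfolded gauss_def])
  finally have "indep_vars (\<lambda>_. std_normal) (\<lambda>i z. z i) {..<r}"
    using False m by (subst indep_vars_iff_distr_eq_PiM') auto
  then show ?thesis
    by (rule indep_vars_compose2[where Y="\<lambda>i x. x" and N="\<lambda>_. borel", simplified])
       (simp add: measurable_def)
qed

lemma gauss_inner_distributed:
  assumes v: "sq r v > 0"
  shows "distributed (gauss {..<r}) lborel (\<lambda>z. inner_d r v z) (normal_density 0 (sqrt (sq r v)))"
proof -
  interpret prob_space "gauss {..<r}" by (rule prob_space_gauss)
  \<comment> \<open>Zero coefficients are discarded: a degenerate normal variable has no density,
    and the sum of independent normals is stated for positive deviations.\<close>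
  define A where "A = {i \<in> {..<r}. v i \<noteq> 0}"
  have A: "finite A" "A \<subseteq> {..<r}" by (auto simp: A_def)
  have sumA: "(\<Sum>i\<in>A. (v i)\<^sup>2) = sq r v" unfolding sq_def A_def by (rule sum.mono_neutral_left) auto
  have innerA: "(\<Sum>i\<in>A. v i * z i) = inner_d r v z" for z
    unfolding inner_d_def A_def by (rule sum.mono_neutral_left) auto
  have A_ne: "A \<noteq> {}" using v sumA by auto
  have ind: "indep_vars (\<lambda>_. borel) (\<lambda>i z. v i * z i) A"
    by (rule indep_vars_compose2[OF indep_vars_subset[OF gauss_coordinates_indep A(2)]]) simp
  have d: "distributed (gauss {..<r}) lborel (\<lambda>z. v i * z i) (normal_density 0 \<bar>v i\<bar>)" if i: "i \<in> A" for i
  proof -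
    have m: "(\<lambda>z. z i) \<in> borel_measurable (gauss {..<r})" using i A by (intro measurable_gauss_component) auto
    have "distr (gauss {..<r}) lborel (\<lambda>z. z i) = distr (gauss {..<r}) std_normal (\<lambda>z. z i)"
      by (rule distr_cong) auto
    also have "\<dots> = density lborel std_normal_density"
      using i A by (subst distr_gauss_component) (auto simp: std_normal_def)
    finally have "distributed (gauss {..<r}) lborel (\<lambda>z. z i) std_normal_density"
      using m by (simp add: distributed_def)
    from normal_density_affine[OF this, of "v i" 0] i show ?thesis by (simp add: A_def)
  qed
  have "distributed (gauss {..<r}) lborel (\<lambda>z. \<Sum>i\<in>A. v i * z i)
     (normal_density (\<Sum>i\<in>A. 0) (sqrt (\<Sum>i\<in>A. \<bar>v i\<bar>\<^sup>2)))"
    by (rule sum_indep_normal[OF A(1) A_ne ind _ d]) (auto simp: A_def)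
  then show ?thesis by (simp add: innerA sumA)
qed

text \<open>The factor is the double factorial of 2k - 1. A vanishing \<open>v\<close> is treated
  apart, the distribution having no density then.\<close>

lemma
  shows gauss_inner_power_integrable: "integrable (gauss {..<r}) (\<lambda>z. inner_d r v z ^ q)"
    and gauss_inner_even_moment:
      "(\<integral>z. inner_d r v z ^ (2 * k) \<partial>gauss {..<r}) = fact (2 * k) / (2 ^ k * fact k) * sq r v ^ k"
proof -
  interpret prob_space "gauss {..<r}" by (rule prob_space_gauss)
  have "integrable (gauss {..<r}) (\<lambda>z. inner_d r v z ^ q) \<and>
    (\<integral>z. inner_d r v z ^ (2 * k) \<partial>gauss {..<r}) = fact (2 * k) / (2 ^ k * fact k) * sq r v ^ k"
  proof (cases "sq r v > 0")
    case True
    note d = gauss_inner_distributed[OF True]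
    have "integrable (gauss {..<r}) (\<lambda>z. inner_d r v z ^ q)"
      using distributed_integrable[OF d, of "\<lambda>x. x ^ q"] integrable_normal_moment[of "sqrt (sq r v)" 0 q] True
      by simp
    moreover have "(\<integral>z. inner_d r v z ^ (2 * k) \<partial>gauss {..<r}) = fact (2 * k) / ((2 / (sqrt (sq r v))\<^sup>2) ^ k * fact k)"
      using distributed_integral[OF d, of "\<lambda>x. x ^ (2 * k)"] integral_normal_moment_even[of "sqrt (sq r v)" 0 k] True
      by simp
    ultimately show ?thesis using True by (simp add: power_divide)
  next
    case False
    then have s0: "sq r v = 0" by (smt (verit) sq_def sum_nonneg zero_le_power2)
    then have "v i = 0" if "i < r" for i using that by (simp add: sq_def sum_nonneg_eq_0_iff)
    then have "inner_d r v z = 0" for z by (simp add: inner_d_def)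
    then show ?thesis using s0 by (cases "k = 0") (auto simp: prob_space power_0_left)
  qed
  then show "integrable (gauss {..<r}) (\<lambda>z. inner_d r v z ^ q)"
    "(\<integral>z. inner_d r v z ^ (2 * k) \<partial>gauss {..<r}) = fact (2 * k) / (2 ^ k * fact k) * sq r v ^ k" by auto
qed

lemma gauss_moment_const_le: "fact (2 * k) / (2 ^ k * fact k) \<le> (real (2 * k)) ^ k"
proof -
  have "fact (2 * k) div fact (2 * k - k) \<le> (2 * k) ^ k" by (rule fact_div_fact_le_pow) simp
  moreover have "fact (2 * k) = (fact (2 * k) div fact k :: nat) * fact k"
    using fact_dvd[of k "2 * k", where 'a=nat] by simp
  ultimately have "(fact (2 * k) :: nat) \<le> (2 * k) ^ k * fact k" by (simp del: fact_Suc) (metis mult_le_mono1)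
  then have "real (fact (2 * k)) \<le> real ((2 * k) ^ k * fact k)" by (simp only: of_nat_le_iff)
  then have "fact (2 * k) / fact k \<le> (real (2 * k)) ^ k" by (simp add: divide_simps)
  moreover have "fact (2 * k) / (2 ^ k * fact k) \<le> (fact (2 * k) / fact k :: real)"
    by (intro divide_left_mono) auto
  ultimately show ?thesis by linarith
qed

section \<open>Moments as forms: expansion in words\<close>

lemma sum_words_Suc: "(\<Sum>xs\<in>words r (Suc n). f xs) = (\<Sum>i<r. \<Sum>xs\<in>words r n. f (i # xs))" for f :: "_ \<Rightarrow> real"
proof -
  have "words r (Suc n) = (\<lambda>(i, xs). i # xs) ` ({..<r} \<times> words r n)"
    by (auto simp: words_def image_iff length_Suc_conv)
  then have "(\<Sum>xs\<in>words r (Suc n). f xs) = (\<Sum>(i, xs)\<in>{..<r} \<times> words r n. f (i # xs))"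
    by (simp add: sum.reindex inj_on_def case_prod_unfold)
  then show ?thesis by (simp add: sum.cartesian_product)
qed

lemma inner_power_expand: "inner_d r w x ^ n = (\<Sum>xs\<in>words r n. mon xs x * mon xs w)"
proof (induction n)
  case 0 then show ?case by (simp add: words_0)
next
  case (Suc n)
  have "inner_d r w x ^ Suc n = (\<Sum>i<r. w i * x i) * (\<Sum>xs\<in>words r n. mon xs x * mon xs w)"
    unfolding power_Suc Suc by (simp only: inner_d_def)
  also have "\<dots> = (\<Sum>xs\<in>words r (Suc n). mon xs x * mon xs w)"
    unfolding sum_words_Suc sum_product by (intro sum.cong refl) (simp add: mult_ac)
  finally show ?case .
qed

lemma norm_d_sq': "(norm_d r v)\<^sup>2 = sq r v" by (simp add: norm_d_sq sq_def)

lemma abs_mon_le: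
  assumes "xs \<in> words r n" "\<And>i. i < r \<Longrightarrow> \<bar>y i\<bar> \<le> c" "c \<ge> 0" shows "\<bar>mon xs y\<bar> \<le> c ^ n"
  using assms(1)
proof (induction xs arbitrary: n)
  case (Cons i xs)
  then have "n = Suc (length xs)" "\<bar>mon xs y\<bar> \<le> c ^ length xs" "\<bar>y i\<bar> \<le> c" using assms(2) by (auto simp: words_def)
  then show ?case using assms(3) by (simp add: abs_mult mult_mono)
qed (simp add: words_def)

text \<open>The coordinate of largest absolute value dominates the monomial. This reduces
  integrability of mixed moments to even powers of single coordinates, which are directional
  moments.\<close>

lemma abs_mon_le_sum_power:
  assumes xs: "xs \<in> words r (2 * k)" and k: "k > 0"
  shows "\<bar>mon xs y\<bar> \<le> (\<Sum>j<r. y j ^ (2 * k))"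
proof -
  have r: "r > 0" using xs k by (cases xs) (auto simp: words_def)
  define c where "c = Max ((\<lambda>j. \<bar>y j\<bar>) ` {..<r})"
  have "c \<in> (\<lambda>j. \<bar>y j\<bar>) ` {..<r}" unfolding c_def using r by (intro Max_in) auto
  then obtain j where j: "j < r" "c = \<bar>y j\<bar>" by auto
  have "\<bar>y i\<bar> \<le> c" if "i < r" for i unfolding c_def using that by auto
  then have "\<bar>mon xs y\<bar> \<le> c ^ (2 * k)" using j by (intro abs_mon_le[OF xs]) auto
  also have "\<dots> = y j ^ (2 * k)" by (simp add: j power_even_abs)
  also have "\<dots> \<le> (\<Sum>j<r. y j ^ (2 * k))"
    by (rule member_le_sum[of j _ "\<lambda>j. y j ^ (2 * k)"]) (use j in \<open>auto intro: zero_le_even_power\<close>)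
  finally show ?thesis .
qed

lemma inner_d_basis: "i < r \<Longrightarrow> inner_d r (\<lambda>j. if j = i then 1 else 0) y = y i"
  by (simp add: inner_d_def if_distrib[of "\<lambda>x. x * _"] cong: if_cong)

lemma mon_integrable:
  fixes Y :: "'w \<Rightarrow> nat \<Rightarrow> real"
  assumes int: "\<And>v q. integrable M (\<lambda>z. inner_d r v (Y z) ^ q)"
    and xs: "xs \<in> words r (2 * k)" and k: "k > 0"
  shows "integrable M (\<lambda>z. mon xs (Y z))"
proof (rule Bochner_Integration.integrable_bound[where f="\<lambda>z. \<Sum>j<r. Y z j ^ (2 * k)"])
  have Yq: "integrable M (\<lambda>z. Y z j ^ q)" if "j < r" for j q
    using int[of "\<lambda>i. if i = j then 1 else 0" q] that by (simp add: inner_d_basis)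
  show "integrable M (\<lambda>z. \<Sum>j<r. Y z j ^ (2 * k))" using Yq by auto
  have m: "(\<lambda>z. Y z j) \<in> borel_measurable M" if "j < r" for j
    using borel_measurable_integrable[OF Yq[OF that, of 1]] by simp
  have "(\<lambda>z. mon ys (Y z)) \<in> borel_measurable M" if "set ys \<subseteq> {..<r}" for ys
    using that by (induction ys) (auto intro!: borel_measurable_times m)
  then show "(\<lambda>z. mon xs (Y z)) \<in> borel_measurable M" using xs by (simp add: words_def)
  show "AE z in M. norm (mon xs (Y z)) \<le> norm (\<Sum>j<r. Y z j ^ (2 * k))"
    using abs_mon_le_sum_power[OF xs k] by (intro AE_I2) (auto intro: order_trans[OF _ abs_ge_self])
qed

lemma moment_expand:
  fixes Y :: "'w \<Rightarrow> nat \<Rightarrow> real"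
  assumes int: "\<And>v q. integrable M (\<lambda>z. inner_d r v (Y z) ^ q)" and k: "k > 0"
  shows "(\<lambda>w. \<integral>z. inner_d r w (Y z) ^ (2 * k) \<partial>M)
    = (\<lambda>w. \<Sum>xs\<in>words r (2 * k). (\<integral>z. mon xs (Y z) \<partial>M) * mon xs w)"
  unfolding inner_power_expand by (simp add: mon_integrable[OF int _ k] Bochner_Integration.integral_sum)

lemma form_inner_power: "form r n (\<lambda>w. inner_d r w x ^ n)"
  using form_power[OF form_inner[of r x], of n] by simp

section \<open>The form \<open>f\<close> attached to a positive functional, and its norming
  functionals\<close>

locale positive_functional =
  fixes r k :: nat and L :: "((nat \<Rightarrow> real) \<Rightarrow> real) \<Rightarrow> real"
  assumes pos: "pos_functional r k L" and k: "k > 0"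
begin

lemma L_lin: "form r (2 * k) p \<Longrightarrow> form r (2 * k) q \<Longrightarrow> L (\<lambda>w. a * p w + b * q w) = a * L p + b * L q"
  using pos unfolding pos_functional_def by blast

lemma L_nonneg: "sos r k p \<Longrightarrow> 0 \<le> L p"
  using pos unfolding pos_functional_def by blast

lemma L_sq: "L (\<lambda>w. sq r w ^ k) = 1"
  using pos unfolding pos_functional_def by blast

lemma L_scale: "form r (2 * k) p \<Longrightarrow> L (\<lambda>w. a * p w) = a * L p"
  using L_lin[of p p a 0] by simp

lemma L_diff: "form r (2 * k) p \<Longrightarrow> form r (2 * k) q \<Longrightarrow> L (\<lambda>w. p w - q w) = L p - L q"
  using L_lin[of p q 1 "-1"] by simp

lemma L_sum: "finite I \<Longrightarrow> (\<And>i. i \<in> I \<Longrightarrow> form r (2 * k) (p i)) \<Longrightarrow>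
  L (\<lambda>w. \<Sum>i\<in>I. c i * p i w) = (\<Sum>i\<in>I. c i * L (p i))"
proof (induction I rule: finite_induct)
  case empty
  show ?case using L_scale[OF form_zero, of 0] by simp
next
  case (insert i I)
  have "form r (2 * k) (\<lambda>w. \<Sum>i\<in>I. c i * p i w)" using insert by (intro form_sum form_scale) auto
  from L_lin[OF insert.prems[of i] this, of "c i" 1] insert show ?case by simp
qed

definition f :: "(nat \<Rightarrow> real) \<Rightarrow> real" where "f x = L (\<lambda>w. inner_d r w x ^ (2 * k))"

text \<open>Up to a factor, \<open>t x\<close> is the gradient of \<open>f\<close> at \<open>x\<close>.\<close>

definition t :: "(nat \<Rightarrow> real) \<Rightarrow> nat \<Rightarrow> real" where "t x i = L (\<lambda>w. inner_d r w x ^ (2 * k - 1) * w i)"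

lemma inner_t: "inner_d r (t x) y = L (\<lambda>w. inner_d r w x ^ (2 * k - 1) * inner_d r w y)"
proof -
  have fm: "form r (2 * k) (\<lambda>w. inner_d r w x ^ (2 * k - 1) * w i)" if "i < r" for i
    using form_mult[OF form_inner_power[of r "2 * k - 1" x] form_var[OF that]] k by simp
  have "L (\<lambda>w. \<Sum>i<r. y i * (inner_d r w x ^ (2 * k - 1) * w i)) = (\<Sum>i<r. y i * t x i)"
    unfolding t_def by (rule L_sum) (simp, rule fm, simp)
  also have "(\<lambda>w. \<Sum>i<r. y i * (inner_d r w x ^ (2 * k - 1) * w i)) = (\<lambda>w. inner_d r w x ^ (2 * k - 1) * inner_d r w y)"
    unfolding inner_d_def[of r _ y] sum_distrib_left by (intro ext sum.cong refl) (simp add: mult_ac)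
  finally show ?thesis by (simp add: inner_d_def mult.commute)
qed

text \<open>A substitute for Hoelder's inequality under \<open>L\<close>, from
  \<open>sos_young\<close> at the linear forms given by \<open>x\<close> and \<open>y\<close>. The
  missing optimal weights cost only a constant factor.\<close>

lemma inner_t_le: "inner_d r (t x) y \<le> f x + f y"
proof -
  have fm: "form r (2 * k) (\<lambda>w. inner_d r w x ^ (2 * k - 1) * inner_d r w y)"
    using form_mult[OF form_inner_power[of r "2 * k - 1" x] form_inner[of r y]] k by simp
  have "0 \<le> L (\<lambda>w. inner_d r w x ^ (2 * k) + inner_d r w y ^ (2 * k) - inner_d r w x ^ (2 * k - 1) * inner_d r w y)"
    by (intro L_nonneg sos_young form_inner k)
  also have "\<dots> = f x + f y - inner_d r (t x) y"
    unfolding inner_t f_def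
    using L_diff[OF form_add[OF form_inner_power form_inner_power] fm, of x y]
      L_lin[OF form_inner_power[of r "2 * k" x] form_inner_power[of r "2 * k" y], of 1 1] by simp
  finally show ?thesis by simp
qed

lemma inner_t_self: "inner_d r (t x) x = f x"
proof -
  have "inner_d r w x ^ (2 * k - 1) * inner_d r w x = inner_d r w x ^ (2 * k)" for w
    using k by (cases k) simp_all
  then show ?thesis by (simp only: inner_t f_def)
qed

lemma inner_d_scale: "inner_d r w (\<lambda>i. a * x i) = a * inner_d r w x"
  by (simp add: inner_d_def sum_distrib_left mult_ac)

lemma f_scale: "f (\<lambda>i. a * x i) = a ^ (2 * k) * f x"
  by (simp only: f_def inner_d_scale power_mult_distrib L_scale[OF form_inner_power])

lemma f_nonneg: "0 \<le> f x"
proof -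
  have "0 \<le> L (\<lambda>w. (inner_d r w x ^ k)\<^sup>2)" by (intro L_nonneg sos_square form_inner_power)
  then show ?thesis by (simp add: f_def power_mult[symmetric] mult.commute)
qed

lemma f_unit: "norm_d r x = 1 \<Longrightarrow> f x \<le> 1"
  using L_nonneg[OF sos_cauchy_schwarz_power[of r x k]] L_diff[OF form_sq_power form_inner_power[of r "2 * k" x]]
  by (simp add: L_sq f_def)

text \<open>Testing \<open>inner_t_le\<close> in the direction of \<open>t x\<close> itself: at a
  unit vector \<open>f\<close> is at most 1, by the certified Cauchy-Schwarz inequality.\<close>

lemma norm_t_le: assumes "f x = 1" shows "norm_d r (t x) \<le> 2"
proof (cases "norm_d r (t x) = 0")
  case False
  define n where "n = norm_d r (t x)"
  have n: "n > 0" using False norm_d_nonneg[of r "t x"] by (simp add: n_def)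
  define y where "y i = (1 / n) * t x i" for i
  have n2: "sq r (t x) = n\<^sup>2" by (simp add: n_def norm_d_sq')
  have "sq r y = (1 / n)\<^sup>2 * sq r (t x)" by (simp add: sq_def y_def power_mult_distrib sum_distrib_left power_divide)
  then have "sq r y = 1" using n n2 by (simp add: power_divide)
  then have "norm_d r y = 1" by (simp add: norm_d_def sq_def)
  moreover have "inner_d r (t x) y = n"
  proof -
    have "inner_d r (t x) y = (1 / n) * inner_d r (t x) (t x)" unfolding y_def[abs_def] by (rule inner_d_scale)
    also have "inner_d r (t x) (t x) = sq r (t x)" by (simp add: inner_d_def sq_def power2_eq_square)
    finally show ?thesis using n n2 by (simp add: power2_eq_square)
  qed
  ultimately show ?thesis using inner_t_le[of x y] f_unit[of y] assms by (simp add: n_def)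
qed simp

lemma f_expand: "f x = (\<Sum>xs\<in>words r (2 * k). mon xs x * L (mon xs))"
  unfolding f_def inner_power_expand by (rule L_sum) (auto intro: form_mon finite_words)

text \<open>\<open>L\<close> and the expectation commute because both act term by term on a finite
  expansion in words; \<open>L\<close> is purely algebraic.\<close>

lemma
  fixes Y :: "'w \<Rightarrow> nat \<Rightarrow> real"
  assumes int: "\<And>v q. integrable M (\<lambda>z. inner_d r v (Y z) ^ q)"
  shows f_integrable: "integrable M (\<lambda>z. f (Y z))"
    and f_expectation: "(\<integral>z. f (Y z) \<partial>M) = L (\<lambda>w. \<integral>z. inner_d r w (Y z) ^ (2 * k) \<partial>M)"
proof -
  have mi: "integrable M (\<lambda>z. mon xs (Y z))" if "xs \<in> words r (2 * k)" for xs
    by (rule mon_integrable[OF int that k])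
  show "integrable M (\<lambda>z. f (Y z))" unfolding f_expand
    by (intro Bochner_Integration.integrable_sum integrable_mult_left mi)
  note eq = moment_expand[OF int k]
  have "(\<integral>z. f (Y z) \<partial>M) = (\<Sum>xs\<in>words r (2 * k). (\<integral>z. mon xs (Y z) \<partial>M) * L (mon xs))"
    unfolding f_expand by (simp add: mi Bochner_Integration.integral_sum)
  also have "\<dots> = L (\<lambda>w. \<integral>z. inner_d r w (Y z) ^ (2 * k) \<partial>M)"
    unfolding eq by (rule L_sum[symmetric]) (auto intro: form_mon finite_words)
  finally show "(\<integral>z. f (Y z) \<partial>M) = L (\<lambda>w. \<integral>z. inner_d r w (Y z) ^ (2 * k) \<partial>M)" .
qed

lemma gauss_f_le: "(\<integral>z. f z \<partial>gauss {..<r}) \<le> (real (2 * k)) ^ k"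
proof -
  have "(\<integral>z. f z \<partial>gauss {..<r}) = L (\<lambda>w. \<integral>z. inner_d r w z ^ (2 * k) \<partial>gauss {..<r})"
    by (rule f_expectation) (rule gauss_inner_power_integrable)
  also have "\<dots> = fact (2 * k) / (2 ^ k * fact k)"
    unfolding gauss_inner_even_moment L_scale[OF form_sq_power] L_sq by simp
  also have "\<dots> \<le> (real (2 * k)) ^ k" by (rule gauss_moment_const_le)
  finally show ?thesis .
qed

text \<open>Rescaling \<open>z\<close> by \<open>1 / s\<close> in \<open>inner_t_le\<close> bounds
  all functionals at once by \<open>s * (1 + (1 / s) ^ (2 * k) * f z)\<close>. The choice of
  \<open>s\<close> as the square root of \<open>2 * k\<close> is the one for which the Gaussian mean
  of the second term is at most 1.\<close>

lemma gwidth_le: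
  assumes T: "finite T" "T \<noteq> {}" "T \<subseteq> t ` {x. f x = 1}"
  shows "gwidth r T \<le> 2 * sqrt (2 * k)"
proof -
  interpret prob_space "gauss {..<r}" by (rule prob_space_gauss)
  define s where "s = sqrt (2 * real k)"
  have s: "s > 0" using k by (simp add: s_def)
  have fi: "integrable (gauss {..<r}) f"
    by (rule f_integrable[where Y="\<lambda>z. z"]) (rule gauss_inner_power_integrable)
  have "gwidth r T \<le> (\<integral>z. s * (1 + (1 / s) ^ (2 * k) * f z) \<partial>gauss {..<r})"
    unfolding gwidth_def
  proof (rule integral_mono)
    show "integrable (gauss {..<r}) (\<lambda>z. Max ((\<lambda>t. lin {..<r} t z) ` T))"
      by (intro Max_integrable T lin_integrable)
    show "integrable (gauss {..<r}) (\<lambda>z. s * (1 + (1 / s) ^ (2 * k) * f z))"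
      using fi by auto
    fix z
    have "lin {..<r} u z \<le> s * (1 + (1 / s) ^ (2 * k) * f z)" if "u \<in> T" for u
    proof -
      obtain x where x: "u = t x" "f x = 1" using \<open>u \<in> T\<close> T(3) by blast
      have "(1 / s) * inner_d r u z \<le> 1 + (1 / s) ^ (2 * k) * f z"
        using inner_t_le[of x "\<lambda>i. (1 / s) * z i"] unfolding f_scale inner_d_scale x by simp
      then have "inner_d r u z \<le> s * (1 + (1 / s) ^ (2 * k) * f z)" using s by (simp add: field_simps)
      then show ?thesis by (simp add: lin_def inner_d_def)
    qed
    then show "Max ((\<lambda>t. lin {..<r} t z) ` T) \<le> s * (1 + (1 / s) ^ (2 * k) * f z)" using T by auto
  qed
  also have "\<dots> = s * (1 + (1 / s) ^ (2 * k) * (\<integral>z. f z \<partial>gauss {..<r}))"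
    using fi by (simp add: prob_space)
  also have "\<dots> \<le> s * (1 + (1 / s) ^ (2 * k) * (real (2 * k)) ^ k)"
    using s gauss_f_le by (intro mult_left_mono add_left_mono) auto
  also have "(1 / s) ^ (2 * k) * (real (2 * k)) ^ k = 1"
    using k by (simp add: s_def power_mult power_divide)
  finally show ?thesis by (simp add: s_def)
qed

lemma continuous_mon: "continuous_on UNIV (mon xs)"
  by (induction xs) (auto intro!: continuous_intros continuous_on_product_coordinates simp: mon_def[abs_def])

lemma continuous_f: "continuous_on UNIV f"
  unfolding f_expand[abs_def] by (intro continuous_intros continuous_mon)

lemma continuous_inner: "continuous_on UNIV (inner_d r v)"
  unfolding inner_d_def[abs_def] by (intro continuous_intros continuous_on_product_coordinates)

lemma f_normalize:
  assumes "f y > 0"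
  shows "\<exists>x. f x = 1 \<and> inner_d r (t x) y ^ (2 * k) = f y"
proof -
  define a where "a = root (2 * k) (f y)"
  have a: "a > 0" "a ^ (2 * k) = f y" using assms k by (simp_all add: a_def)
  define x where "x i = (1 / a) * y i" for i
  have "f x = (1 / a) ^ (2 * k) * f y" unfolding x_def[abs_def] by (rule f_scale)
  then have fx: "f x = 1" using a assms by (simp add: power_divide)
  have "inner_d r (t x) x = (1 / a) * inner_d r (t x) y" unfolding x_def[abs_def] by (rule inner_d_scale)
  then have "inner_d r (t x) y = a" using fx inner_t_self[of x] a by simp
  then show ?thesis using fx a by blast
qed

text \<open>By \<open>f_normalize\<close> the normalised point of each \<open>y\<close> attains
  \<open>f y\<close>. Losing the factor \<open>2 ^ (2 * k)\<close> turns equality into an open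
  condition on \<open>y\<close>, and Lindelof's theorem selects countably many functionals.\<close>

lemma countable_norming:
  assumes "f y0 > 0"
  shows "\<exists>x :: nat \<Rightarrow> nat \<Rightarrow> real. (\<forall>n. f (x n) = 1) \<and> (\<forall>y. f y > 0 \<longrightarrow> (\<exists>n. f y \<le> 2 ^ (2 * k) * inner_d r (t (x n)) y ^ (2 * k)))"
proof -
  define U where "U x = {y. f y < 2 ^ (2 * k) * inner_d r (t x) y ^ (2 * k)}" for x
  define F where "F = {x. f x = 1}"
  have openU: "open (U x)" for x
    unfolding U_def by (intro open_Collect_less continuous_intros continuous_f continuous_inner)
  obtain V where V: "V \<subseteq> U ` F" "countable V" "\<Union>V = \<Union>(U ` F)"
    by (rule Lindelof[of "U ` F"]) (use openU in blast)
  have "\<exists>F'. countable F' \<and> F' \<subseteq> F \<and> V = U ` F'"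
    using V(1,2) by (subst countable_subset_image[symmetric]) simp
  then obtain F' where F': "countable F'" "F' \<subseteq> F" "V = U ` F'" by blast
  have cov: "\<exists>x\<in>F'. y \<in> U x" if y: "f y > 0" for y
  proof -
    obtain x where x: "f x = 1" "inner_d r (t x) y ^ (2 * k) = f y" using f_normalize[OF y] by blast
    have "(1::real) < 2 ^ (2 * k)" using k by (intro one_less_power) auto
    then have "y \<in> U x" using x y by (simp add: U_def)
    then have "y \<in> \<Union>(U ` F)" using x by (auto simp: F_def)
    then show ?thesis using V(3) F'(3) by auto
  qed
  then have "F' \<noteq> {}" using assms by blast
  then have r: "range (from_nat_into F') = F'" using F'(1) by (rule range_from_nat_into)
  show ?thesis
  proof (intro exI[of _ "from_nat_into F'"] conjI allI impI)
    show "f (from_nat_into F' n) = 1" for n using r F'(2) by (auto simp: F_def)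
    fix y assume "f y > 0"
    then obtain x where "x \<in> F'" "y \<in> U x" using cov by blast
    moreover then obtain n where "x = from_nat_into F' n" using r by blast
    ultimately show "\<exists>n. f y \<le> 2 ^ (2 * k) * inner_d r (t (from_nat_into F' n)) y ^ (2 * k)"
      by (auto simp: U_def intro: less_imp_le)
  qed
qed

text \<open>The maximal inequality concerns finite sets, with a bound that ignores their size. It is
  therefore applied on the event \<open>S n\<close> where the first functionals already norm
  \<open>f\<close>, and these events exhaust the points with \<open>f (Y z) > 0\<close>.\<close>

theorem subgaussian_f_le:
  fixes Y :: "'w \<Rightarrow> nat \<Rightarrow> real"
  assumes M: "prob_space M"
    and int: "\<And>v q. integrable M (\<lambda>z. inner_d r v (Y z) ^ q)"
    and sub: "\<And>v q. even q \<Longrightarrow> q > 0 \<Longrightarrow> (\<integral>z. inner_d r v (Y z) ^ q \<partial>M) \<le> (K * sqrt q * norm_d r v) ^ q"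
    and K: "K > 0"
  shows "(\<integral>z. f (Y z) \<partial>M) \<le> (104865920 * K * sqrt (2 * k)) ^ (2 * k)"
proof (cases "\<exists>y. f y > 0")
  case False
  then have "f y = 0" for y using f_nonneg[of y] by (simp add: antisym not_less)
  then show ?thesis using K by simp
next
  case True
  then obtain x :: "nat \<Rightarrow> nat \<Rightarrow> real" where x: "\<And>n. f (x n) = 1"
    and cov: "\<And>y. f y > 0 \<Longrightarrow> \<exists>n. f y \<le> 2 ^ (2 * k) * inner_d r (t (x n)) y ^ (2 * k)"
    using countable_norming by blast
  define s where "s = sqrt (real (2 * k))"
  have s1: "s \<ge> 1" using k by (simp add: s_def)
  define B where "B = (2 * (16 * K * s * 2 + 256 * K * (4 * 2 + 51200 * (2 * s)))) ^ (2 * k)"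
  define S where "S n = {z \<in> space M. \<exists>j\<le>n. f (Y z) \<le> 2 ^ (2 * k) * inner_d r (t (x j)) (Y z) ^ (2 * k)}" for n
  have fi: "integrable M (\<lambda>z. f (Y z))" by (rule f_integrable[OF int])
  have Sm: "S n \<in> sets M" for n
  proof -
    have [measurable]: "(\<lambda>z. f (Y z)) \<in> borel_measurable M" using fi by auto
    have [measurable]: "(\<lambda>z. inner_d r v (Y z)) \<in> borel_measurable M" for v
      using borel_measurable_integrable[OF int[of v 1]] by simp
    show ?thesis unfolding S_def by measurable
  qed
  have ifi: "integrable M (\<lambda>z. indicator (S n) z * f (Y z))" for n
    using integrable_mult_indicator[OF Sm fi, of n] by simp
  have bound: "(\<integral>z. indicator (S n) z * f (Y z) \<partial>M) \<le> 2 ^ (2 * k) * B" for n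
  proof -
    define T where "T = (\<lambda>j. t (x j)) ` {..n}"
    have "\<exists>R. integrable M R \<and> (\<forall>u\<in>T. \<forall>z. inner_d r u (Y z) ^ (2 * k) \<le> R z) \<and>
      (\<integral>z. R z \<partial>M) \<le> (2 * (16 * K * sqrt (real (2 * k)) * 2 + 256 * K * (4 * 2 + 51200 * (2 * s)))) ^ (2 * k)"
    proof (rule subgaussian_max_moment[OF M _ _ int sub K])
      show "gwidth r T \<le> 2 * s" unfolding s_def
        by (rule gwidth_le) (auto simp: T_def x)
      show "norm_d r u \<le> 2" if "u \<in> T" for u using that x by (auto simp: T_def intro: norm_t_le)
    qed (use k in \<open>auto simp: T_def\<close>)
    then obtain R where R: "integrable M R" "\<And>u z. u \<in> T \<Longrightarrow> inner_d r u (Y z) ^ (2 * k) \<le> R z" "(\<integral>z. R z \<partial>M) \<le> B"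
      by (auto simp: B_def s_def)
    have R0: "0 \<le> R z" for z
      by (rule order_trans[OF _ R(2)[of "t (x 0)"]]) (auto simp: T_def intro: zero_le_even_power)
    have "(\<integral>z. indicator (S n) z * f (Y z) \<partial>M) \<le> (\<integral>z. 2 ^ (2 * k) * R z \<partial>M)"
    proof (rule integral_mono[OF ifi])
      show "integrable M (\<lambda>z. 2 ^ (2 * k) * R z)" using R by simp
      fix z
      show "indicator (S n) z * f (Y z) \<le> 2 ^ (2 * k) * R z"
      proof (cases "z \<in> S n")
        case True
        then obtain j where j: "j \<le> n" "f (Y z) \<le> 2 ^ (2 * k) * inner_d r (t (x j)) (Y z) ^ (2 * k)"
          by (auto simp: S_def)
        have "2 ^ (2 * k) * inner_d r (t (x j)) (Y z) ^ (2 * k) \<le> 2 ^ (2 * k) * R z"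
          using j by (intro mult_left_mono R(2)) (auto simp: T_def)
        with j(2) have "f (Y z) \<le> 2 ^ (2 * k) * R z" by (rule order_trans)
        then show ?thesis using True by simp
      qed (use R0[of z] in simp)
    qed
    also have "\<dots> \<le> 2 ^ (2 * k) * B" using R by simp
    finally show ?thesis .
  qed
  have lim: "(\<lambda>n. \<integral>z. indicator (S n) z * f (Y z) \<partial>M) \<longlonglongrightarrow> (\<integral>z. f (Y z) \<partial>M)"
  proof (rule integral_dominated_convergence[where w="\<lambda>z. f (Y z)"])
    show "AE z in M. (\<lambda>n. indicator (S n) z * f (Y z)) \<longlonglongrightarrow> f (Y z)"
    proof (rule AE_I2)
      fix z assume z: "z \<in> space M"
      show "(\<lambda>n. indicator (S n) z * f (Y z)) \<longlonglongrightarrow> f (Y z)"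
      proof (cases "f (Y z) > 0")
        case True
        then obtain j where j: "f (Y z) \<le> 2 ^ (2 * k) * inner_d r (t (x j)) (Y z) ^ (2 * k)" using cov by blast
        have "indicator (S n) z * f (Y z) = f (Y z)" if "n \<ge> j" for n
        proof -
          have "z \<in> S n" using that z j unfolding S_def by blast
          then show ?thesis by simp
        qed
        then show ?thesis by (intro tendsto_eventually eventually_sequentiallyI[of j]) auto
      next
        case False
        then have "f (Y z) = 0" using f_nonneg[of "Y z"] by simp
        then show ?thesis by simp
      qed
    qed
    show "AE z in M. norm (indicator (S n) z * f (Y z)) \<le> f (Y z)" for n
      using f_nonneg by (auto simp: indicator_def)
  qed (use fi ifi in auto)
  have "(\<integral>z. f (Y z) \<partial>M) \<le> 2 ^ (2 * k) * B"
    by (rule LIMSEQ_le_const2[OF lim]) (use bound in auto)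
  also have "\<dots> = (2 * (2 * (16 * K * s * 2 + 256 * K * (4 * 2 + 51200 * (2 * s))))) ^ (2 * k)"
    unfolding B_def by (rule power_mult_distrib[symmetric])
  \<comment> \<open>The product expands to
    \<open>128 * K * s + 8192 * K + 104857600 * K * s\<close>; since \<open>s \<ge> 1\<close> the
    middle term is absorbed, and the coefficients add up to 104865920.\<close>
  also have "\<dots> \<le> (104865920 * K * s) ^ (2 * k)"
  proof (rule power_mono)
    have "K \<le> K * s" using K s1 by simp
    then show "2 * (2 * (16 * K * s * 2 + 256 * K * (4 * 2 + 51200 * (2 * s)))) \<le> 104865920 * K * s"
      by (simp add: algebra_simps)
  qed (use K s1 in auto)
  finally show ?thesis by (simp add: s_def)
qed

end

text \<open>The constant exceeds that of \<open>subgaussian_f_le\<close> by 1: separation gives only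
  a value at most 0, and the gap makes the value strictly positive.\<close>

theorem isotropic_sos:
  fixes Y :: "'w \<Rightarrow> nat \<Rightarrow> real"
  assumes M: "prob_space M"
    and int: "\<And>v q. integrable M (\<lambda>z. inner_d r v (Y z) ^ q)"
    and sub: "\<And>v q. even q \<Longrightarrow> q > 0 \<Longrightarrow> (\<integral>z. inner_d r v (Y z) ^ q \<partial>M) \<le> (K * sqrt q * norm_d r v) ^ q"
    and K: "K > 0" and k: "k > 0"
  shows "sos r k (\<lambda>w. (104865921 * K * sqrt (2 * k)) ^ (2 * k) * sq r w ^ k - (\<integral>z. inner_d r w (Y z) ^ (2 * k) \<partial>M))"
    (is "sos r k ?q")
proof (rule ccontr)
  assume nq: "\<not> sos r k ?q"
  have fm: "form r (2 * k) (\<lambda>w. \<integral>z. inner_d r w (Y z) ^ (2 * k) \<partial>M)"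
    unfolding moment_expand[OF int k] by (intro form_sum form_scale form_mon)
  have q: "form r (2 * k) ?q" by (intro form_diff form_scale form_sq_power fm)
  obtain L where L: "pos_functional r k L" "L ?q \<le> 0" using not_sos_imp_functional[OF q nq] by blast
  interpret positive_functional r k L by standard (use L k in auto)
  have "L ?q = (104865921 * K * sqrt (2 * k)) ^ (2 * k) - (\<integral>z. f (Y z) \<partial>M)"
    using L_diff[OF form_scale[OF form_sq_power] fm] L_scale[OF form_sq_power] f_expectation[OF int] by (simp add: L_sq)
  moreover have "(\<integral>z. f (Y z) \<partial>M) \<le> (104865920 * K * sqrt (2 * k)) ^ (2 * k)"
    by (rule subgaussian_f_le[OF M int sub K])
  moreover have "(104865920 * K * sqrt (2 * k)) ^ (2 * k) < (104865921 * K * sqrt (2 * k)) ^ (2 * k)"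
    using K k by (intro power_strict_mono) auto
  ultimately show False using L(2) by linarith
qed

section \<open>Whitening\<close>

lemma inner_d_add: "inner_d r (\<lambda>i. v i + w i) x = inner_d r v x + inner_d r w x"
  by (simp add: inner_d_def algebra_simps sum.distrib)

lemma inner_d_scale_left: "inner_d r (\<lambda>i. a * v i) x = a * inner_d r v x"
  by (simp add: inner_d_def sum_distrib_left mult.assoc)

lemma inner_d_sum: "inner_d d (\<lambda>j. \<Sum>k\<in>I. c k * u k j) x = (\<Sum>k\<in>I. c k * inner_d d (u k) x)"
  unfolding inner_d_def sum_distrib_left sum_distrib_right by (subst sum.swap) (simp add: mult_ac)

text \<open>Gram-Schmidt in L2: the residual of a coordinate is dropped when it vanishes almost surely,
  so the covariance may be degenerate.\<close>

lemma whitening: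
  fixes Z :: "'w \<Rightarrow> nat \<Rightarrow> real"
  assumes int: "\<And>v w. integrable M (\<lambda>z. inner_d d v (Z z) * inner_d d w (Z z))"
    and n: "n \<le> d"
  shows "\<exists>(r::nat) u l. (\<forall>j<r. \<forall>k<r. (\<integral>z. inner_d d (u j) (Z z) * inner_d d (u k) (Z z) \<partial>M) = (if j = k then 1 else 0)) \<and>
    (\<forall>i<n. AE z in M. Z z i = (\<Sum>k<r. l i k * inner_d d (u k) (Z z)))"
  using n
proof (induction n)
  case 0
  show ?case by (intro exI[of _ "0::nat"]) auto
next
  case (Suc n)
  define ip where "ip v w = (\<integral>z. inner_d d v (Z z) * inner_d d w (Z z) \<partial>M)" for v w
  from Suc.IH[OF Suc_leD[OF Suc.prems]] obtain r :: nat and u l where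
    rul: "\<forall>j<r. \<forall>k<r. ip (u j) (u k) = (if j = k then 1 else 0)"
      "\<forall>i<n. AE z in M. Z z i = (\<Sum>k<r. l i k * inner_d d (u k) (Z z))"
    unfolding ip_def[symmetric] by (elim exE conjE) (rule that)
  have orth: "ip (u j) (u k) = (if j = k then 1 else 0)" if "j < r" "k < r" for j k
    using rul(1) that by blast
  have l: "AE z in M. Z z i = (\<Sum>k<r. l i k * inner_d d (u k) (Z z))" if "i < n" for i
    using rul(2) that by blast
  define e :: "nat \<Rightarrow> real" where "e j = (if j = n then 1 else 0)" for j
  have e: "inner_d d e x = x n" for x using Suc.prems inner_d_basis[of n d x] by (simp add: e_def[abs_def])
  define c where "c k = ip e (u k)" for k
  define v where "v j = e j - (\<Sum>k<r. c k * u k j)" for j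
  have v: "inner_d d v x = x n - (\<Sum>k<r. c k * inner_d d (u k) x)" for x
    unfolding v_def[abs_def] inner_d_diff inner_d_sum e ..
  have ip_com: "ip a b = ip b a" for a b by (simp add: ip_def mult.commute)
  have vu: "ip v (u k) = 0" if k: "k < r" for k
  proof -
    have "ip v (u k) = (\<integral>z. inner_d d e (Z z) * inner_d d (u k) (Z z) - (\<Sum>j<r. c j * (inner_d d (u j) (Z z) * inner_d d (u k) (Z z))) \<partial>M)"
      unfolding ip_def v e by (simp add: left_diff_distrib sum_distrib_right mult.assoc)
    also have "\<dots> = ip e (u k) - (\<Sum>j<r. c j * ip (u j) (u k))"
      unfolding ip_def by (simp add: int Bochner_Integration.integral_sum Bochner_Integration.integrable_sum)
    also have "(\<Sum>j<r. c j * ip (u j) (u k)) = (\<Sum>j<r. if j = k then c j else 0)"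
      using k orth by (intro sum.cong) auto
    also have "\<dots> = c k" using k by simp
    finally show ?thesis by (simp add: c_def)
  qed
  have vv0: "0 \<le> ip v v" unfolding ip_def by (intro integral_nonneg_AE) auto
  show ?case
  proof (cases "ip v v = 0")
    case True
    have "AE z in M. inner_d d v (Z z) * inner_d d v (Z z) = 0"
      using True int[of v v] unfolding ip_def by (subst (asm) integral_nonneg_eq_0_iff_AE) auto
    then have "AE z in M. Z z n = (\<Sum>k<r. c k * inner_d d (u k) (Z z))"
      by eventually_elim (simp add: v)
    then have AE: "AE z in M. Z z i = (\<Sum>k<r. (l(n := c)) i k * inner_d d (u k) (Z z))" if "i < Suc n" for i
      using l[of i] that by (cases "i = n") auto
    show ?thesis unfolding ip_def[symmetric]
    proof (rule exI[of _ r], rule exI[of _ u], rule exI[of _ "l(n := c)"], intro conjI allI impI)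
      show "ip (u j) (u k) = (if j = k then 1 else 0)" if "j < r" "k < r" for j k
        by (rule orth[OF that])
    qed (rule AE)
  next
    case False
    define s where "s = sqrt (ip v v)"
    have s: "s > 0" "s * s = ip v v" using False vv0 by (auto simp: s_def)
    define u' where "u' = u(r := (\<lambda>j. (1 / s) * v j))"
    \<comment> \<open>Earlier coordinates get coefficient 0 at the new direction, whereas coordinate
      \<open>n\<close> gets the norm \<open>s\<close> of its residual.\<close>
    define l' where "l' i k = (if i = n then (if k = r then s else c k) else if k = r then 0 else l i k)" for i k
    have ip_s: "ip (\<lambda>j. a * p j) q = a * ip p q" for a p q
      by (simp add: ip_def inner_d_scale_left mult.assoc)
    have uo: "u' k = u k" if "k < r" for k using that by (simp add: u'_def)
    have ur: "u' r = (\<lambda>j. (1 / s) * v j)" by (simp add: u'_def)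
    have "ip (u' r) (u' r) = 1"
    proof -
      have "ip (u' r) (u' r) = (1 / s) * ip v (\<lambda>j. (1 / s) * v j)" unfolding ur by (rule ip_s)
      also have "ip v (\<lambda>j. (1 / s) * v j) = ip (\<lambda>j. (1 / s) * v j) v" by (rule ip_com)
      also have "\<dots> = (1 / s) * ip v v" by (rule ip_s)
      finally show ?thesis using s(1) by (simp add: s(2)[symmetric])
    qed
    moreover have "ip (u' r) (u k) = 0" if "k < r" for k
      using ip_s[of "1 / s" v "u k"] vu[OF that] by (simp only: ur mult_zero_right)
    ultimately have orth': "ip (u' j) (u' k) = (if j = k then 1 else 0)" if "j < Suc r" "k < Suc r" for j k
      using that orth[of j k] uo ip_com[of "u' j" "u' k"] by (auto simp: less_Suc_eq)
    have AE: "AE z in M. Z z i = (\<Sum>k<Suc r. l' i k * inner_d d (u' k) (Z z))" if i: "i < Suc n" for i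
    proof (cases "i = n")
      case True
      have "(\<Sum>k<Suc r. l' n k * inner_d d (u' k) x) = (\<Sum>k<r. c k * inner_d d (u k) x) + s * ((1 / s) * inner_d d v x)" for x
        by (simp add: l'_def uo ur inner_d_scale_left del: times_divide_eq_left)
      then show ?thesis using s True by (simp add: v)
    next
      case False
      have "(\<Sum>k<Suc r. l' i k * inner_d d (u' k) x) = (\<Sum>k<r. l i k * inner_d d (u k) x)" for x
        using False by (simp add: l'_def uo)
      then show ?thesis using l[of i] i False by simp
    qed
    show ?thesis unfolding ip_def[symmetric]
    proof (rule exI[of _ "Suc r"], rule exI[of _ u'], rule exI[of _ l'], intro conjI allI impI)
      show "ip (u' j) (u' k) = (if j = k then 1 else 0)" if "j < Suc r" "k < Suc r" for j k
        by (rule orth'[OF that])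
    qed (rule AE)
  qed
qed

section \<open>From forms in whitened coordinates to polynomials in the original ones\<close>

lemma poly_fun_sum: "finite I \<Longrightarrow> (\<And>i. i \<in> I \<Longrightarrow> poly_fun d (p i)) \<Longrightarrow> poly_fun d (\<lambda>v. \<Sum>i\<in>I. p i v)"
  by (induction I rule: finite_induct) (auto intro: poly_fun.intros)

lemma form_imp_poly_fun:
  assumes "form r n p" and g: "\<And>k. poly_fun d (\<lambda>v. g v k)"
  shows "poly_fun d (\<lambda>v. p (g v))"
proof -
  obtain c where c: "p = lincomb r n c" using assms by (auto simp: form_def)
  have "poly_fun d (\<lambda>v. mon xs (g v))" for xs
    by (induction xs) (auto intro: poly_fun.intros g)
  then show ?thesis unfolding c lincomb_def
    by (intro poly_fun_sum finite_words poly_fun.mult poly_fun.const)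
qed

text \<open>A sum-of-squares identity survives any polynomial substitution; \<open>g\<close> will be
  the linear passage to whitened coordinates.\<close>

lemma sos_imp_sos_poly:
  assumes "sos r n p" and g: "\<And>k. poly_fun d (\<lambda>v. g v k)"
  shows "sos_poly d (\<lambda>v. p (g v))"
proof -
  obtain hs where hs: "\<forall>h\<in>set hs. form r n h" "p = (\<lambda>w. \<Sum>h\<leftarrow>hs. (h w)\<^sup>2)" using assms by (auto simp: sos_def)
  show ?thesis unfolding sos_poly_def
    by (intro exI[of _ "map (\<lambda>h v. h (g v)) hs"])
       (use hs g in \<open>auto simp: o_def intro: form_imp_poly_fun\<close>)
qed

lemma powr_inverse_le_imp:
  fixes x y :: real
  assumes "x powr (1 / real q) \<le> y" "0 \<le> x" "q > 0"
  shows "x \<le> y ^ q"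
proof (cases "x = 0")
  case True
  then show ?thesis using assms by simp
next
  case False
  then have "x = (x powr (1 / real q)) ^ q" using assms by (simp add: powr_power)
  also have "\<dots> \<le> y ^ q" using assms by (intro power_mono) auto
  finally show ?thesis .
qed

theorem theorem1p10:
  fixes C0 :: real
  assumes "gaussian_moment_const C0"
  shows "\<exists>C>0. \<forall>(d::nat) (s::real) P.
           s > 0 \<and> hypercontractive_subgaussian C0 d s P \<longrightarrow>
           certifiably_hypercontractive_subgaussian C0 d (C * s) P"
proof (intro exI[of _ 104865921] conjI allI impI)
  fix d :: nat and s :: real and P :: "(nat \<Rightarrow> real) measure"
  assume a: "s > 0 \<and> hypercontractive_subgaussian C0 d s P"
  have C0: "C0 > 0" using assms by (simp add: gaussian_moment_const_def)
  define K where "K = C0 * s"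
  have K: "K > 0" using C0 a by (simp add: K_def)
  define Z where "Z x i = x i - mean_d P i" for x :: "nat \<Rightarrow> real" and i
  have Zeq: "(\<lambda>i. x i - mean_d P i) = Z x" for x by (simp add: Z_def fun_eq_iff)
  have distr: "distr_d d P" using a by (simp add: hypercontractive_subgaussian_def)
  then have M: "prob_space P" and int: "\<And>v q. integrable P (\<lambda>x. inner_d d v (Z x) ^ q)"
    by (auto simp: distr_d_def Zeq)
  have dm: "dir_moment d P q v = (\<integral>x. inner_d d v (Z x) ^ q \<partial>P)" for q v
    by (simp add: dir_moment_def Zeq)
  have sub: "dir_moment d P q v \<le> (K * sqrt q * sqrt (dir_moment d P 2 v)) ^ q" if "even q" "q > 0" for q v
  proof (rule powr_inverse_le_imp)
    show "dir_moment d P q v powr (1 / real q) \<le> K * sqrt q * sqrt (dir_moment d P 2 v)"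
      using a that by (simp add: hypercontractive_subgaussian_def K_def)
    show "0 \<le> dir_moment d P q v" unfolding dm using that by (intro integral_nonneg_AE) (auto simp: zero_le_even_power)
  qed (rule that)
  \<comment> \<open>Polarisation: integrability is given for powers of a single linear form, while
    whitening needs products of two.\<close>
  have int2: "integrable P (\<lambda>z. inner_d d v (Z z) * inner_d d w (Z z))" for v w
  proof -
    have "(\<lambda>z. inner_d d v (Z z) * inner_d d w (Z z))
      = (\<lambda>z. (1 / 2) * (inner_d d (\<lambda>i. v i + w i) (Z z) ^ 2 - inner_d d v (Z z) ^ 2 - inner_d d w (Z z) ^ 2))"
      by (simp add: inner_d_add power2_eq_square algebra_simps)
    then show ?thesis using int by (simp only:) (intro integrable_mult_right Bochner_Integration.integrable_diff int)
  qed
  from whitening[of P d Z d, OF int2 order_refl] obtain r :: nat and u l where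
    rul: "\<forall>j<r. \<forall>k<r. (\<integral>z. inner_d d (u j) (Z z) * inner_d d (u k) (Z z) \<partial>P) = (if j = k then 1 else 0)"
      "\<forall>i<d. AE z in P. Z z i = (\<Sum>k<r. l i k * inner_d d (u k) (Z z))"
    by (elim exE conjE) (rule that)
  have orth: "(\<integral>z. inner_d d (u j) (Z z) * inner_d d (u k) (Z z) \<partial>P) = (if j = k then 1 else 0)"
    if "j < r" "k < r" for j k using rul(1) that by blast
  have l: "AE z in P. Z z i = (\<Sum>k<r. l i k * inner_d d (u k) (Z z))" if "i < d" for i
    using rul(2) that by blast
  define Y where "Y z k = inner_d d (u k) (Z z)" for z k
  \<comment> \<open>\<open>pull\<close> and \<open>g\<close> go in opposite directions:
    \<open>pull\<close> writes a linear form in \<open>Y\<close> as one in \<open>Z\<close> and so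
    transfers the hypothesis, whereas \<open>g\<close> writes a direction \<open>v\<close> in
    whitened coordinates and so transfers the certificate back.\<close>
  define pull where "pull w j = (\<Sum>k<r. w k * u k j)" for w j
  define g where "g v k = (\<Sum>i<d. v i * l i k)" for v k
  have innerY: "inner_d r w (Y z) = inner_d d (pull w) (Z z)" for w z
    unfolding pull_def[abs_def] inner_d_sum by (simp add: inner_d_def[of r] Y_def)
  have second: "(\<integral>z. inner_d r w (Y z) ^ 2 \<partial>P) = sq r w" for w
  proof -
    have "(\<lambda>z. inner_d r w (Y z) ^ 2) = (\<lambda>z. \<Sum>j<r. \<Sum>k<r. (w j * w k) * (inner_d d (u j) (Z z) * inner_d d (u k) (Z z)))"
      unfolding inner_d_def[of r] Y_def power2_eq_square sum_product by (intro ext sum.cong refl) (simp add: mult_ac)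
    then have "(\<integral>z. inner_d r w (Y z) ^ 2 \<partial>P)
      = (\<Sum>j<r. \<Sum>k<r. (w j * w k) * (\<integral>z. inner_d d (u j) (Z z) * inner_d d (u k) (Z z) \<partial>P))"
      by (simp add: int2 Bochner_Integration.integral_sum Bochner_Integration.integrable_sum)
    also have "\<dots> = (\<Sum>j<r. \<Sum>k<r. if j = k then w j * w k else 0)"
      using orth by (intro sum.cong) auto
    also have "\<dots> = sq r w" by (simp add: sq_def power2_eq_square)
    finally show ?thesis .
  qed
  have AE_eq: "AE z in P. inner_d d v (Z z) = inner_d r (g v) (Y z)" for v
  proof -
    have "AE z in P. \<forall>i\<in>{..<d}. Z z i = (\<Sum>k<r. l i k * inner_d d (u k) (Z z))"
      using l by (intro AE_finite_allI) auto
    then show ?thesis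
    proof eventually_elim
      case (elim z)
      have "inner_d d v (Z z) = (\<Sum>i<d. v i * (\<Sum>k<r. l i k * Y z k))"
        unfolding inner_d_def[of d v] using elim by (intro sum.cong) (auto simp: Y_def)
      also have "\<dots> = inner_d r (g v) (Y z)"
        unfolding inner_d_def g_def sum_distrib_left sum_distrib_right
        by (subst sum.swap) (simp add: mult_ac)
      finally show ?case .
    qed
  qed
  \<comment> \<open>The representation of \<open>Z\<close> by \<open>Y\<close> holds almost surely,
    which suffices for moments. Hence the identity is exact for every \<open>v\<close>, as a
    polynomial certificate requires, even if the covariance is degenerate.\<close>
  have mom: "dir_moment d P q v = (\<integral>z. inner_d r (g v) (Y z) ^ q \<partial>P)" for q v
    unfolding dm
  proof (rule integral_cong_AE)
    show "AE z in P. inner_d d v (Z z) ^ q = inner_d r (g v) (Y z) ^ q"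
      using AE_eq[of v] by eventually_elim simp
  qed (use int in \<open>auto simp: innerY\<close>)
  have subY: "(\<integral>z. inner_d r w (Y z) ^ q \<partial>P) \<le> (K * sqrt q * norm_d r w) ^ q" if "even q" "q > 0" for q w
  proof -
    have "dir_moment d P 2 (pull w) = sq r w" using second[of w] by (simp add: dm innerY)
    then have "sqrt (dir_moment d P 2 (pull w)) = norm_d r w" by (simp add: norm_d_def sq_def)
    then show ?thesis using sub[OF that, of "pull w"] by (simp add: dm innerY)
  qed
  have g_poly: "poly_fun d (\<lambda>v. g v k)" for k
    unfolding g_def by (intro poly_fun_sum poly_fun.mult poly_fun.var poly_fun.const) auto
  have "sos_poly d (\<lambda>v. (C0 * (104865921 * s) * sqrt (real m)) ^ m * (dir_moment d P 2 v) ^ (m div 2) - dir_moment d P m v)"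
    if "even m" "m > 0" for m
  proof -
    obtain k where k: "m = 2 * k" "k > 0" using \<open>even m\<close> \<open>m > 0\<close> by (auto elim: evenE)
    have "sos r k (\<lambda>w. (104865921 * K * sqrt (2 * k)) ^ (2 * k) * sq r w ^ k - (\<integral>z. inner_d r w (Y z) ^ (2 * k) \<partial>P))"
      by (rule isotropic_sos[OF M _ subY K k(2)]) (simp add: innerY int)
    from sos_imp_sos_poly[OF this g_poly]
    show ?thesis by (simp add: k mom second K_def mult_ac)
  qed
  then show "certifiably_hypercontractive_subgaussian C0 d (104865921 * s) P"
    using distr by (simp add: certifiably_hypercontractive_subgaussian_def)
qed simp

end
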